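(* Let $n\in\mathbb N$, let $p_0$ be nonzero a.e. with $p_0,1/p_0\in L(0,1)$, let $b$ be measurable with $b^2=p_0$, and let $p_k\in W_{2,1/b}^{-k}$, $k=\overline{1,n}$, $q_\nu\in W_{2,1/b}^{-\nu}$, $\nu=\overline{0,n-1}$. For $y\in W_{2,b}^n$ consider $$\ell_{2n}y:=\sum_{k=0}^n\big(p_ky^{(n-k)}\big)^{(n-k)}+i\sum_{k=0}^{n-1}\Big(\big(q_ky^{(n-k-1)}\big)^{(n-k)}+\big(q_ky^{(n-k)}\big)^{(n-k-1)}\Big),$$ a functional on $\mathring W_{2,b}^n$. Then $$\ell_{2n}y=\frac{d^n}{dx^n}\Big(By^{(n)}+Cy\Big),\ \text{i.e. } (\ell_{2n}y,\varphi)=(-1)^n\int_0^1\big(By^{(n)}+Cy\big)\varphi^{(n)}dx\ \ \forall\varphi\in\mathring W^n_{2,b},$$ where $B$ maps $L_{2,b}$ bijectively onto $L_{2,1/b}$, $$Bf(x)=b^2(x)f(x)+\int_0^xK(x,t)f(t)\,dt,\qquad |K(x,t)|\le a(x)+a(t)\ \text{ with some } a\in L_{2,1/b},$$ $$Cy=\sum_{\nu=0}^{n-1}y^{(\nu)}(0)u_\nu(x),\quad u_\nu\in L_{2,1/b},$$ and $$K(x,t)=\sum_{k=1}^n\Bigg(\frac{(x-t)^{k-1}}{(k-1)!}\Big(P_k(x)+iQ_{k-1}(x)+(-1)^k\big(P_k(t)-iQ_{k-1}(t)\big)\Big)$$ $$+\sum_{\nu=1}^{k-1}(-1)^\nu\int_t^x\frac{(x-\tau)^{\nu-1}}{(\nu-1)!}\Big(\tbinom{k}{\nu}P_k(\tau)+i\big(\tbinom{k-1}{\nu}-\tbinom{k-1}{\nu-1}\big)Q_{k-1}(\tau)\Big)\frac{(\tau-t)^{k-1-\nu}}{(k-1-\nu)!}\,d\tau\Bigg),$$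 where $P_k,Q_{k-1}\in L_{2,1/b}$ are any functions with $P_k^{(k)}=p_k$, $Q_{k-1}^{(k-1)}=q_{k-1}$ (generalized derivatives), $k=\overline{1,n}$ ($Q_0=q_0$); $K$ does not depend on the choice of these primitives.
   Context: With $p=2$: $L_{2,b}$ is the space of measurable $f$ with $bf\in L_2(0,1)$, $L_{2,1/b}$ those $\sigma$ with $\sigma/b\in L_2(0,1)$. $W_{2,b}^k$: $g$ with $g,\dots,g^{(k-1)}\in AC[0,1]$, $g^{(k)}\in L_{2,b}$; $\mathring W_{2,b}^k$: those with $g^{(\nu)}(0)=g^{(\nu)}(1)=0$, $\nu<k$. $W_{2,1/b}^{-k}$ is the set of functionals $f$ on $\mathring W_{2,b}^k$ of the form $(f,\varphi)=(-1)^k\int_0^1\sigma\varphi^{(k)}dx$ with $\sigma\in L_{2,1/b}$; we write $f=\sigma^{(k)}$ (generalized derivative; for $k=0$, $f=\sigma$ is a function). Derivative of a functional: $(f',\varphi):=-(f,\varphi')$; product with a function $y\in W^k_{2,b}$: $(fy,\varphi):=(f,\varphi y)$. Each term of $\ell_{2n}y$ is thus a functional on some $\mathring W^j_{2,b}$, $j\le n$, regarded on $\mathring W^n_{2,b}$ by restriction. $\binom{k}{\nu}$ are binomial coefficients. *)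

theory Defs
  imports "HOL-Analysis.Analysis"
begin

definition L2w :: "(real \<Rightarrow> complex) \<Rightarrow> (real \<Rightarrow> complex) \<Rightarrow> bool" where
  "L2w w f \<longleftrightarrow> set_borel_measurable lebesgue {0..1} f \<and>
     set_integrable lebesgue {0..1} (\<lambda>x. (cmod (w x * f x))\<^sup>2)"

definition invw :: "(real \<Rightarrow> complex) \<Rightarrow> real \<Rightarrow> complex" where
  "invw b = (\<lambda>x. inverse (b x))"

text \<open>D is a family of derivatives (D 0 = g, D j = g^(j)) with g,...,g^(k-1) absolutely
  continuous on [0,1] and g^(j+1) (integrable) the derivative of g^(j), j<k.\<close>
definition ac_family :: "nat \<Rightarrow> (nat \<Rightarrow> real \<Rightarrow> complex) \<Rightarrow> bool" where
  "ac_family k D \<longleftrightarrow> (\<forall>j<k. set_integrable lebesgue {0..1} (D (Suc j)) \<and>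
     (\<forall>x\<in>{0..1}. D j x = D j 0 + set_lebesgue_integral lebesgue {0..x} (D (Suc j))))"

definition Wb :: "(real \<Rightarrow> complex) \<Rightarrow> nat \<Rightarrow> (nat \<Rightarrow> real \<Rightarrow> complex) \<Rightarrow> bool" where
  "Wb b k D \<longleftrightarrow> ac_family k D \<and> L2w b (D k)"

definition W0b :: "(real \<Rightarrow> complex) \<Rightarrow> nat \<Rightarrow> (nat \<Rightarrow> real \<Rightarrow> complex) \<Rightarrow> bool" where
  "W0b b k D \<longleftrightarrow> Wb b k D \<and> (\<forall>\<nu><k. D \<nu> 0 = 0 \<and> D \<nu> 1 = 0)"

text \<open>Functionals act on (derivative families of) test functions phi.\<close>
type_synonym fnl = "(nat \<Rightarrow> real \<Rightarrow> complex) \<Rightarrow> complex"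

definition gder :: "nat \<Rightarrow> (real \<Rightarrow> complex) \<Rightarrow> fnl" where
  "gder k \<sigma> = (\<lambda>D. (-1)^k * set_lebesgue_integral lebesgue {0..1} (\<lambda>x. \<sigma> x * D k x))"

definition is_gder :: "(real \<Rightarrow> complex) \<Rightarrow> nat \<Rightarrow> (real \<Rightarrow> complex) \<Rightarrow> fnl \<Rightarrow> bool" where
  "is_gder b k \<sigma> f \<longleftrightarrow> (\<forall>D. W0b b k D \<longrightarrow> f D = gder k \<sigma> D)"

definition in_Wneg :: "(real \<Rightarrow> complex) \<Rightarrow> nat \<Rightarrow> fnl \<Rightarrow> bool" where
  "in_Wneg b k f \<longleftrightarrow> (\<exists>\<sigma>. L2w (invw b) \<sigma> \<and> is_gder b k \<sigma> f)"

definition shiftF :: "nat \<Rightarrow> (nat \<Rightarrow> real \<Rightarrow> complex) \<Rightarrow> nat \<Rightarrow> real \<Rightarrow> complex" where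
  "shiftF m Y = (\<lambda>j. Y (j + m))"

text \<open>Leibniz rule: derivative family of the product phi*z.\<close>
definition leib :: "(nat \<Rightarrow> real \<Rightarrow> complex) \<Rightarrow> (nat \<Rightarrow> real \<Rightarrow> complex) \<Rightarrow> nat \<Rightarrow> real \<Rightarrow> complex" where
  "leib D Z = (\<lambda>j x. \<Sum>i\<le>j. of_nat (j choose i) * D i x * Z (j - i) x)"

definition fmul :: "fnl \<Rightarrow> (nat \<Rightarrow> real \<Rightarrow> complex) \<Rightarrow> fnl" where
  "fmul f Z = (\<lambda>D. f (leib D Z))"

definition fder :: "fnl \<Rightarrow> fnl" where
  "fder f = (\<lambda>D. - f (shiftF 1 D))"

definition fdern :: "nat \<Rightarrow> fnl \<Rightarrow> fnl" where
  "fdern m f = (fder ^^ m) f"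

definition pfn :: "(real \<Rightarrow> complex) \<Rightarrow> (nat \<Rightarrow> fnl) \<Rightarrow> nat \<Rightarrow> fnl" where
  "pfn p0 p k = (if k = 0 then gder 0 p0 else p k)"

definition ell :: "nat \<Rightarrow> (real \<Rightarrow> complex) \<Rightarrow> (nat \<Rightarrow> fnl) \<Rightarrow> (nat \<Rightarrow> fnl)
    \<Rightarrow> (nat \<Rightarrow> real \<Rightarrow> complex) \<Rightarrow> fnl" where
  "ell n p0 p q Y = (\<lambda>D.
     (\<Sum>k\<le>n. fdern (n - k) (fmul (pfn p0 p k) (shiftF (n - k) Y)) D)
     + \<i> * (\<Sum>k<n. fdern (n - k) (fmul (q k) (shiftF (n - k - 1) Y)) D
                 + fdern (n - k - 1) (fmul (q k) (shiftF (n - k) Y)) D))"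

text \<open>The kernel K(x,t) (meant for 0 <= t <= x <= 1).\<close>
definition Kker :: "nat \<Rightarrow> (nat \<Rightarrow> real \<Rightarrow> complex) \<Rightarrow> (nat \<Rightarrow> real \<Rightarrow> complex) \<Rightarrow> real \<Rightarrow> real \<Rightarrow> complex" where
  "Kker n P Q x t = (\<Sum>k=1..n.
     of_real ((x - t) ^ (k - 1) / fact (k - 1)) *
       (P k x + \<i> * Q (k - 1) x + (-1) ^ k * (P k t - \<i> * Q (k - 1) t))
     + (\<Sum>\<nu>=1..k-1. (-1) ^ \<nu> * set_lebesgue_integral lebesgue {t..x} (\<lambda>\<tau>.
          of_real ((x - \<tau>) ^ (\<nu> - 1) / fact (\<nu> - 1)) *
          (of_nat (k choose \<nu>) * P k \<tau>
             + \<i> * (of_nat ((k - 1) choose \<nu>) - of_nat ((k - 1) choose (\<nu> - 1))) * Q (k - 1) \<tau>) *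
          of_real ((\<tau> - t) ^ (k - 1 - \<nu>) / fact (k - 1 - \<nu>)))))"

definition Bop :: "(real \<Rightarrow> complex) \<Rightarrow> (real \<Rightarrow> real \<Rightarrow> complex) \<Rightarrow> (real \<Rightarrow> complex) \<Rightarrow> real \<Rightarrow> complex" where
  "Bop b K f = (\<lambda>x. (b x)\<^sup>2 * f x + set_lebesgue_integral lebesgue {0..x} (\<lambda>t. K x t * f t))"

text \<open>B maps L_{2,b} bijectively onto L_{2,1/b} (elements are a.e.-classes).\<close>
definition L2_bij :: "(real \<Rightarrow> complex) \<Rightarrow> ((real \<Rightarrow> complex) \<Rightarrow> real \<Rightarrow> complex) \<Rightarrow> bool" where
  "L2_bij b B \<longleftrightarrow>
     (\<forall>f. L2w b f \<longrightarrow> L2w (invw b) (B f)) \<and>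
     (\<forall>f g. L2w b f \<longrightarrow> L2w b g \<longrightarrow> (AE x in lebesgue_on {0..1}. B f x = B g x)
        \<longrightarrow> (AE x in lebesgue_on {0..1}. f x = g x)) \<and>
     (\<forall>h. L2w (invw b) h \<longrightarrow> (\<exists>f. L2w b f \<and> (AE x in lebesgue_on {0..1}. B f x = h x)))"

definition primitives :: "(real \<Rightarrow> complex) \<Rightarrow> nat \<Rightarrow> (nat \<Rightarrow> fnl) \<Rightarrow> (nat \<Rightarrow> fnl)
    \<Rightarrow> (nat \<Rightarrow> real \<Rightarrow> complex) \<Rightarrow> (nat \<Rightarrow> real \<Rightarrow> complex) \<Rightarrow> bool" where
  "primitives b n p q P Q \<longleftrightarrow> (\<forall>k\<in>{1..n}.
     L2w (invw b) (P k) \<and> is_gder b k (P k) (p k) \<and>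
     L2w (invw b) (Q (k - 1)) \<and> is_gder b (k - 1) (Q (k - 1)) (q (k - 1)))"

end

theory Submission
  imports Defs
begin

text \<open>Unfolding all products by the Leibniz rule turns \<open>(\<ell>y, \<phi>)\<close> into a sum of integrals of products of
  the derivatives of order \<open>n - \<nu>\<close> of \<open>\<phi>\<close> and of order \<open>n - k + \<nu>\<close> of \<open>y\<close> with a linear combination of
  \<open>P\<^sub>k\<close> and \<open>Q\<^sub>k\<^sub>-\<^sub>1\<close>. Taylor's formula at \<open>1\<close> and at \<open>0\<close> expresses these derivatives through the \<open>n\<close>-th ones
  and the initial values of \<open>y\<close>, and Fubini's theorem on a triangle yields the kernel.
  Since \<open>\<bar>K(x,t)\<bar> \<le> A(x) A(t)\<close> with \<open>A/b\<close> square integrable, the iterates of the Volterra part of \<open>B\<close> are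
  dominated by \<open>S\<^sup>m/m!\<close>, where \<open>S\<close> is the primitive of \<open>A\<^sup>2/\<bar>p\<^sub>0\<bar>\<close>, whence \<open>B\<close> is bijective.
  Finally, two primitives of the same functional differ by a polynomial of degree less than \<open>k\<close>, and
  the kernel of such polynomials vanishes by repeated integration by parts.\<close>

section \<open>Absolutely continuous functions and integration by parts\<close>

text \<open>The weight has no pointwise bounds and enters only through the square integrability of b
  and 1/b. This already puts constants, hence all continuous functions, into both weighted spaces,
  and a product of two derivatives stays admissible as long as one factor is below top order and
  therefore continuous. The kernel evaluates \<open>P\<close> and \<open>Q\<close> at x and t, but
  the functionals determine these functions only almost everywhere. Hence the bound holds at every
  point of the triangle for fixed primitives, while independence of their choice is a statement
  about almost all x and t. The function (x - t)^j / j! plays three roles: Taylor kernel for y and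
  for the test function, moment kernel in the description of all primitives, and factor of the
  products that make polynomial primitives invisible. All three rest on the one formula
  \<open>ac_family_by_parts\<close>.\<close>

lemma sigma_finite_lebesgue: "sigma_finite_measure (lebesgue :: 'a::euclidean_space measure)"
proof -
  obtain A :: "'a set set" where A: "countable A" "A \<subseteq> sets lborel" "\<Union> A = space lborel"
    "\<forall>a\<in>A. emeasure lborel a \<noteq> \<infinity>"
    using sigma_finite_measure.sigma_finite_countable[OF sigma_finite_lborel] by blast
  show ?thesis
    by standard (use A in \<open>auto intro!: exI[of _ A]\<close>)
qed

interpretation lebesgue: sigma_finite_measure "lebesgue :: real measure"
  by (rule sigma_finite_lebesgue)

interpretation lebesgue_pair: pair_sigma_finite "lebesgue :: real measure" "lebesgue :: real measure"
  ..

lemma ident_lebesgue_borel [measurable]: "(\<lambda>x. x) \<in> lebesgue \<rightarrow>\<^sub>M (borel :: real measure)"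
  by (rule measurable_completion) simp

text \<open>Domination by M times the tensor product of two integrable functions suffices, so the
  bounded factor \<open>h\<close>, later a Taylor kernel, has to satisfy nothing but Borel
  measurability.\<close>

lemma set_integrable_triangle:
  fixes f g :: "real \<Rightarrow> 'a::{real_normed_field, banach, second_countable_topology}"
  assumes f: "set_integrable lebesgue {a..c} f" and g: "set_integrable lebesgue {a..c} g"
    and h: "(\<lambda>(x,t). h x t) \<in> borel_measurable (borel \<Otimes>\<^sub>M borel)"
    and bd: "\<And>x t. x \<in> {a..c} \<Longrightarrow> t \<in> {a..c} \<Longrightarrow> norm (h x t) \<le> M"
  shows "integrable (lebesgue \<Otimes>\<^sub>M lebesgue)
    (\<lambda>(x,t). indicator {a..c} x *\<^sub>R indicator {a..x} t *\<^sub>R (f x * (h x t * g t)))"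
proof -
  define F where "F = (\<lambda>x. indicator {a..c} x *\<^sub>R f x)"
  define G where "G = (\<lambda>x. indicator {a..c} x *\<^sub>R g x)"
  have F: "integrable lebesgue F" and G: "integrable lebesgue G"
    using f g by (auto simp: set_integrable_def F_def G_def)
  note [measurable] = borel_measurable_integrable[OF F] borel_measurable_integrable[OF G]
  have hm[measurable]: "(\<lambda>p. h (fst p) (snd p)) \<in> borel_measurable (lebesgue \<Otimes>\<^sub>M lebesgue)"
  proof -
    \<comment> \<open>The product of the two completed measures carries a finer sigma-algebra than
      the Borel one, so \<open>h\<close> is pulled back along the identity.\<close>
    have "(\<lambda>p. (fst p, snd p)) \<in> (lebesgue \<Otimes>\<^sub>M lebesgue) \<rightarrow>\<^sub>M (borel \<Otimes>\<^sub>M borel :: (real \<times> real) measure)"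
      by measurable
    from measurable_compose[OF this h] show ?thesis by simp
  qed
  have FG: "integrable (lebesgue \<Otimes>\<^sub>M lebesgue) (\<lambda>(x,t). F x * G t)"
  proof (rule lebesgue_pair.Fubini_integrable)
    show "integrable lebesgue (\<lambda>x. LINT y|lebesgue. norm (case (x, y) of (x, t) \<Rightarrow> F x * G t))"
      using F by (simp add: norm_mult)
    show "AE x in lebesgue. integrable lebesgue (\<lambda>y. case (x, y) of (x, t) \<Rightarrow> F x * G t)"
      using G by simp
  qed measurable
  have eq: "(\<lambda>(x,t). indicator {a..c} x *\<^sub>R indicator {a..x} t *\<^sub>R (f x * (h x t * g t))) =
     (\<lambda>p. (if a \<le> fst p \<and> fst p \<le> c \<and> a \<le> snd p \<and> snd p \<le> fst p then 1 else 0) *\<^sub>R (F (fst p) * (h (fst p) (snd p) * G (snd p))))"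
    by (auto simp: F_def G_def fun_eq_iff)
  show ?thesis
    unfolding eq
  proof (rule Bochner_Integration.integrable_bound[OF integrable_scaleR_right[OF FG, of M]])
    show "AE p in lebesgue \<Otimes>\<^sub>M lebesgue.
       norm ((if a \<le> fst p \<and> fst p \<le> c \<and> a \<le> snd p \<and> snd p \<le> fst p then 1 else 0) *\<^sub>R (F (fst p) * (h (fst p) (snd p) * G (snd p))))
       \<le> norm (M *\<^sub>R (case p of (x, t) \<Rightarrow> F x * G t))"
    proof (intro always_eventually allI)
      fix p :: "real \<times> real"
      obtain x t where p: "p = (x,t)" by (cases p)
      have "norm (F x) * (norm (h x t) * norm (G t)) \<le> norm (F x) * (\<bar>M\<bar> * norm (G t))"
        if "x \<in> {a..c}" "t \<in> {a..c}"
        using bd[OF that] by (intro mult_left_mono mult_right_mono) auto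
      then show "norm ((if a \<le> fst p \<and> fst p \<le> c \<and> a \<le> snd p \<and> snd p \<le> fst p then 1 else 0) *\<^sub>R (F (fst p) * (h (fst p) (snd p) * G (snd p))))
       \<le> norm (M *\<^sub>R (case p of (x, t) \<Rightarrow> F x * G t))"
        unfolding p by (auto simp: norm_mult mult_ac)
    qed
  qed measurable
qed

text \<open>Both iterated integrals arise from one integrable function on the square, cut off to a
  \<le> t \<le> x \<le> c. The two integrability claims have the same source; they are needed
  wherever an integral of a sum containing such a term is split.\<close>

lemma
  fixes f g :: "real \<Rightarrow> 'a::{real_normed_field, banach, second_countable_topology}"
  assumes f: "set_integrable lebesgue {a..c} f" and g: "set_integrable lebesgue {a..c} g"
    and h: "(\<lambda>(x,t). h x t) \<in> borel_measurable (borel \<Otimes>\<^sub>M borel)"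
    and bd: "\<And>x t. x \<in> {a..c} \<Longrightarrow> t \<in> {a..c} \<Longrightarrow> norm (h x t) \<le> M"
  shows set_integral_triangle_swap:
      "(LINT x:{a..c}|lebesgue. f x * (LINT t:{a..x}|lebesgue. h x t * g t)) =
       (LINT t:{a..c}|lebesgue. g t * (LINT x:{t..c}|lebesgue. f x * h x t))"
    and set_integrable_triangle_fst:
      "set_integrable lebesgue {a..c} (\<lambda>x. f x * (LINT t:{a..x}|lebesgue. h x t * g t))"
    and set_integrable_triangle_snd:
      "set_integrable lebesgue {a..c} (\<lambda>t. g t * (LINT x:{t..c}|lebesgue. f x * h x t))"
proof -
  let ?H = "\<lambda>x t. indicator {a..c} x *\<^sub>R indicator {a..x} t *\<^sub>R (f x * (h x t * g t))"
  have I: "integrable (lebesgue \<Otimes>\<^sub>M lebesgue) (\<lambda>(x,t). ?H x t)"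
    by (rule set_integrable_triangle[OF assms])
  have fst: "indicator {a..c} x *\<^sub>R (f x * (LINT t:{a..x}|lebesgue. h x t * g t)) = (LINT t|lebesgue. ?H x t)" for x
  proof -
    have "indicator {a..c} x *\<^sub>R (f x * (LINT t:{a..x}|lebesgue. h x t * g t))
        = (LINT t|lebesgue. indicator {a..c} x *\<^sub>R f x * (indicator {a..x} t *\<^sub>R (h x t * g t)))"
      unfolding set_lebesgue_integral_def integral_mult_right_zero by simp
    also have "\<dots> = (LINT t|lebesgue. ?H x t)"
      by (rule Bochner_Integration.integral_cong) (auto simp: indicator_def)
    finally show ?thesis .
  qed
  have snd: "indicator {a..c} t *\<^sub>R (g t * (LINT x:{t..c}|lebesgue. f x * h x t)) = (LINT x|lebesgue. ?H x t)" for t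
  proof -
    have "indicator {a..c} t *\<^sub>R (g t * (LINT x:{t..c}|lebesgue. f x * h x t))
        = (LINT x|lebesgue. indicator {a..c} t *\<^sub>R g t * (indicator {t..c} x *\<^sub>R (f x * h x t)))"
      unfolding set_lebesgue_integral_def integral_mult_right_zero by simp
    also have "\<dots> = (LINT x|lebesgue. ?H x t)"
      by (rule Bochner_Integration.integral_cong) (auto simp: indicator_def mult_ac)
    finally show ?thesis .
  qed
  show "(LINT x:{a..c}|lebesgue. f x * (LINT t:{a..x}|lebesgue. h x t * g t)) =
       (LINT t:{a..c}|lebesgue. g t * (LINT x:{t..c}|lebesgue. f x * h x t))"
    unfolding set_lebesgue_integral_def[of _ "{a..c}"] fst snd
    by (rule lebesgue_pair.Fubini_integral[symmetric, OF I])
  show "set_integrable lebesgue {a..c} (\<lambda>x. f x * (LINT t:{a..x}|lebesgue. h x t * g t))"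
    unfolding set_integrable_def fst using lebesgue_pair.integrable_fst[OF I] .
  show "set_integrable lebesgue {a..c} (\<lambda>t. g t * (LINT x:{t..c}|lebesgue. f x * h x t))"
    unfolding set_integrable_def snd using lebesgue_pair.integrable_snd[OF I] .
qed


text \<open>Absolute continuity is encoded by the fundamental theorem of calculus, with the
  derivative as an explicit datum determined only almost everywhere. The value type is general
  because the notion serves both the complex families and the real primitive \<open>S\<close> in the
  Volterra estimate.\<close>

definition ac_deriv :: "real \<Rightarrow> real \<Rightarrow> (real \<Rightarrow> 'a::{real_normed_field, euclidean_space}) \<Rightarrow> (real \<Rightarrow> 'a) \<Rightarrow> bool" where
  "ac_deriv a c F f \<longleftrightarrow> set_integrable lebesgue {a..c} f \<and>
     (\<forall>x\<in>{a..c}. F x = F a + (LINT t:{a..x}|lebesgue. f t))"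

lemma ac_deriv_set_integrable: "ac_deriv a c F f \<Longrightarrow> set_integrable lebesgue {a..c} f"
  unfolding ac_deriv_def by blast

lemma ac_family_iff: "ac_family k D \<longleftrightarrow> (\<forall>j<k. ac_deriv 0 1 (D j) (D (Suc j)))"
  unfolding ac_family_def ac_deriv_def ..

lemma set_integrable_mult_continuous:
  fixes f g :: "real \<Rightarrow> 'a::{real_normed_field, euclidean_space}"
  assumes "continuous_on {a..c} f" "set_integrable lebesgue {a..c} g"
  shows "set_integrable lebesgue {a..c} (\<lambda>x. f x * g x)"
proof (rule absolutely_integrable_bounded_measurable_product[OF bilinear_times])
  show "f \<in> borel_measurable (lebesgue_on {a..c})"
    using assms(1) by (rule continuous_imp_measurable_on_sets_lebesgue) auto
  show "bounded (f ` {a..c})"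
    using assms(1) by (intro compact_imp_bounded compact_continuous_image) auto
qed (use assms in auto)

lemma set_integral_eq_integral_lebesgue:
  fixes f :: "real \<Rightarrow> 'a::euclidean_space"
  shows "set_integrable lebesgue S f \<Longrightarrow> (LINT x:S|lebesgue. f x) = integral S f"
  by (rule set_lebesgue_integral_eq_integral)

lemma ac_deriv_continuous:
  assumes "ac_deriv a c F f"
  shows "continuous_on {a..c} F"
proof -
  have f: "set_integrable lebesgue {a..c} f" and F: "\<And>x. x \<in> {a..c} \<Longrightarrow> F x = F a + (LINT t:{a..x}|lebesgue. f t)"
    using assms unfolding ac_deriv_def by blast+
  have "continuous_on {a..c} (\<lambda>x. F a + integral {a..x} f)"
    using set_lebesgue_integral_eq_integral(1)[OF f]
    by (intro continuous_intros indefinite_integral_continuous_1) auto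
  moreover have "F x = F a + integral {a..x} f" if "x \<in> {a..c}" for x
  proof -
    have "set_integrable lebesgue {a..x} f"
      using that by (intro set_integrable_subset[OF f]) auto
    then show ?thesis
      using F[OF that] by (simp only: set_integral_eq_integral_lebesgue)
  qed
  ultimately show ?thesis
    using continuous_on_eq[of "{a..c}" "\<lambda>x. F a + integral {a..x} f" F] by metis
qed

lemma ac_deriv_diff_eq:
  assumes "ac_deriv a c F f" "a \<le> s" "s \<le> x" "x \<le> c"
  shows "(LINT t:{s..x}|lebesgue. f t) = F x - F s"
proof -
  have f: "set_integrable lebesgue {a..c} f" and F: "\<And>x. x \<in> {a..c} \<Longrightarrow> F x = F a + (LINT t:{a..x}|lebesgue. f t)"
    using assms(1) unfolding ac_deriv_def by blast+
  have sub: "set_integrable lebesgue {u..v} f" if "a \<le> u" "v \<le> c" for u v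
    using that by (intro set_integrable_subset[OF f]) auto
  have c: "integral {a..s} f + integral {s..x} f = integral {a..x} f"
    using assms(2-) set_lebesgue_integral_eq_integral(1)[OF sub[of a x]]
    by (intro Henstock_Kurzweil_Integration.integral_combine) auto
  have "F x = F a + integral {a..x} f" "F s = F a + integral {a..s} f"
    using F[of x] F[of s] assms(2-) by (simp_all flip: set_integral_eq_integral_lebesgue[OF sub])
  then show ?thesis
    using sub[of s x] assms(2-) by (simp add: c[symmetric] set_integral_eq_integral_lebesgue)
qed

text \<open>No pointwise differentiation is involved: the integral of f(s) g(t) over the triangle a
  \<le> t \<le> s \<le> x, computed in both orders, is the integration by parts formula on
  [a, x].\<close>

lemma ac_deriv_mult:
  assumes F: "ac_deriv a c F f" and G: "ac_deriv a c G g"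
  shows "ac_deriv a c (\<lambda>x. F x * G x) (\<lambda>x. F x * g x + f x * G x)"
proof -
  note cF = ac_deriv_continuous[OF F] and cG = ac_deriv_continuous[OF G]
  have f: "set_integrable lebesgue {a..c} f" and g: "set_integrable lebesgue {a..c} g"
    using F G by (auto intro: ac_deriv_set_integrable)
  have Fg: "set_integrable lebesgue {a..c} (\<lambda>x. F x * g x)"
    using cF g by (rule set_integrable_mult_continuous)
  have fG: "set_integrable lebesgue {a..c} (\<lambda>x. f x * G x)"
    using set_integrable_mult_continuous[OF cG f] by (simp add: mult.commute)
  have "F x * G x = F a * G a + (LINT t:{a..x}|lebesgue. F t * g t + f t * G t)" if x: "x \<in> {a..c}" for x
  proof -
    have sub: "set_integrable lebesgue {a..x} k" if "set_integrable lebesgue {a..c} k" for k :: "real \<Rightarrow> 'a"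
      using x by (intro set_integrable_subset[OF that]) auto
    note subs = f[THEN sub] g[THEN sub] Fg[THEN sub] fG[THEN sub]
    have e1: "(LINT s:{a..x}|lebesgue. f s * (LINT t:{a..s}|lebesgue. 1 * g t)) =
          (LINT t:{a..x}|lebesgue. g t * (LINT s:{t..x}|lebesgue. f s * 1))"
      by (rule set_integral_triangle_swap[where M = 1]) (simp_all add: subs)
    have e2: "(LINT s:{a..x}|lebesgue. f s * (LINT t:{a..s}|lebesgue. 1 * g t)) =
      (LINT s:{a..x}|lebesgue. f s * G s - f s * G a)"
      using x by (intro set_lebesgue_integral_cong) (auto simp: ac_deriv_diff_eq[OF G] algebra_simps)
    have e3: "(LINT t:{a..x}|lebesgue. g t * (LINT s:{t..x}|lebesgue. f s * 1)) =
      (LINT t:{a..x}|lebesgue. F x * g t - F t * g t)"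
      using x by (intro set_lebesgue_integral_cong) (auto simp: ac_deriv_diff_eq[OF F] algebra_simps)
    have e4: "(LINT s:{a..x}|lebesgue. f s * G s - f s * G a) = (LINT s:{a..x}|lebesgue. f s * G s) - (F x - F a) * G a"
      using x by (subst set_integral_diff(2)[OF subs(4)]) (use subs(1) in \<open>simp_all add: ac_deriv_diff_eq[OF F]\<close>)
    have e5: "(LINT t:{a..x}|lebesgue. F x * g t - F t * g t) = F x * (G x - G a) - (LINT t:{a..x}|lebesgue. F t * g t)"
      using x by (subst set_integral_diff(2)[OF _ subs(3)]) (use subs(2) in \<open>simp_all add: ac_deriv_diff_eq[OF G]\<close>)
    have "(LINT s:{a..x}|lebesgue. f s * G s) - (F x - F a) * G a = F x * (G x - G a) - (LINT t:{a..x}|lebesgue. F t * g t)"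
      using e1 unfolding e2 e3 e4 e5 .
    moreover have "(LINT t:{a..x}|lebesgue. F t * g t + f t * G t) = (LINT t:{a..x}|lebesgue. F t * g t) + (LINT s:{a..x}|lebesgue. f s * G s)"
      by (rule set_integral_add(2)[OF subs(3,4)])
    ultimately show ?thesis
      by (simp add: algebra_simps)
  qed
  then show ?thesis
    unfolding ac_deriv_def using set_integral_add(1)[OF Fg fG] by blast
qed

lemma ac_deriv_const [simp]: "ac_deriv a c (\<lambda>x. k) (\<lambda>x. 0)"
  by (simp add: ac_deriv_def set_integrable_def)

lemma ac_deriv_add:
  assumes "ac_deriv a c F f" "ac_deriv a c G g"
  shows "ac_deriv a c (\<lambda>x. F x + G x) (\<lambda>x. f x + g x)"
  unfolding ac_deriv_def
proof (intro conjI ballI)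
  show "F x + G x = F a + G a + (LINT t:{a..x}|lebesgue. f t + g t)" if "x \<in> {a..c}" for x
  proof -
    have "set_integrable lebesgue {a..x} f" "set_integrable lebesgue {a..x} g"
      using assms[THEN ac_deriv_set_integrable] that by (auto intro: set_integrable_subset)
    then show ?thesis
      using assms that by (simp add: ac_deriv_diff_eq)
  qed
qed (use assms[THEN ac_deriv_set_integrable] in auto)

lemma ac_deriv_cmult: "ac_deriv a c F f \<Longrightarrow> ac_deriv a c (\<lambda>x. k * F x) (\<lambda>x. k * f x)"
  using ac_deriv_mult[OF ac_deriv_const[of a c k]] by (simp)

lemma ac_deriv_sum:
  "(\<And>i. i \<in> I \<Longrightarrow> ac_deriv a c (F i) (f i)) \<Longrightarrow> ac_deriv a c (\<lambda>x. \<Sum>i\<in>I. F i x) (\<lambda>x. \<Sum>i\<in>I. f i x)"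
  by (induction I rule: infinite_finite_induct) (auto intro!: ac_deriv_add)

lemma ac_deriv_of_has_vector_derivative:
  assumes "\<And>x. x \<in> {a..c} \<Longrightarrow> (F has_vector_derivative f x) (at x within {a..c})" "continuous_on {a..c} f"
  shows "ac_deriv a c F f"
proof -
  have I: "set_integrable lebesgue {a..c} f"
    using assms(2) by (rule absolutely_integrable_continuous_real)
  have "F x = F a + (LINT t:{a..x}|lebesgue. f t)" if x: "x \<in> {a..c}" for x
  proof -
    have "(f has_integral F x - F a) {a..x}"
      using x assms(1) by (intro fundamental_theorem_of_calculus)
        (auto intro!: has_vector_derivative_within_subset[of F _ _ "{a..c}" "{a..x}"])
    moreover have "set_integrable lebesgue {a..x} f"
      using x by (intro set_integrable_subset[OF I]) auto
    ultimately show ?thesis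
      by (simp add: set_integral_eq_integral_lebesgue has_integral_iff)
  qed
  with I show ?thesis unfolding ac_deriv_def by blast
qed

section \<open>Families of successive derivatives: Leibniz rule and repeated integration by
  parts\<close>

lemma ac_family_mono: "ac_family k D \<Longrightarrow> j \<le> k \<Longrightarrow> ac_family j D"
  by (simp add: ac_family_iff)

lemma ac_family_shiftF: "ac_family (k + m) D \<Longrightarrow> ac_family k (shiftF m D)"
  by (simp add: ac_family_iff shiftF_def)

lemma ac_family_continuous: "ac_family k D \<Longrightarrow> j < k \<Longrightarrow> continuous_on {0..1} (D j)"
  by (auto simp: ac_family_iff intro: ac_deriv_continuous)

text \<open>Pascal's rule, arranged as two Leibniz sums of order j with unchanged binomial
  coefficients, which is the form that the termwise product rule produces in
  \<open>ac_family_leib\<close>.\<close>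

lemma leib_Suc: "leib D Z (Suc j) x = leib D (shiftF 1 Z) j x + leib (shiftF 1 D) Z j x"
proof -
  let ?t = "\<lambda>c i. of_nat c * D i x * Z (Suc j - i) x"
  have "leib D Z (Suc j) x = ?t 1 0 + (\<Sum>i\<le>j. ?t ((j choose Suc i) + (j choose i)) (Suc i))"
    unfolding leib_def sum.atMost_Suc_shift by (simp add: add.commute)
  also have "\<dots> = (?t 1 0 + (\<Sum>i\<le>j. ?t (j choose Suc i) (Suc i))) + (\<Sum>i\<le>j. ?t (j choose i) (Suc i))"
    by (simp add: algebra_simps sum.distrib)
  also have "?t 1 0 + (\<Sum>i\<le>j. ?t (j choose Suc i) (Suc i)) = (\<Sum>i\<le>Suc j. ?t (j choose i) i)"
    unfolding sum.atMost_Suc_shift by simp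
  also have "\<dots> = leib D (shiftF 1 Z) j x"
    by (simp add: leib_def shiftF_def Suc_diff_le)
  finally show ?thesis by (simp add: leib_def shiftF_def)
qed

lemma ac_family_leib:
  assumes "ac_family k D" "ac_family k Z"
  shows "ac_family k (leib D Z)"
  unfolding ac_family_iff
proof safe
  fix j assume j: "j < k"
  have "ac_deriv 0 1 (\<lambda>x. \<Sum>i\<le>j. of_nat (j choose i) * (D i x * Z (j - i) x))
     (\<lambda>x. \<Sum>i\<le>j. of_nat (j choose i) * (D i x * Z (Suc (j - i)) x + D (Suc i) x * Z (j - i) x))"
    using assms j by (intro ac_deriv_sum ac_deriv_cmult ac_deriv_mult) (auto simp: ac_family_iff)
  moreover have "(\<Sum>i\<le>j. of_nat (j choose i) * (D i x * Z (Suc (j - i)) x + D (Suc i) x * Z (j - i) x)) =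
    leib D Z (Suc j) x" for x
    unfolding leib_Suc unfolding leib_def shiftF_def sum.distrib[symmetric]
    by (intro sum.cong refl) (simp add: algebra_simps)
  moreover have "leib D Z j = (\<lambda>x. \<Sum>i\<le>j. of_nat (j choose i) * (D i x * Z (j - i) x))"
    by (simp add: leib_def mult.assoc)
  ultimately show "ac_deriv 0 1 (leib D Z j) (leib D Z (Suc j))"
    by simp
qed

text \<open>The subinterval is arbitrary because the formula is used on [0, x] and [\<tau>, 1] for
  the two Taylor expansions and on [t, x] for polynomial primitives.\<close>

lemma ac_family_by_parts:
  assumes "ac_family k U" "ac_family k V" and st: "0 \<le> s" "s \<le> t" "t \<le> 1" and k: "0 < k"
  shows "(LINT x:{s..t}|lebesgue. U 0 x * V k x) =
    (\<Sum>j<k. (-1) ^ j * (U j t * V (k - 1 - j) t - U j s * V (k - 1 - j) s))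
    + (-1) ^ k * (LINT x:{s..t}|lebesgue. U k x * V 0 x)"
  using assms(1,2) k
proof (induction k arbitrary: U)
  case (Suc k)
  have U: "ac_deriv 0 1 (U 0) (U 1)" and V: "ac_deriv 0 1 (V k) (V (Suc k))"
    using Suc.prems by (auto simp: ac_family_iff)
  have I: "set_integrable lebesgue {s..t} (\<lambda>x. U 0 x * V (Suc k) x)" "set_integrable lebesgue {s..t} (\<lambda>x. U 1 x * V k x)"
    using set_integrable_mult_continuous[OF ac_deriv_continuous[OF U], of "V (Suc k)"]
      set_integrable_mult_continuous[OF ac_deriv_continuous[OF V], of "U 1"] U[THEN ac_deriv_set_integrable] V[THEN ac_deriv_set_integrable] st
    by (auto simp: mult.commute intro!: set_integrable_subset[of lebesgue "{0..1}" _ "{s..t}"])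
  have "(LINT x:{s..t}|lebesgue. U 0 x * V (Suc k) x + U 1 x * V k x) = U 0 t * V k t - U 0 s * V k s"
    using ac_deriv_diff_eq[OF ac_deriv_mult[OF U V] st] .
  then have 1: "(LINT x:{s..t}|lebesgue. U 0 x * V (Suc k) x) = U 0 t * V k t - U 0 s * V k s - (LINT x:{s..t}|lebesgue. U 1 x * V k x)"
    using I by (simp add: algebra_simps)
  show ?case
  \<comment> \<open>The induction hypothesis, applied to the derivative family of \<open>U\<close>,
    asks for a positive order; a single integration is therefore separate.\<close>
  proof (cases "k = 0")
    case True
    then show ?thesis using 1 by simp
  next
    case False
    have "(LINT x:{s..t}|lebesgue. shiftF 1 U 0 x * V k x) =
      (\<Sum>j<k. (-1) ^ j * (shiftF 1 U j t * V (k - 1 - j) t - shiftF 1 U j s * V (k - 1 - j) s))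
      + (-1) ^ k * (LINT x:{s..t}|lebesgue. shiftF 1 U k x * V 0 x)"
      using Suc.prems False by (intro Suc.IH) (auto simp: ac_family_iff shiftF_def)
    then show ?thesis
      unfolding 1 sum.lessThan_Suc_shift by (simp add: shiftF_def sum_negf)
  qed
qed simp

text \<open>The \<open>i\<close>-th derivative of \<open>x \<mapsto> (a - x)\<^sup>m / m!\<close>.\<close>

definition mono_family :: "real \<Rightarrow> nat \<Rightarrow> nat \<Rightarrow> real \<Rightarrow> complex" where
  "mono_family a m i x = (if i \<le> m then (-1) ^ i * of_real ((a - x) ^ (m - i) / fact (m - i)) else 0)"

lemma ac_family_mono_family: "ac_family k (mono_family a m)"
  unfolding ac_family_iff
proof safe
  fix j
  show "ac_deriv 0 1 (mono_family a m j) (mono_family a m (Suc j))"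
  proof (rule ac_deriv_of_has_vector_derivative)
    show "continuous_on {0..1} (mono_family a m (Suc j))"
      by (cases "Suc j \<le> m") (auto simp: mono_family_def[abs_def] intro!: continuous_intros)
    fix x :: real
    consider "j < m" | "j = m" | "j > m" by linarith
    then show "(mono_family a m j has_vector_derivative mono_family a m (Suc j) x) (at x within {0..1})"
    proof cases
      case 1
      then obtain l where l: "m - j = Suc l" "m - Suc j = l" "Suc j \<le> m" "j \<le> m"
        by (metis Suc_diff_Suc Suc_leI less_imp_le_nat)
      have d: "((\<lambda>x. a - x) has_real_derivative -1) (at x within {0..1})"
        by (auto intro!: derivative_eq_intros)
      have "((\<lambda>x. (a - x) ^ Suc l / fact (Suc l)) has_real_derivative - ((a - x) ^ l / fact l)) (at x within {0..1})"
        using DERIV_cdivide[OF DERIV_power_Suc[OF d, of l], of "fact (Suc l)"]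
        using of_nat_neq_0[of l, where 'a = real] by (simp del: power_Suc add: mult_divide_mult_cancel_left)
      then have "((\<lambda>x. (-1) ^ j *  complex_of_real ((a - x) ^ Suc l / fact (Suc l))) has_vector_derivative (-1) ^ j * complex_of_real (- ((a - x) ^ l / fact l))) (at x within {0..1})"
        by (intro has_vector_derivative_mult_right has_vector_derivative_of_real)
          (simp add: has_real_derivative_iff_has_vector_derivative)
      then show ?thesis
        unfolding mono_family_def using l by simp
    qed (auto simp: mono_family_def[abs_def])
  qed
qed

section \<open>Weighted square integrable functions and Volterra operators\<close>

lemma set_integral_singleton [simp]:
  fixes f :: "real \<Rightarrow> 'a::euclidean_space"
  shows "(LINT t:{a}|lebesgue. f t) = 0"
  unfolding set_lebesgue_integral_def
proof (rule integral_eq_zero_AE)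
  have "AE x in lborel. x \<noteq> a"
    by (rule AE_lborel_singleton)
  then have "AE x in lebesgue. x \<noteq> a"
    by (rule AE_completion)
  then show "AE x in lebesgue. indicat_real {a} x *\<^sub>R f x = 0"
    by eventually_elim simp
qed

lemma set_integral_mono_set:
  fixes f :: "'a \<Rightarrow> real"
  assumes "set_integrable M B f" "A \<in> sets M" "A \<subseteq> B" "\<And>x. x \<in> B \<Longrightarrow> 0 \<le> f x"
  shows "(LINT x:A|M. f x) \<le> (LINT x:B|M. f x)"
  using assms(1) set_integrable_subset[OF assms(1-3)] assms(3,4)
  unfolding set_lebesgue_integral_def set_integrable_def
  by (intro integral_mono) (auto simp: indicator_def)

lemma ac_deriv_integral:
  assumes "set_integrable lebesgue {a..c} f"
  shows "ac_deriv a c (\<lambda>x. LINT t:{a..x}|lebesgue. f t) f"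
  using assms by (simp add: ac_deriv_def)

text \<open>Multiplying the case m by \<open>S\<close> and using the product rule gives m + 2 times
  the wanted derivative, whence the factor 1 / (m + 2). This is what turns repeated integration
  against \<open>s\<close> into S^m / m!.\<close>

lemma ac_deriv_power_fact:
  fixes S s :: "real \<Rightarrow> real"
  assumes "ac_deriv a c S s"
  shows "ac_deriv a c (\<lambda>x. S x ^ Suc m / fact (Suc m)) (\<lambda>x. s x * (S x ^ m / fact m))"
proof (induction m)
  case (Suc m)
  have "ac_deriv a c (\<lambda>x. 1 / (2 + real m) * (S x * (S x ^ Suc m / fact (Suc m))))
     (\<lambda>x. 1 / (2 + real m) * (S x * (s x * (S x ^ m / fact m)) + s x * (S x ^ Suc m / fact (Suc m))))"
    by (intro ac_deriv_cmult ac_deriv_mult assms Suc)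
  moreover have "1 / (2 + real m) * (S x * (S x ^ Suc m / fact (Suc m))) = S x ^ Suc (Suc m) / fact (Suc (Suc m))" for x
    by (simp add: add.commute)
  moreover have "1 / (2 + real m) * (S x * (s x * (S x ^ m / fact m)) + s x * (S x ^ Suc m / fact (Suc m)))
     = s x * (S x ^ Suc m / fact (Suc m))" for x
  proof -
    define X where "X = s x * (S x ^ Suc m / fact (Suc m))"
    have "S x * (s x * (S x ^ m / fact m)) = (1 + real m) * X"
      using of_nat_neq_0[of m, where 'a = real] by (simp add: X_def divide_simps)
    then have "1 / (2 + real m) * (S x * (s x * (S x ^ m / fact m)) + X) = 1 / (2 + real m) * ((2 + real m) * X)"
      by (simp add: algebra_simps)
    then show ?thesis
      by (simp add: X_def)
  qed
  ultimately show ?case by (simp only:)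
qed (use assms in simp)

section \<open>The two weighted spaces and their pairing\<close>

lemma set_borel_measurable_lebesgue_on:
  fixes f :: "real \<Rightarrow> 'a::real_normed_vector"
  shows "set_borel_measurable lebesgue {0..1} f \<longleftrightarrow> f \<in> borel_measurable (lebesgue_on {0..1})"
  unfolding set_borel_measurable_def by (rule borel_measurable_restrict_space_iff[symmetric]) simp

lemma set_integrable_lebesgue_on:
  fixes f :: "real \<Rightarrow> 'a::euclidean_space"
  shows "set_integrable lebesgue {0..1} f \<longleftrightarrow> integrable (lebesgue_on {0..1}) f"
  by (rule set_integrable_eq) simp

lemma L2w_iff: "L2w w f \<longleftrightarrow> f \<in> borel_measurable (lebesgue_on {0..1}) \<and>
    integrable (lebesgue_on {0..1}) (\<lambda>x. (cmod (w x * f x))\<^sup>2)"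
  unfolding L2w_def set_borel_measurable_lebesgue_on set_integrable_lebesgue_on ..

lemma L2w_measurable: "L2w w f \<Longrightarrow> f \<in> borel_measurable (lebesgue_on {0..1})"
  by (simp add: L2w_iff)

text \<open>This is all that the analysis retains of p0: since |b|^2 = |p0|, the integrability of p0
  and of 1/p0 becomes square integrability of b and of 1/b.\<close>

locale weight =
  fixes b :: "real \<Rightarrow> complex"
  assumes b_measurable [measurable]: "b \<in> borel_measurable (lebesgue_on {0..1})"
    and b_square_integrable: "integrable (lebesgue_on {0..1}) (\<lambda>x. (cmod (b x))\<^sup>2)"
    and invw_square_integrable: "integrable (lebesgue_on {0..1}) (\<lambda>x. (cmod (invw b x))\<^sup>2)"
    and b_nonzero: "AE x in lebesgue_on {0..1}. b x \<noteq> 0"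
begin

lemma invw_measurable [measurable]: "invw b \<in> borel_measurable (lebesgue_on {0..1})"
  unfolding invw_def by measurable

text \<open>Both identities hold at every x, zeros of \<open>b\<close> included, because
  \<open>inverse 0 = 0\<close>; no exceptional set has to be carried along.\<close>

lemma invw_b_square: "invw b x * (b x)\<^sup>2 = b x" and b_invw_square: "b x * (invw b x)\<^sup>2 = invw b x"
  by (cases "b x = 0"; simp add: invw_def power2_eq_square)+

lemma L2w_bound:
  assumes g: "L2w w g" and [measurable]: "f \<in> borel_measurable (lebesgue_on {0..1})" "w \<in> borel_measurable (lebesgue_on {0..1})"
    and le: "AE x in lebesgue_on {0..1}. cmod (f x) \<le> C * cmod (g x)"
  shows "L2w w f"
  unfolding L2w_iff
proof
  show "integrable (lebesgue_on {0..1}) (\<lambda>x. (cmod (w x * f x))\<^sup>2)"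
  proof (rule Bochner_Integration.integrable_bound)
    show "integrable (lebesgue_on {0..1}) (\<lambda>x. C\<^sup>2 * (cmod (w x * g x))\<^sup>2)"
      using g by (simp add: L2w_iff)
    show "AE x in lebesgue_on {0..1}. norm ((cmod (w x * f x))\<^sup>2) \<le> norm (C\<^sup>2 * (cmod (w x * g x))\<^sup>2)"
      using le
    proof eventually_elim
      case (elim x)
      have "(cmod (w x) * cmod (f x))\<^sup>2 \<le> (cmod (w x) * (C * cmod (g x)))\<^sup>2"
        using elim by (intro power_mono mult_left_mono) auto
      then show ?case by (simp add: norm_mult power_mult_distrib mult_ac)
    qed
  qed measurable
qed measurable

lemma L2w_mult_bounded:
  assumes f: "L2w w f" and [measurable]: "g \<in> borel_measurable (lebesgue_on {0..1})" "w \<in> borel_measurable (lebesgue_on {0..1})"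
    and "\<And>x. x \<in> {0..1} \<Longrightarrow> cmod (g x) \<le> C"
  shows "L2w w (\<lambda>x. g x * f x)"
proof (rule L2w_bound[OF f, where C = C])
  have [measurable]: "f \<in> borel_measurable (lebesgue_on {0..1})"
    using f by (simp add: L2w_iff)
  show "(\<lambda>x. g x * f x) \<in> borel_measurable (lebesgue_on {0..1})" by measurable
  show "AE x in lebesgue_on {0..1}. cmod (g x * f x) \<le> C * cmod (f x)"
    using assms(4) by (intro AE_I2) (auto simp: norm_mult intro!: mult_right_mono)
qed fact

lemma L2w_mult_continuous:
  assumes "L2w w f" "continuous_on {0..1} g" "w \<in> borel_measurable (lebesgue_on {0..1})"
  shows "L2w w (\<lambda>x. g x * f x)"
proof -
  have "bounded (g ` {0..1})"
    using assms by (intro compact_imp_bounded compact_continuous_image) auto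
  then obtain C where "\<And>x. x \<in> {0..1} \<Longrightarrow> cmod (g x) \<le> C"
    unfolding bounded_iff by blast
  with assms continuous_imp_measurable_on_sets_lebesgue[OF assms(2)] show ?thesis
    by (intro L2w_mult_bounded) auto
qed

lemma L2w_cmult: "L2w w f \<Longrightarrow> L2w w (\<lambda>x. c * f x)"
  by (auto simp: L2w_iff norm_mult power_mult_distrib mult.left_commute[of _ "cmod c ^ 2"])

lemma L2w_add:
  assumes f: "L2w w f" and g: "L2w w g" and [measurable]: "w \<in> borel_measurable (lebesgue_on {0..1})"
  shows "L2w w (\<lambda>x. f x + g x)"
  unfolding L2w_iff
proof
  note [measurable] = f[THEN L2w_measurable] g[THEN L2w_measurable]
  show "(\<lambda>x. f x + g x) \<in> borel_measurable (lebesgue_on {0..1})" by measurable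
  show "integrable (lebesgue_on {0..1}) (\<lambda>x. (cmod (w x * (f x + g x)))\<^sup>2)"
  proof (rule Bochner_Integration.integrable_bound)
    show "integrable (lebesgue_on {0..1}) (\<lambda>x. 2 * (cmod (w x * f x))\<^sup>2 + 2 * (cmod (w x * g x))\<^sup>2)"
      using f g by (simp add: L2w_iff)
    show "AE x in lebesgue_on {0..1}. norm ((cmod (w x * (f x + g x)))\<^sup>2) \<le> norm (2 * (cmod (w x * f x))\<^sup>2 + 2 * (cmod (w x * g x))\<^sup>2)"
    proof (intro AE_I2)
      fix x
      let ?p = "cmod (w x * f x)" and ?q = "cmod (w x * g x)"
      have "(cmod (w x * (f x + g x)))\<^sup>2 \<le> (?p + ?q)\<^sup>2"
        by (intro power_mono) (auto simp: distrib_left norm_triangle_ineq)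
      also have "\<dots> \<le> 2 * ?p\<^sup>2 + 2 * ?q\<^sup>2"
        using zero_le_power2[of "?p - ?q"] by (simp add: power2_eq_square algebra_simps)
      finally show "norm ((cmod (w x * (f x + g x)))\<^sup>2) \<le> norm (2 * ?p\<^sup>2 + 2 * ?q\<^sup>2)" by simp
    qed
  qed measurable
qed

lemma L2w_diff:
  assumes "L2w w f" "L2w w g" "w \<in> borel_measurable (lebesgue_on {0..1})"
  shows "L2w w (\<lambda>x. f x - g x)"
  using L2w_add[OF assms(1) L2w_cmult[OF assms(2), of "-1"] assms(3)] by simp

lemma L2w_zero [simp]: "L2w w (\<lambda>x. 0)"
  by (simp add: L2w_iff)

lemma L2w_sum:
  "(\<And>i. i \<in> I \<Longrightarrow> L2w w (f i)) \<Longrightarrow> w \<in> borel_measurable (lebesgue_on {0..1}) \<Longrightarrow> L2w w (\<lambda>x. \<Sum>i\<in>I. f i x)"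
  by (induction I rule: infinite_finite_induct) (auto intro!: L2w_add)

lemma L2w_cmod: "L2w w f \<Longrightarrow> L2w w (\<lambda>x. complex_of_real (cmod (f x)))"
  by (auto simp: L2w_iff norm_mult)

lemma L2w_one: "L2w b (\<lambda>x. 1)" "L2w (invw b) (\<lambda>x. 1)"
  using b_square_integrable invw_square_integrable by (auto simp: L2w_iff)

lemma L2w_continuous:
  assumes "continuous_on {0..1} g"
  shows "L2w b g" "L2w (invw b) g"
  using L2w_mult_continuous[OF L2w_one(1) assms] L2w_mult_continuous[OF L2w_one(2) assms] by auto

text \<open>The pairing of the two spaces: s f = (s/b)(b f) wherever b is nonzero, and a product of
  moduli is at most the sum of their squares.\<close>

lemma L2w_mult_integrable:
  assumes s: "L2w (invw b) s" and f: "L2w b f"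
  shows "set_integrable lebesgue {0..1} (\<lambda>x. s x * f x)"
  unfolding set_integrable_lebesgue_on
proof (rule Bochner_Integration.integrable_bound)
  note [measurable] = s[THEN L2w_measurable] f[THEN L2w_measurable]
  show "(\<lambda>x. s x * f x) \<in> borel_measurable (lebesgue_on {0..1})" by measurable
  show "integrable (lebesgue_on {0..1}) (\<lambda>x. (cmod (invw b x * s x))\<^sup>2 + (cmod (b x * f x))\<^sup>2)"
    using s f by (simp add: L2w_iff)
  show "AE x in lebesgue_on {0..1}. norm (s x * f x) \<le> norm ((cmod (invw b x * s x))\<^sup>2 + (cmod (b x * f x))\<^sup>2)"
    using b_nonzero
  proof eventually_elim
    case (elim x)
    let ?p = "cmod (invw b x * s x)" and ?q = "cmod (b x * f x)"
    have "s x * f x = (invw b x * s x) * (b x * f x)"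
      using elim by (simp add: invw_def)
    then have "norm (s x * f x) = ?p * ?q"
      by (simp only: norm_mult)
    also have "\<dots> \<le> ?p\<^sup>2 + ?q\<^sup>2"
      using sum_squares_bound[of ?p ?q] mult_nonneg_nonneg[OF norm_ge_zero norm_ge_zero, of "invw b x * s x" "b x * f x"] by linarith
    finally show ?case by simp
  qed
qed

lemma L2w_integrable:
  "L2w b f \<Longrightarrow> set_integrable lebesgue {0..1} f"
  "L2w (invw b) s \<Longrightarrow> set_integrable lebesgue {0..1} s"
  using L2w_mult_integrable[OF L2w_one(2)] L2w_mult_integrable[OF _ L2w_one(1)] by auto

text \<open>A product bound is asked for, since it lets the x-dependence leave the integral at each
  iteration. Outside the triangle the kernel has no meaning, so measurability concerns its extension
  by zero.\<close>

lemma volterra_L2_bij: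
  fixes A :: "real \<Rightarrow> real"
  assumes K [measurable]: "(\<lambda>(x,t). if 0 \<le> t \<and> t \<le> x \<and> x \<le> 1 then K x t else 0) \<in> borel_measurable (lebesgue \<Otimes>\<^sub>M lebesgue)"
    and A: "L2w (invw b) (\<lambda>x. complex_of_real (A x))"
    and A_nonneg: "\<And>x. 0 \<le> x \<Longrightarrow> x \<le> 1 \<Longrightarrow> 0 \<le> A x"
    and bound: "\<And>x t. 0 \<le> t \<Longrightarrow> t \<le> x \<Longrightarrow> x \<le> 1 \<Longrightarrow> cmod (K x t) \<le> A x * A t"
  shows "L2_bij b (Bop b K)"
proof -
  define V where "V f x = (LINT t:{0..x}|lebesgue. K x t * f t)" for f x
  \<comment> \<open>One application of b^-2 V, with \<open>V\<close> the integral part, yields a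
    function dominated by a multiple of \<open>G\<close>. In modulus b G is A/b, so \<open>G\<close>
    lies in L_{2,b}, and A G = s is integrable: integrating \<open>A\<close> against a function
    bounded by G S^m / m! gives the next power of \<open>S\<close>.\<close>
  define s where "s x = (A x)\<^sup>2 * (cmod (invw b x))\<^sup>2" for x
  define S where "S x = (LINT t:{0..x}|lebesgue. s t)" for x
  define G where "G x = A x * (cmod (invw b x))\<^sup>2" for x
  have Bop: "Bop b K f x = (b x)\<^sup>2 * f x + V f x" for f x
    by (simp add: Bop_def V_def)
  have A_measurable [measurable]: "A \<in> borel_measurable (lebesgue_on {0..1})"
    using measurable_compose[OF L2w_measurable[OF A] borel_measurable_Re] by simp

  have V_measurable: "V f \<in> borel_measurable (lebesgue_on {0..1})" if "f \<in> borel_measurable (lebesgue_on {0..1})" for f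
  proof -
    have [measurable]: "(\<lambda>x. indicator {0..1} x *\<^sub>R f x) \<in> borel_measurable lebesgue"
      using that by (simp add: set_borel_measurable_def flip: set_borel_measurable_lebesgue_on)
    have "(\<lambda>x. LINT t|lebesgue. (case (x, t) of (x, t) \<Rightarrow> if 0 \<le> t \<and> t \<le> x \<and> x \<le> 1 then K x t else 0) * (indicator {0..1} t *\<^sub>R f t)) \<in> borel_measurable lebesgue"
      by measurable
    then have "(\<lambda>x. LINT t|lebesgue. (case (x, t) of (x, t) \<Rightarrow> if 0 \<le> t \<and> t \<le> x \<and> x \<le> 1 then K x t else 0) * (indicator {0..1} t *\<^sub>R f t)) \<in> borel_measurable (lebesgue_on {0..1})"
      by (rule measurable_restrict_space1)
    then show ?thesis
    proof (rule measurable_cong[THEN iffD1, rotated])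
      fix x assume "x \<in> space (lebesgue_on {0..1::real})"
      then show "(LINT t|lebesgue. (case (x, t) of (x, t) \<Rightarrow> if 0 \<le> t \<and> t \<le> x \<and> x \<le> 1 then K x t else 0) * (indicator {0..1} t *\<^sub>R f t)) = V f x"
        unfolding V_def set_lebesgue_integral_def
        by (intro Bochner_Integration.integral_cong) (auto simp: indicator_def)
    qed
  qed
  have Af: "set_integrable lebesgue {0..1} (\<lambda>t. A t * cmod (f t))" if "L2w b f" for f
  proof -
    have "set_integrable lebesgue {0..1} (\<lambda>t. complex_of_real (A t) * f t)"
      by (rule L2w_mult_integrable[OF A that])
    then have "set_integrable lebesgue {0..1} (\<lambda>t. cmod (complex_of_real (A t) * f t))"
      by (rule set_integrable_norm)
    then show ?thesis
      by (rule set_integrable_cong[THEN iffD1, rotated 3]) (auto simp: norm_mult A_nonneg)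
  qed
  have Af': "set_integrable lebesgue {0..x} (\<lambda>t. A t * cmod (f t))" if "L2w b f" "x \<le> 1" for f x
    using that by (intro set_integrable_subset[OF Af]) auto
  have Kf: "set_integrable lebesgue {0..x} (\<lambda>t. K x t * f t)" if f: "L2w b f" and x: "0 \<le> x" "x \<le> 1" for f x
  proof (rule set_integrable_bound)
    show "set_integrable lebesgue {0..x} (\<lambda>t. A x * (A t * cmod (f t)))"
      using Af'[OF f x(2)] by simp
    show "AE t in lebesgue. t \<in> {0..x} \<longrightarrow> cmod (K x t * f t) \<le> norm (A x * (A t * cmod (f t)))"
    proof (intro always_eventually allI impI)
      fix t assume t: "t \<in> {0..x}"
      have "cmod (K x t) * cmod (f t) \<le> A x * A t * cmod (f t)"
        using t x by (intro mult_right_mono bound) auto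
      then show "cmod (K x t * f t) \<le> norm (A x * (A t * cmod (f t)))"
        using t x A_nonneg[of x] A_nonneg[of t] by (simp add: norm_mult)
    qed
    have [measurable]: "(\<lambda>x. indicator {0..1} x *\<^sub>R f x) \<in> borel_measurable lebesgue"
      using L2w_measurable[OF f] by (simp add: set_borel_measurable_def flip: set_borel_measurable_lebesgue_on)
    have "(\<lambda>t. (case (x, t) of (x, t) \<Rightarrow> if 0 \<le> t \<and> t \<le> x \<and> x \<le> 1 then K x t else 0) * (indicator {0..1} t *\<^sub>R f t)) \<in> borel_measurable lebesgue"
      by (intro borel_measurable_times measurable_Pair2[OF K]) auto
    then show "set_borel_measurable lebesgue {0..x} (\<lambda>t. K x t * f t)"
      unfolding set_borel_measurable_def
      by (rule measurable_cong[THEN iffD1, rotated]) (use x in \<open>auto simp: indicator_def\<close>)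
  qed
  have V_bound: "cmod (V f x) \<le> A x * (LINT t:{0..x}|lebesgue. A t * cmod (f t))"
    if f: "L2w b f" and x: "0 \<le> x" "x \<le> 1" for f x
  proof -
    have "cmod (V f x) \<le> (LINT t:{0..x}|lebesgue. cmod (K x t * f t))"
      unfolding V_def by (rule set_integral_norm_bound[OF Kf[OF that]])
    also have "\<dots> \<le> (LINT t:{0..x}|lebesgue. A x * (A t * cmod (f t)))"
    proof (rule set_integral_mono)
      fix t assume t: "t \<in> {0..x}"
      show "cmod (K x t * f t) \<le> A x * (A t * cmod (f t))"
        using t x mult_right_mono[OF bound[of t x], of "cmod (f t)"] by (simp add: norm_mult)
    qed (use Kf[OF that] Af'[OF f x(2)] in \<open>auto intro: set_integrable_norm\<close>)
    finally show ?thesis by simp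
  qed

  have s: "set_integrable lebesgue {0..1} s"
    using A by (simp add: set_integrable_lebesgue_on L2w_iff s_def[abs_def] norm_mult power_mult_distrib mult.commute)
  have s_nonneg: "0 \<le> s x" for x
    by (simp add: s_def)
  have S: "ac_deriv 0 1 S s"
    using ac_deriv_integral[OF s] by (simp add: S_def[abs_def])
  have S0: "S 0 = 0"
    by (simp add: S_def)
  have power_S: "(LINT t:{0..x}|lebesgue. s t * (S t ^ m / fact m)) = S x ^ Suc m / fact (Suc m)"
    if "0 \<le> x" "x \<le> 1" for x m
    using ac_deriv_diff_eq[OF ac_deriv_power_fact[OF S] _ _ that(2), of 0] that S0 by simp
  have power_S_integrable: "set_integrable lebesgue {0..x} (\<lambda>t. s t * (S t ^ m / fact m))"
    if "x \<le> 1" for x m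
    using that by (intro set_integrable_subset[OF ac_deriv_set_integrable[OF ac_deriv_power_fact[OF S]]]) auto
  have S_nonneg: "0 \<le> S x" if "0 \<le> x" "x \<le> 1" for x
    using that S_def s_nonneg by (auto simp: set_lebesgue_integral_def intro!: Bochner_Integration.integral_nonneg)
  have S_mono: "S x \<le> S 1" if "0 \<le> x" "x \<le> 1" for x
  proof -
    have "S 1 - S x = (LINT t:{x..1}|lebesgue. s t)"
      using ac_deriv_diff_eq[OF S that] by simp
    also have "\<dots> \<ge> 0"
      using s_nonneg by (auto simp: set_lebesgue_integral_def intro!: Bochner_Integration.integral_nonneg)
    finally show ?thesis by simp
  qed
  have G_L2w: "L2w b (\<lambda>x. complex_of_real (G x))"
    unfolding L2w_iff
  proof
    show "(\<lambda>x. complex_of_real (G x)) \<in> borel_measurable (lebesgue_on {0..1})"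
      unfolding G_def by measurable
    have "integrable (lebesgue_on {0..1}) s"
      using s by (simp add: set_integrable_lebesgue_on)
    then show "integrable (lebesgue_on {0..1}) (\<lambda>x. (cmod (b x * complex_of_real (G x)))\<^sup>2)"
    proof (rule Bochner_Integration.integrable_bound)
      show "AE x in lebesgue_on {0..1}. norm ((cmod (b x * complex_of_real (G x)))\<^sup>2) \<le> norm (s x)"
      proof (intro AE_I2)
        fix x
        have "cmod (b x * complex_of_real (G x)) = \<bar>A x\<bar> * cmod (invw b x)"
          by (cases "b x = 0") (auto simp: norm_mult G_def invw_def norm_inverse abs_mult power2_eq_square)
        then show "norm ((cmod (b x * complex_of_real (G x)))\<^sup>2) \<le> norm (s x)"
          by (simp add: s_def power_mult_distrib)
      qed
      show "(\<lambda>x. (cmod (b x * complex_of_real (G x)))\<^sup>2) \<in> borel_measurable (lebesgue_on {0..1})"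
        unfolding G_def by measurable
    qed
  qed
  have AG: "A x * G x = s x" for x
    by (simp add: G_def s_def power2_eq_square)

  have "L2w (invw b) (Bop b K f)" if f: "L2w b f" for f
  proof -
    have "L2w (invw b) (\<lambda>x. (b x)\<^sup>2 * f x)"
      unfolding L2w_iff
    proof
      note [measurable] = L2w_measurable[OF f]
      show "(\<lambda>x. (b x)\<^sup>2 * f x) \<in> borel_measurable (lebesgue_on {0..1})" by measurable
      have "integrable (lebesgue_on {0..1}) (\<lambda>x. (cmod (b x * f x))\<^sup>2)"
        using f by (simp add: L2w_iff)
      then show "integrable (lebesgue_on {0..1}) (\<lambda>x. (cmod (invw b x * ((b x)\<^sup>2 * f x)))\<^sup>2)"
        by (simp only: invw_b_square mult.assoc[symmetric])
    qed
    moreover have "L2w (invw b) (V f)"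
    proof (rule L2w_bound[OF A])
      show "V f \<in> borel_measurable (lebesgue_on {0..1})"
        by (rule V_measurable[OF L2w_measurable[OF f]])
      let ?C = "LINT t:{0..1}|lebesgue. A t * cmod (f t)"
      show "AE x in lebesgue_on {0..1}. cmod (V f x) \<le> ?C * cmod (complex_of_real (A x))"
      proof (intro AE_I2)
        fix x assume "x \<in> space (lebesgue_on {0..1::real})"
        then have x: "0 \<le> x" "x \<le> 1" by auto
        have "(LINT t:{0..x}|lebesgue. A t * cmod (f t)) \<le> ?C"
          using x A_nonneg by (intro set_integral_mono_set[OF Af[OF f]]) auto
        from mult_left_mono[OF this A_nonneg[OF x]] V_bound[OF f x] A_nonneg[OF x]
        show "cmod (V f x) \<le> ?C * cmod (complex_of_real (A x))"
          by (simp add: mult.commute)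
      qed
    qed simp
    ultimately show ?thesis
      unfolding Bop[abs_def] by (rule L2w_add) simp
  qed
  moreover have "AE x in lebesgue_on {0..1}. f x = g x"
    if f: "L2w b f" and g: "L2w b g" and eq: "AE x in lebesgue_on {0..1}. Bop b K f x = Bop b K g x" for f g
  proof -
    define h where "h x = f x - g x" for x
    have h: "L2w b h"
      unfolding h_def by (rule L2w_diff[OF f g]) simp
    \<comment> \<open>A Gronwall argument: b^2 h = - V h gives |h| \<le> G w, hence w' = A |h| \<le>
      s w almost everywhere. Starting from a bound C of the continuous function \<open>w\<close>,
      iteration yields w \<le> C S^m / m! for all m, which tends to 0.\<close>
    define w where "w x = (LINT t:{0..x}|lebesgue. A t * cmod (h t))" for x
    have w: "ac_deriv 0 1 w (\<lambda>t. A t * cmod (h t))"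
      using ac_deriv_integral[OF Af[OF h]] by (simp add: w_def[abs_def])
    have h_le: "AE x in lebesgue_on {0..1}. cmod (h x) \<le> G x * w x"
      using eq b_nonzero AE_space
    proof eventually_elim
      case (elim x)
      then have x: "0 \<le> x" "x \<le> 1" by auto
      have "V h x = V f x - V g x"
        unfolding V_def h_def using Kf[OF f x] Kf[OF g x] by (simp add: algebra_simps)
      then have "(b x)\<^sup>2 * h x = - V h x"
        using elim(1) unfolding Bop h_def by algebra
      then have "(cmod (b x))\<^sup>2 * cmod (h x) = cmod (V h x)"
        by (metis norm_minus_cancel norm_mult norm_power)
      also have "\<dots> \<le> A x * w x"
        unfolding w_def by (rule V_bound[OF h x])
      finally show ?case
        using elim(2) by (simp add: G_def invw_def norm_inverse power_inverse divide_inverse[symmetric] pos_le_divide_eq mult_ac)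
    qed
    obtain C where C: "\<And>x. x \<in> {0..1} \<Longrightarrow> \<bar>w x\<bar> \<le> C"
      using compact_imp_bounded[OF compact_continuous_image[OF ac_deriv_continuous[OF w]]]
      unfolding bounded_iff real_norm_def by blast
    have w_le: "w x \<le> C * (S x ^ m / fact m)" if "0 \<le> x" "x \<le> 1" for x m
      using that
    proof (induction m arbitrary: x)
      case 0
      then show ?case using C[of x] by auto
    next
      case (Suc m)
      have "w x \<le> (LINT t:{0..x}|lebesgue. C * (s t * (S t ^ m / fact m)))"
        unfolding w_def
      proof (rule set_integral_mono_AE)
        have "AE t in lebesgue. t \<in> {0..1} \<longrightarrow> cmod (h t) \<le> G t * w t"
          using h_le by (simp add: AE_restrict_space_iff)
        then show "AE t in lebesgue. t \<in> {0..x} \<longrightarrow> A t * cmod (h t) \<le> C * (s t * (S t ^ m / fact m))"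
        proof eventually_elim
          case (elim t)
          show ?case
          proof
            assume "t \<in> {0..x}"
            then have t: "0 \<le> t" "t \<le> 1" using Suc.prems by auto
            have "A t * cmod (h t) \<le> A t * (G t * w t)"
              using elim t A_nonneg[OF t] by (intro mult_left_mono) auto
            also have "\<dots> = s t * w t"
              by (simp flip: AG)
            also have "\<dots> \<le> s t * (C * (S t ^ m / fact m))"
              by (intro mult_left_mono Suc.IH t s_nonneg)
            finally show "A t * cmod (h t) \<le> C * (s t * (S t ^ m / fact m))"
              by (simp add: mult_ac)
          qed
        qed
      qed (use Af'[OF h] power_S_integrable Suc.prems in auto)
      then show ?case
        using Suc.prems by (simp only: set_integral_mult_right power_S)
    qed
    have w0: "w x \<le> 0" if "0 \<le> x" "x \<le> 1" for x
    proof -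
      have "(\<lambda>m. C * (S x ^ m / fact m)) \<longlonglongrightarrow> C * 0"
        using summable_LIMSEQ_zero[OF summable_exp_generic[of "S x"]]
        by (intro tendsto_intros) (simp add: divide_inverse mult.commute)
      then show ?thesis
        using w_le[OF that] by (intro LIMSEQ_le_const[where X = "\<lambda>m. C * (S x ^ m / fact m)"]) auto
    qed
    show ?thesis
      using h_le AE_space
    proof eventually_elim
      case (elim x)
      have "G x * w x \<le> 0"
        using elim w0[of x] A_nonneg[of x] by (auto simp: G_def intro!: mult_nonneg_nonpos)
      with elim(1) have "cmod (f x - g x) \<le> 0"
        unfolding h_def by linarith
      then show ?case by simp
    qed
  qed
  moreover have "\<exists>f. L2w b f \<and> (AE x in lebesgue_on {0..1}. Bop b K f x = h x)" if h: "L2w (invw b) h" for h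
  proof -
    \<comment> \<open>Terms of the Neumann series for f = b^-2 (h - V f).\<close>
    define g where "g = rec_nat (\<lambda>x. (invw b x)\<^sup>2 * h x) (\<lambda>_ f x. - ((invw b x)\<^sup>2 * V f x))"
    have g0: "g 0 = (\<lambda>x. (invw b x)\<^sup>2 * h x)" and gS: "g (Suc m) = (\<lambda>x. - ((invw b x)\<^sup>2 * V (g m) x))" for m
      by (simp_all add: g_def)
    have g_measurable [measurable]: "g m \<in> borel_measurable (lebesgue_on {0..1})" for m
    proof (induction m)
      case 0
      note [measurable] = L2w_measurable[OF h]
      show ?case unfolding g0 by measurable
    next
      case (Suc m)
      note [measurable] = V_measurable[OF Suc]
      show ?case unfolding gS by measurable
    qed
    have g0_L2w: "L2w b (g 0)"
      unfolding L2w_iff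
    proof
      have "integrable (lebesgue_on {0..1}) (\<lambda>x. (cmod (invw b x * h x))\<^sup>2)"
        using h by (simp add: L2w_iff)
      then show "integrable (lebesgue_on {0..1}) (\<lambda>x. (cmod (b x * g 0 x))\<^sup>2)"
        by (simp only: g0 b_invw_square mult.assoc[symmetric])
    qed (rule g_measurable)
    define C where "C = (LINT t:{0..1}|lebesgue. A t * cmod (g 0 t))"
    have C_nonneg: "0 \<le> C"
      unfolding C_def using A_nonneg
      by (auto simp: set_lebesgue_integral_def indicator_def intro!: Bochner_Integration.integral_nonneg)
    have G_nonneg: "0 \<le> G x" if "0 \<le> x" "x \<le> 1" for x
      using A_nonneg[OF that] by (simp add: G_def)
    have g_next: "cmod (g (Suc m) x) \<le> G x * (LINT t:{0..x}|lebesgue. A t * cmod (g m t))"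
      if "L2w b (g m)" "0 \<le> x" "x \<le> 1" for m x
      using mult_left_mono[OF V_bound[OF that], of "(cmod (invw b x))\<^sup>2"]
      by (simp add: gS norm_mult norm_power G_def mult_ac)
    have S_power_le: "S x ^ m / fact m \<le> S 1 ^ m / fact m" if "0 \<le> x" "x \<le> 1" for x m
      using S_mono[OF that] S_nonneg[OF that] by (intro divide_right_mono power_mono) auto
    \<comment> \<open>The estimate starts at index 1: \<open>g 0\<close> is merely in L_{2,b} and
      has no bound by \<open>G\<close>. One application of the integral operator creates the
      pointwise bound G C, and each further one raises the power of \<open>S\<close>.\<close>
    have g_L2w_le: "L2w b (g (Suc m)) \<and> (\<forall>x\<in>{0..1}. cmod (g (Suc m) x) \<le> G x * (C * (S x ^ m / fact m)))" for m
    proof (induction m)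
      case 0
      have le: "cmod (g (Suc 0) x) \<le> G x * C" if x: "0 \<le> x" "x \<le> 1" for x
      proof -
        have "(LINT t:{0..x}|lebesgue. A t * cmod (g 0 t)) \<le> C"
          unfolding C_def using x A_nonneg by (intro set_integral_mono_set[OF Af[OF g0_L2w]]) auto
        from mult_left_mono[OF this G_nonneg[OF x]] g_next[OF g0_L2w x] show ?thesis by simp
      qed
      have "L2w b (g (Suc 0))"
        by (rule L2w_bound[OF G_L2w, where C = C]) (use le G_nonneg in \<open>auto simp: mult.commute intro!: AE_I2\<close>)
      then show ?case using le by auto
    next
      case (Suc m)
      have le: "cmod (g (Suc (Suc m)) x) \<le> G x * (C * (S x ^ Suc m / fact (Suc m)))" if x: "0 \<le> x" "x \<le> 1" for x
      proof -
        have "(LINT t:{0..x}|lebesgue. A t * cmod (g (Suc m) t)) \<le> (LINT t:{0..x}|lebesgue. C * (s t * (S t ^ m / fact m)))"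
        proof (rule set_integral_mono)
          fix t assume "t \<in> {0..x}"
          then have t: "0 \<le> t" "t \<le> 1" using x by auto
          have "A t * cmod (g (Suc m) t) \<le> A t * (G t * (C * (S t ^ m / fact m)))"
            using Suc t by (intro mult_left_mono A_nonneg) auto
          then show "A t * cmod (g (Suc m) t) \<le> C * (s t * (S t ^ m / fact m))"
            by (simp add: mult_ac flip: AG)
        qed (use Af' Suc power_S_integrable x in auto)
        also have "\<dots> = C * (S x ^ Suc m / fact (Suc m))"
          using x by (simp only: set_integral_mult_right power_S mult.assoc)
        finally have "(LINT t:{0..x}|lebesgue. A t * cmod (g (Suc m) t)) \<le> C * (S x ^ Suc m / fact (Suc m))" .
        from mult_left_mono[OF this G_nonneg[OF x]] g_next[of "Suc m", OF _ x] Suc show ?thesis by auto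
      qed
      have "L2w b (g (Suc (Suc m)))"
      proof (rule L2w_bound[OF G_L2w, where C = "C * (S 1 ^ Suc m / fact (Suc m))"])
        show "AE x in lebesgue_on {0..1}. cmod (g (Suc (Suc m)) x) \<le> C * (S 1 ^ Suc m / fact (Suc m)) * cmod (complex_of_real (G x))"
        proof (intro AE_I2)
          fix x assume "x \<in> space (lebesgue_on {0..1::real})"
          then have x: "0 \<le> x" "x \<le> 1" by auto
          have "G x * (C * (S x ^ Suc m / fact (Suc m))) \<le> G x * (C * (S 1 ^ Suc m / fact (Suc m)))"
            by (intro mult_left_mono S_power_le x G_nonneg C_nonneg)
          with le[OF x] G_nonneg[OF x]
          show "cmod (g (Suc (Suc m)) x) \<le> C * (S 1 ^ Suc m / fact (Suc m)) * cmod (complex_of_real (G x))"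
            by (simp add: mult_ac del: power_Suc fact_Suc)
        qed
      qed auto
      then show ?case using le by auto
    qed
    have g_L2w: "L2w b (g m)" for m
      using g0_L2w g_L2w_le by (cases m) auto
    have exp_sums: "(\<lambda>m. S x ^ m / fact m) sums exp (S x)" for x
      using exp_converges[of "S x"] by (simp add: divide_inverse mult.commute)
    have g_norm_summable: "summable (\<lambda>m. cmod (g m x))" and g_sum_le: "(\<Sum>m. cmod (g (Suc m) x)) \<le> G x * (C * exp (S 1))"
      if x: "0 \<le> x" "x \<le> 1" for x
    proof -
      have sums: "(\<lambda>m. G x * (C * (S 1 ^ m / fact m))) sums (G x * (C * exp (S 1)))"
        by (intro sums_mult exp_sums)
      have le: "cmod (g (Suc m) x) \<le> G x * (C * (S 1 ^ m / fact m))" for m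
        using g_L2w_le[of m] x mult_left_mono[OF mult_left_mono[OF S_power_le[OF x, of m] C_nonneg] G_nonneg[OF x]] by force
      have summable: "summable (\<lambda>m. cmod (g (Suc m) x))"
        by (rule summable_comparison_test'[OF sums_summable[OF sums]]) (use le in simp)
      then show "summable (\<lambda>m. cmod (g m x))"
        by (subst (asm) summable_Suc_iff)
      show "(\<Sum>m. cmod (g (Suc m) x)) \<le> G x * (C * exp (S 1))"
        unfolding sums_unique[OF sums] by (rule suminf_le[OF le summable sums_summable[OF sums]])
    qed
    define f where "f x = (\<Sum>m. g m x)" for x
    \<comment> \<open>Only the tail of the series is dominated by a multiple of \<open>G\<close>;
      its head is put into L_{2,b} separately.\<close>
    define f1 where "f1 x = (\<Sum>m. g (Suc m) x)" for x
    have f_split: "f x = g 0 x + f1 x" if "0 \<le> x" "x \<le> 1" for x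
      unfolding f_def f1_def
      using suminf_split_head[OF summable_norm_cancel[OF g_norm_summable[OF that]]] by simp
    have f1: "L2w b f1"
    proof (rule L2w_bound[OF G_L2w])
      show "f1 \<in> borel_measurable (lebesgue_on {0..1})"
        unfolding f1_def by measurable
      show "AE x in lebesgue_on {0..1}. cmod (f1 x) \<le> (C * exp (S 1)) * cmod (complex_of_real (G x))"
      proof (intro AE_I2)
        fix x assume "x \<in> space (lebesgue_on {0..1::real})"
        then have x: "0 \<le> x" "x \<le> 1" by auto
        have "summable (\<lambda>m. cmod (g (Suc m) x))"
          using g_norm_summable[OF x] by (subst summable_Suc_iff)
        from summable_norm[OF this] g_sum_le[OF x] G_nonneg[OF x]
        show "cmod (f1 x) \<le> (C * exp (S 1)) * cmod (complex_of_real (G x))"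
          by (simp add: f1_def mult_ac)
      qed
    qed simp
    have f_L2w: "L2w b f"
    proof (rule L2w_bound[OF L2w_add[OF g0_L2w f1], where C = 1])
      show "f \<in> borel_measurable (lebesgue_on {0..1})"
        unfolding f_def by measurable
    qed (auto simp: f_split intro!: AE_I2)
    have V_sums: "(\<lambda>m. V (g m) x) sums V f x" if x: "0 \<le> x" "x \<le> 1" for x
    proof -
      let ?k = "\<lambda>m t. indicator {0..x} t *\<^sub>R (K x t * g m t)"
      have k: "integrable lebesgue (?k m)" for m
        using Kf[OF g_L2w x] by (simp add: set_integrable_def)
      have sm: "summable (\<lambda>m. norm (?k m t))" for t
      proof (cases "t \<in> {0..x}")
        case True
        then have "summable (\<lambda>m. cmod (K x t) * cmod (g m t))"
          using x by (intro summable_mult g_norm_summable) auto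
        then show ?thesis using True by (simp add: norm_mult)
      qed simp
      \<comment> \<open>Summability of the integrals of the norms allows exchanging series and
        integral. The head is again left out, because only the later terms have the factorial
        bound.\<close>
      have "summable (\<lambda>m. LINT t|lebesgue. norm (?k (Suc m) t))"
      proof (rule summable_comparison_test')
        have "summable (\<lambda>m. A x * (C * (S x ^ Suc m / fact (Suc m))))"
          using sums_summable[OF exp_sums[of x]] by (intro summable_mult, subst summable_Suc_iff)
        then show "summable (\<lambda>m. A x * (C * (S x ^ Suc m / fact (Suc m))))" .
        fix m :: nat
        have "(LINT t|lebesgue. norm (?k (Suc m) t)) = (LINT t:{0..x}|lebesgue. cmod (K x t * g (Suc m) t))"
          by (simp add: set_lebesgue_integral_def)
        also have "\<dots> \<le> (LINT t:{0..x}|lebesgue. (A x * C) * (s t * (S t ^ m / fact m)))"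
        proof (rule set_integral_mono)
          fix t assume t: "t \<in> {0..x}"
          have "cmod (K x t) * cmod (g (Suc m) t) \<le> (A x * A t) * (G t * (C * (S t ^ m / fact m)))"
            using t x g_L2w_le[of m] by (intro mult_mono bound) (auto intro!: mult_nonneg_nonneg A_nonneg)
          then show "cmod (K x t * g (Suc m) t) \<le> (A x * C) * (s t * (S t ^ m / fact m))"
            by (simp add: norm_mult mult_ac flip: AG)
        qed (use Kf[OF g_L2w x] power_S_integrable x in \<open>auto intro: set_integrable_norm\<close>)
        also have "\<dots> = A x * (C * (S x ^ Suc m / fact (Suc m)))"
          using x by (simp only: set_integral_mult_right power_S mult.assoc)
        finally show "norm (LINT t|lebesgue. norm (?k (Suc m) t)) \<le> A x * (C * (S x ^ Suc m / fact (Suc m)))"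
          by (simp del: norm_scaleR)
      qed
      then have "summable (\<lambda>m. LINT t|lebesgue. norm (?k m t))"
        by (subst (asm) summable_Suc_iff)
      from sums_integral[OF k _ this] sm
      have "(\<lambda>m. LINT t|lebesgue. ?k m t) sums (LINT t|lebesgue. (\<Sum>m. ?k m t))"
        by simp
      moreover have "(\<Sum>m. ?k m t) = indicator {0..x} t *\<^sub>R (K x t * f t)" for t
        using x by (auto simp: indicator_def f_def intro!: suminf_mult summable_norm_cancel[OF g_norm_summable])
      ultimately show ?thesis
        by (simp add: V_def set_lebesgue_integral_def)
    qed
    have "AE x in lebesgue_on {0..1}. Bop b K f x = h x"
      using b_nonzero AE_space
    proof eventually_elim
      case (elim x)
      then have x: "0 \<le> x" "x \<le> 1" by auto
      have "g (Suc m) x = - ((invw b x)\<^sup>2) * V (g m) x" for m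
        by (simp add: gS)
      then have "f1 x = - ((invw b x)\<^sup>2) * V f x"
        unfolding f1_def using sums_unique[OF sums_mult[OF V_sums[OF x], of "- ((invw b x)\<^sup>2)"]] by simp
      then have "f x = (invw b x)\<^sup>2 * (h x - V f x)"
        using f_split[OF x] by (simp add: g0 algebra_simps)
      then show ?case
        unfolding Bop using elim by (simp add: invw_def field_simps)
    qed
    with f_L2w show ?thesis by blast
  qed
  ultimately show ?thesis
    unfolding L2_bij_def by blast
qed

end

section \<open>The pieces of the kernel\<close>

lemma sum_rev_atMost: "(\<Sum>j\<le>k. f (k - j)) = (\<Sum>j\<le>(k::nat). f j)"
  by (rule sum.reindex_bij_witness[of _ "\<lambda>j. k - j" "\<lambda>j. k - j"]) auto

lemma mono_family_at_center: "mono_family a m j a = (if j = m then (-1) ^ m else 0)"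
  by (auto simp: mono_family_def)

text \<open>The m-th derivative is integrated by parts against (x - t)^(m-1) / (m-1)!. Centred at
  the upper end point, this kernel has a single nonvanishing derivative there, and its m-th
  derivative is zero, so only V(x) and the Taylor polynomial at 0 remain.\<close>

lemma ac_family_taylor_left:
  assumes V: "ac_family m V" and m: "0 < m" and x: "0 \<le> x" "x \<le> 1"
  shows "V 0 x = (\<Sum>j<m. V j 0 * of_real (x ^ j / fact j))
    + (LINT t:{0..x}|lebesgue. of_real ((x - t) ^ (m - 1) / fact (m - 1)) * V m t)"
proof -
  obtain l where l: "m = Suc l" using m by (cases m) auto
  have "(LINT t:{0..x}|lebesgue. mono_family x l 0 t * V m t) =
    (\<Sum>j<m. (-1) ^ j * (mono_family x l j x * V (m - 1 - j) x - mono_family x l j 0 * V (m - 1 - j) 0))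
    + (-1) ^ m * (LINT t:{0..x}|lebesgue. mono_family x l m t * V 0 t)"
    using assms by (intro ac_family_by_parts ac_family_mono_family) auto
  also have "(LINT t:{0..x}|lebesgue. mono_family x l m t * V 0 t) = 0"
    by (simp add: l mono_family_def)
  also have "(\<Sum>j<m. (-1) ^ j * (mono_family x l j x * V (m - 1 - j) x - mono_family x l j 0 * V (m - 1 - j) 0))
    = (\<Sum>j\<le>l. (if j = l then V 0 x else 0)) - (\<Sum>j\<le>l. V (l - j) 0 * of_real (x ^ (l - j) / fact (l - j)))"
    unfolding l lessThan_Suc_atMost sum_subtractf[symmetric]
    by (rule sum.cong) (auto simp: mono_family_at_center, auto simp: mono_family_def algebra_simps simp flip: power_add)
  also have "\<dots> = V 0 x - (\<Sum>j<m. V j 0 * of_real (x ^ j / fact j))"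
    using sum_rev_atMost[of "\<lambda>j. V j 0 * of_real (x ^ j / fact j)" l]
    by (simp add: l lessThan_Suc_atMost)
  finally show ?thesis
    by (simp add: l mono_family_def algebra_simps)
qed

text \<open>The kernel is now centred at the lower end point \<tau>, and the zero boundary values at
  1 leave no polynomial part; this is the expansion for test functions. The sign combines (\<tau> -
  x)^l = (-1)^l (x - \<tau>)^l with the minus sign of a lower boundary term.\<close>

lemma ac_family_taylor_right:
  assumes V: "ac_family m V" and m: "0 < m" and V1: "\<And>j. j < m \<Longrightarrow> V j 1 = 0" and x: "0 \<le> \<tau>" "\<tau> \<le> 1"
  shows "V 0 \<tau> = (-1) ^ m * (LINT x:{\<tau>..1}|lebesgue. of_real ((x - \<tau>) ^ (m - 1) / fact (m - 1)) * V m x)"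
proof -
  obtain l where l: "m = Suc l" using m by (cases m) auto
  have "(LINT x:{\<tau>..1}|lebesgue. mono_family \<tau> l 0 x * V m x) =
    (\<Sum>j<m. (-1) ^ j * (mono_family \<tau> l j 1 * V (m - 1 - j) 1 - mono_family \<tau> l j \<tau> * V (m - 1 - j) \<tau>))
    + (-1) ^ m * (LINT t:{\<tau>..1}|lebesgue. mono_family \<tau> l m t * V 0 t)"
    using assms by (intro ac_family_by_parts ac_family_mono_family) auto
  also have "(LINT x:{\<tau>..1}|lebesgue. mono_family \<tau> l m x * V 0 x) = 0"
    by (simp add: l mono_family_def)
  also have "(\<Sum>j<m. (-1) ^ j * (mono_family \<tau> l j 1 * V (m - 1 - j) 1 - mono_family \<tau> l j \<tau> * V (m - 1 - j) \<tau>))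
    = (\<Sum>j\<le>l. (if j = l then - V 0 \<tau> else 0))"
    unfolding l lessThan_Suc_atMost
    by (rule sum.cong) (auto simp: mono_family_at_center V1 l simp flip: power_add)
  also have "(LINT x:{\<tau>..1}|lebesgue. mono_family \<tau> l 0 x * V m x) =
    (LINT x:{\<tau>..1}|lebesgue. (-1) ^ l * (of_real ((x - \<tau>) ^ l / fact l) * V m x))"
  proof (rule set_lebesgue_integral_cong)
    show "\<forall>x. x \<in> {\<tau>..1} \<longrightarrow> mono_family \<tau> l 0 x * V m x = (-1) ^ l * (of_real ((x - \<tau>) ^ l / fact l) * V m x)"
    proof (intro allI impI)
      fix x
      have "(\<tau> - x) ^ l = (-1) ^ l * (x - \<tau>) ^ l"
        by (simp flip: power_mult_distrib)
      then show "mono_family \<tau> l 0 x * V m x = (-1) ^ l * (of_real ((x - \<tau>) ^ l / fact l) * V m x)"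
        by (simp add: mono_family_def)
    qed
  qed simp
  finally have "(-1) ^ l * (LINT x:{\<tau>..1}|lebesgue. of_real ((x - \<tau>) ^ l / fact l) * V m x) = - V 0 \<tau>"
    unfolding set_integral_mult_right by simp
  then show ?thesis
    by (simp add: l)
qed

text \<open>Successive primitives of \<open>g\<close> that vanish at 0, indexed as a derivative
  family with \<open>g\<close> at order k. They supply test functions with a prescribed top
  derivative, once the conditions at 1 are met.\<close>

definition iter_family :: "nat \<Rightarrow> (real \<Rightarrow> complex) \<Rightarrow> nat \<Rightarrow> real \<Rightarrow> complex" where
  "iter_family k g j = ((\<lambda>f x. LINT t:{0..x}|lebesgue. f t) ^^ (k - j)) g"

lemma iter_family_top [simp]: "iter_family k g k = g"
  by (simp add: iter_family_def)

lemma iter_family_less: "j < k \<Longrightarrow> iter_family k g j = (\<lambda>x. LINT t:{0..x}|lebesgue. iter_family k g (Suc j) t)"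
  by (simp add: iter_family_def flip: Suc_diff_Suc)

lemma iter_family_0: "j < k \<Longrightarrow> iter_family k g j 0 = 0"
  by (simp add: iter_family_less)

lemma ac_family_iter_family:
  assumes g: "set_integrable lebesgue {0..1} g"
  shows "ac_family k (iter_family k g)"
proof -
  have I: "set_integrable lebesgue {0..1} (iter_family k g (k - i))" for i
  proof (induction i)
    case (Suc i)
    show ?case
    proof (cases "i < k")
      case True
      then have "k - Suc i < k" "Suc (k - Suc i) = k - i" by auto
      then have "ac_deriv 0 1 (iter_family k g (k - Suc i)) (iter_family k g (k - i))"
        using ac_deriv_integral[OF Suc] by (simp add: iter_family_less)
      then show ?thesis
        by (intro absolutely_integrable_continuous_real ac_deriv_continuous)
    qed (use Suc in auto)
  qed (use g in auto)
  show ?thesis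
    unfolding ac_family_iff
  proof safe
    fix j assume j: "j < k"
    then have "set_integrable lebesgue {0..1} (iter_family k g (Suc j))"
      using I[of "k - Suc j"] by simp
    from ac_deriv_integral[OF this] show "ac_deriv 0 1 (iter_family k g j) (iter_family k g (Suc j))"
      by (simp add: iter_family_less[OF j])
  qed
qed

text \<open>Cauchy's formula for repeated integration, as the Taylor formula with zero initial
  values. It gives continuity of such parameter integrals at once and identifies the values at 1 as
  moments.\<close>

lemma iter_family_eq:
  assumes "set_integrable lebesgue {0..1} g" "0 \<le> x" "x \<le> 1"
  shows "iter_family (Suc l) g 0 x = (LINT t:{0..x}|lebesgue. of_real ((x - t) ^ l / fact l) * g t)"
  using ac_family_taylor_left[OF ac_family_iter_family[OF assms(1), of "Suc l"] _ assms(2,3)]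
  by (simp add: iter_family_0)

lemma continuous_on_iterated_integral:
  assumes "set_integrable lebesgue {0..1} g"
  shows "continuous_on {0..1} (\<lambda>x. LINT t:{0..x}|lebesgue. complex_of_real ((x - t) ^ l / fact l) * g t)"
proof (rule continuous_on_eq)
  show "continuous_on {0..1} (iter_family (Suc l) g 0)"
    using ac_family_continuous[OF ac_family_iter_family[OF assms, of "Suc l"]] by simp
qed (use iter_family_eq[OF assms] in auto)

text \<open>The coefficient of \<phi>^(n-\<nu>) y^(n-k+\<nu>) after the Leibniz rule is applied to
  the terms of p_k and q_(k-1). The case \<nu> = 0 is explicit because natural subtraction makes
  \<nu> - 1 equal to 0, and the binomial coefficient would be 1 instead of 0.\<close>

definition rcoef :: "(nat \<Rightarrow> real \<Rightarrow> complex) \<Rightarrow> (nat \<Rightarrow> real \<Rightarrow> complex) \<Rightarrow> nat \<Rightarrow> nat \<Rightarrow> real \<Rightarrow> complex" where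
  "rcoef P Q k \<nu> x = of_nat (k choose \<nu>) * P k x +
     \<i> * (of_nat ((k - 1) choose \<nu>) - (if \<nu> = 0 then 0 else of_nat ((k - 1) choose (\<nu> - 1)))) * Q (k - 1) x"

definition mid_kernel :: "nat \<Rightarrow> nat \<Rightarrow> (real \<Rightarrow> complex) \<Rightarrow> real \<Rightarrow> real \<Rightarrow> complex" where
  "mid_kernel i j r x t = (LINT \<tau>:{t..x}|lebesgue.
     of_real ((x - \<tau>) ^ i / fact i) * r \<tau> * of_real ((\<tau> - t) ^ j / fact j))"

text \<open>The contribution to the kernel of the derivatives of order \<open>n - \<nu>\<close> of \<open>\<phi>\<close> and of order
  \<open>n - k + \<nu>\<close> of \<open>y\<close>; \<open>upiece\<close> below is the corresponding contribution of the initial values of \<open>y\<close>.\<close>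

definition kpiece :: "(nat \<Rightarrow> real \<Rightarrow> complex) \<Rightarrow> (nat \<Rightarrow> real \<Rightarrow> complex) \<Rightarrow> nat \<Rightarrow> nat \<Rightarrow> real \<Rightarrow> real \<Rightarrow> complex" where
  "kpiece P Q k \<nu> x t =
     (if \<nu> = 0 then of_real ((x - t) ^ (k - 1) / fact (k - 1)) * rcoef P Q k 0 x
      else if \<nu> = k then (-1) ^ k * (of_real ((x - t) ^ (k - 1) / fact (k - 1)) * rcoef P Q k k t)
      else (-1) ^ \<nu> * mid_kernel (\<nu> - 1) (k - 1 - \<nu>) (rcoef P Q k \<nu>) x t)"

text \<open>The terms outside the integrals are the extreme cases \<nu> = 0 and \<nu> = k, in which
  \<phi> or y already has order n and is not expanded. The sign of Q at t comes from the second
  binomial coefficient, the only one left at \<nu> = k.\<close>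

lemma Kker_eq_sum_kpiece: "Kker n P Q x t = (\<Sum>k=1..n. \<Sum>\<nu>\<le>k. kpiece P Q k \<nu> x t)"
  unfolding Kker_def
proof (rule sum.cong[OF refl])
  fix k assume "k \<in> {1..n}"
  then obtain l where k: "k = Suc l" by (cases k) auto
  have split: "{..k} = insert 0 (insert k {1..k-1})"
    by (auto simp: k)
  have "(\<Sum>\<nu>\<le>k. kpiece P Q k \<nu> x t) = kpiece P Q k 0 x t + (kpiece P Q k k x t + (\<Sum>\<nu>=1..k-1. kpiece P Q k \<nu> x t))"
    unfolding split by (subst sum.insert; simp add: k)+
  moreover have "kpiece P Q k 0 x t + kpiece P Q k k x t = of_real ((x - t) ^ (k - 1) / fact (k - 1)) *
       (P k x + \<i> * Q (k - 1) x + (-1) ^ k * (P k t - \<i> * Q (k - 1) t))"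
    by (simp add: kpiece_def rcoef_def k binomial_eq_0 algebra_simps add_divide_distrib diff_divide_distrib)
  moreover have "(\<Sum>\<nu>=1..k-1. kpiece P Q k \<nu> x t) = (\<Sum>\<nu>=1..k-1. (-1) ^ \<nu> * set_lebesgue_integral lebesgue {t..x} (\<lambda>\<tau>.
          of_real ((x - \<tau>) ^ (\<nu> - 1) / fact (\<nu> - 1)) *
          (of_nat (k choose \<nu>) * P k \<tau>
             + \<i> * (of_nat ((k - 1) choose \<nu>) - of_nat ((k - 1) choose (\<nu> - 1))) * Q (k - 1) \<tau>) *
          of_real ((\<tau> - t) ^ (k - 1 - \<nu>) / fact (k - 1 - \<nu>))))"
    by (rule sum.cong) (auto simp: kpiece_def mid_kernel_def rcoef_def)
  ultimately show "of_real ((x - t) ^ (k - 1) / fact (k - 1)) *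
       (P k x + \<i> * Q (k - 1) x + (-1) ^ k * (P k t - \<i> * Q (k - 1) t))
     + (\<Sum>\<nu>=1..k-1. (-1) ^ \<nu> * set_lebesgue_integral lebesgue {t..x} (\<lambda>\<tau>.
          of_real ((x - \<tau>) ^ (\<nu> - 1) / fact (\<nu> - 1)) *
          (of_nat (k choose \<nu>) * P k \<tau>
             + \<i> * (of_nat ((k - 1) choose \<nu>) - of_nat ((k - 1) choose (\<nu> - 1))) * Q (k - 1) \<tau>) *
          of_real ((\<tau> - t) ^ (k - 1 - \<nu>) / fact (k - 1 - \<nu>)))) = (\<Sum>\<nu>\<le>k. kpiece P Q k \<nu> x t)"
    by (simp only: add.assoc[symmetric])
qed

section \<open>Bounds and measurability of the kernel\<close>

lemma power_div_fact_le_1: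
  fixes x :: real
  assumes "0 \<le> x" "x \<le> 1"
  shows "x ^ i / fact i \<le> 1" "0 \<le> x ^ i / fact i"
proof -
  have "x ^ i \<le> fact i"
    using power_le_one[OF assms, of i] fact_ge_1[of i] by (metis order_trans)
  then show "x ^ i / fact i \<le> 1" by simp
qed (use assms in simp)

lemma mid_kernel_bound:
  assumes r: "set_integrable lebesgue {0..1} r" and "0 \<le> t" "t \<le> x" "x \<le> 1"
  shows "cmod (mid_kernel i j r x t) \<le> (LINT \<tau>:{0..1}|lebesgue. cmod (r \<tau>))"
proof -
  have sub: "set_integrable lebesgue {t..x} r"
    using assms by (intro set_integrable_subset[OF r]) auto
  have int: "set_integrable lebesgue {t..x} (\<lambda>\<tau>. of_real ((x - \<tau>) ^ i / fact i) * r \<tau> * of_real ((\<tau> - t) ^ j / fact j))"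
    using set_integrable_mult_continuous[OF _ sub, of "\<lambda>\<tau>. of_real ((x - \<tau>) ^ i / fact i) * of_real ((\<tau> - t) ^ j / fact j)"]
    by (simp add: mult_ac continuous_intros)
  have "cmod (mid_kernel i j r x t) \<le> (LINT \<tau>:{t..x}|lebesgue. cmod (of_real ((x - \<tau>) ^ i / fact i) * r \<tau> * of_real ((\<tau> - t) ^ j / fact j)))"
    unfolding mid_kernel_def by (rule set_integral_norm_bound[OF int])
  also have "\<dots> \<le> (LINT \<tau>:{t..x}|lebesgue. cmod (r \<tau>))"
  proof (rule set_integral_mono)
    fix \<tau> assume \<tau>: "\<tau> \<in> {t..x}"
    have "cmod (of_real ((x - \<tau>) ^ i / fact i)) \<le> 1" "cmod (of_real ((\<tau> - t) ^ j / fact j)) \<le> 1"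
      unfolding norm_of_real using assms \<tau> power_div_fact_le_1[of "x - \<tau>" i] power_div_fact_le_1[of "\<tau> - t" j] by auto
    from mult_mono[OF mult_right_mono[OF this(1), of "cmod (r \<tau>)"] this(2)]
    show "cmod (of_real ((x - \<tau>) ^ i / fact i) * r \<tau> * of_real ((\<tau> - t) ^ j / fact j)) \<le> cmod (r \<tau>)"
      by (simp only: norm_mult) simp
  qed (use int sub in \<open>auto intro: set_integrable_norm\<close>)
  also have "\<dots> \<le> (LINT \<tau>:{0..1}|lebesgue. cmod (r \<tau>))"
    using assms by (intro set_integral_mono_set set_integrable_norm r) auto
  finally show ?thesis .
qed

lemma mid_kernel_measurable [measurable]:
  assumes [measurable]: "r \<in> borel_measurable lebesgue"
  shows "(\<lambda>p. mid_kernel i j r (fst p) (snd p)) \<in> borel_measurable (lebesgue \<Otimes>\<^sub>M lebesgue)"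
proof -
  have "(\<lambda>p. LINT \<tau>|lebesgue. (if snd p \<le> \<tau> \<and> \<tau> \<le> fst p then 1 else 0) *\<^sub>R
     (of_real ((fst p - \<tau>) ^ i / fact i) * r \<tau> * of_real ((\<tau> - snd p) ^ j / fact j))) \<in> borel_measurable (lebesgue \<Otimes>\<^sub>M lebesgue)"
    by measurable
  also have "(\<lambda>p. LINT \<tau>|lebesgue. (if snd p \<le> \<tau> \<and> \<tau> \<le> fst p then 1 else 0) *\<^sub>R
     (of_real ((fst p - \<tau>) ^ i / fact i) * r \<tau> * of_real ((\<tau> - snd p) ^ j / fact j))) = (\<lambda>p. mid_kernel i j r (fst p) (snd p))"
    unfolding mid_kernel_def set_lebesgue_integral_def
    by (intro ext Bochner_Integration.integral_cong) (auto simp: indicator_def)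
  finally show ?thesis .
qed

context weight begin

lemma L2w_b_square: "L2w b f \<Longrightarrow> L2w (invw b) (\<lambda>x. (b x)\<^sup>2 * f x)"
  unfolding L2w_iff by (auto simp only: invw_b_square mult.assoc[symmetric] intro!: borel_measurable_times borel_measurable_power b_measurable)

lemma L2w_rcoef:
  assumes "L2w (invw b) (P k)" "L2w (invw b) (Q (k - 1))"
  shows "L2w (invw b) (rcoef P Q k \<nu>)"
  unfolding rcoef_def[abs_def] by (intro L2w_add L2w_cmult assms invw_measurable)

lemma kpiece_measurable:
  assumes P: "L2w (invw b) (P k)" and Q: "L2w (invw b) (Q (k - 1))"
  shows "(\<lambda>(x,t). if 0 \<le> t \<and> t \<le> x \<and> x \<le> 1 then kpiece P Q k \<nu> x t else 0) \<in> borel_measurable (lebesgue \<Otimes>\<^sub>M lebesgue)"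
proof -
  \<comment> \<open>The coefficient is measurable only on [0,1]; cutting it off changes nothing on
    the triangle, where all arguments and integration variables lie in [0,1].\<close>
  define r where "r = (\<lambda>x. indicator {0..1} x *\<^sub>R rcoef P Q k \<nu> x)"
  have [measurable]: "r \<in> borel_measurable lebesgue"
    using L2w_measurable[OF L2w_rcoef[of P k Q, OF P Q]]
    by (simp add: r_def set_borel_measurable_def flip: set_borel_measurable_lebesgue_on)
  have r: "r x = rcoef P Q k \<nu> x" if "0 \<le> x" "x \<le> 1" for x
    using that by (simp add: r_def)
  have mid: "mid_kernel i j r x t = mid_kernel i j (rcoef P Q k \<nu>) x t" if "0 \<le> t" "t \<le> x" "x \<le> 1" for i j x t
    unfolding mid_kernel_def using that r by (intro set_lebesgue_integral_cong) auto
  have "(\<lambda>p. if 0 \<le> snd p \<and> snd p \<le> fst p \<and> fst p \<le> 1 then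
      (if \<nu> = 0 then of_real ((fst p - snd p) ^ (k - 1) / fact (k - 1)) * r (fst p)
       else if \<nu> = k then (-1) ^ k * (of_real ((fst p - snd p) ^ (k - 1) / fact (k - 1)) * r (snd p))
       else (-1) ^ \<nu> * mid_kernel (\<nu> - 1) (k - 1 - \<nu>) r (fst p) (snd p)) else 0) \<in> borel_measurable (lebesgue \<Otimes>\<^sub>M lebesgue)"
    (is "?f \<in> _")
    by measurable
  also have "?f = (\<lambda>(x,t). if 0 \<le> t \<and> t \<le> x \<and> x \<le> 1 then kpiece P Q k \<nu> x t else 0)"
  proof (rule ext, clarify)
    fix x t :: real
    show "?f (x, t) = (if 0 \<le> t \<and> t \<le> x \<and> x \<le> 1 then kpiece P Q k \<nu> x t else 0)"
      by (cases "0 \<le> t \<and> t \<le> x \<and> x \<le> 1") (simp_all only: fst_conv snd_conv if_True if_False kpiece_def, auto simp: r mid)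
  qed
  finally show ?thesis .
qed

lemma Kker_measurable:
  assumes "\<And>k. k \<in> {1..n} \<Longrightarrow> L2w (invw b) (P k)" "\<And>k. k \<in> {1..n} \<Longrightarrow> L2w (invw b) (Q (k - 1))"
  shows "(\<lambda>(x,t). if 0 \<le> t \<and> t \<le> x \<and> x \<le> 1 then Kker n P Q x t else 0) \<in> borel_measurable (lebesgue \<Otimes>\<^sub>M lebesgue)"
proof -
  have "(\<lambda>p. \<Sum>k=1..n. \<Sum>\<nu>\<le>k. (\<lambda>(x,t). if 0 \<le> t \<and> t \<le> x \<and> x \<le> 1 then kpiece P Q k \<nu> x t else 0) p) \<in> borel_measurable (lebesgue \<Otimes>\<^sub>M lebesgue)"
    by (intro borel_measurable_sum kpiece_measurable assms)
  also have "(\<lambda>p. \<Sum>k=1..n. \<Sum>\<nu>\<le>k. (\<lambda>(x,t). if 0 \<le> t \<and> t \<le> x \<and> x \<le> 1 then kpiece P Q k \<nu> x t else 0) p)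
    = (\<lambda>(x,t). if 0 \<le> t \<and> t \<le> x \<and> x \<le> 1 then Kker n P Q x t else 0)"
    by (auto simp: Kker_eq_sum_kpiece fun_eq_iff)
  finally show ?thesis .
qed

text \<open>An extreme piece is its coefficient at x or at t times a factor of modulus at most 1,
  and a middle piece is at most the L1 norm \<open>c k \<nu>\<close> of its coefficient. These
  constants may enter \<open>a\<close>, since constants lie in L_{2,1/b}.\<close>

lemma Kker_bound:
  assumes P: "\<And>k. k \<in> {1..n} \<Longrightarrow> L2w (invw b) (P k)" and Q: "\<And>k. k \<in> {1..n} \<Longrightarrow> L2w (invw b) (Q (k - 1))"
  obtains a :: "real \<Rightarrow> real" where "L2w (invw b) (\<lambda>x. complex_of_real (a x))" "\<And>x. 0 \<le> a x"
    "\<And>x t. 0 \<le> t \<Longrightarrow> t \<le> x \<Longrightarrow> x \<le> 1 \<Longrightarrow> cmod (Kker n P Q x t) \<le> a x + a t"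
proof
  define c where "c k \<nu> = (LINT x:{0..1}|lebesgue. cmod (rcoef P Q k \<nu> x))" for k \<nu>
  define a where "a x = (\<Sum>k=1..n. \<Sum>\<nu>\<le>k. cmod (rcoef P Q k \<nu> x) + c k \<nu>)" for x
  have c: "0 \<le> c k \<nu>" for k \<nu>
    unfolding c_def set_lebesgue_integral_def by (intro Bochner_Integration.integral_nonneg) simp
  show "0 \<le> a x" for x
    unfolding a_def by (intro sum_nonneg add_nonneg_nonneg c norm_ge_zero)
  show "L2w (invw b) (\<lambda>x. complex_of_real (a x))"
    unfolding a_def of_real_sum of_real_add
    using P Q L2w_cmult[OF L2w_one(2)] by (intro L2w_sum L2w_add L2w_cmod L2w_rcoef) auto
  fix x t :: real assume xt: "0 \<le> t" "t \<le> x" "x \<le> 1"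
  have piece: "cmod (kpiece P Q k \<nu> x t) \<le> (cmod (rcoef P Q k \<nu> x) + c k \<nu>) + (cmod (rcoef P Q k \<nu> t) + c k \<nu>)"
    if k: "k \<in> {1..n}" for k \<nu>
  proof -
    have e: "0 \<le> (x - t) ^ (k - 1) / fact (k - 1)" "(x - t) ^ (k - 1) / fact (k - 1) \<le> 1"
      using power_div_fact_le_1[of "x - t"] xt by auto
    have "cmod (of_real ((x - t) ^ (k - 1) / fact (k - 1)) * z) \<le> cmod z" for z
      unfolding norm_mult norm_of_real abs_of_nonneg[OF e(1)] by (rule mult_left_le_one_le[OF norm_ge_zero e])
    moreover have "cmod (mid_kernel i j (rcoef P Q k \<nu>) x t) \<le> c k \<nu>" for i j
      unfolding c_def using L2w_integrable(2)[OF L2w_rcoef[of P k Q, OF P[OF k] Q[OF k]]] xt by (intro mid_kernel_bound) auto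
    moreover have "cmod ((-1) ^ i * z) = cmod z" for i :: nat and z :: complex
      by (simp add: norm_mult norm_power)
    ultimately have "cmod (kpiece P Q k \<nu> x t) \<le> (if \<nu> = 0 then cmod (rcoef P Q k \<nu> x) else if \<nu> = k then cmod (rcoef P Q k \<nu> t) else c k \<nu>)"
      unfolding kpiece_def by (simp del: of_real_divide of_real_power)
    also have "\<dots> \<le> (cmod (rcoef P Q k \<nu> x) + c k \<nu>) + (cmod (rcoef P Q k \<nu> t) + c k \<nu>)"
      using c[of k \<nu>] by (auto simp: add_nonneg_nonneg)
    finally show ?thesis .
  qed
  have "cmod (Kker n P Q x t) \<le> (\<Sum>k=1..n. \<Sum>\<nu>\<le>k. cmod (kpiece P Q k \<nu> x t))"
    unfolding Kker_eq_sum_kpiece by (intro sum_norm_le order_refl)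
  also have "\<dots> \<le> (\<Sum>k=1..n. \<Sum>\<nu>\<le>k. (cmod (rcoef P Q k \<nu> x) + c k \<nu>) + (cmod (rcoef P Q k \<nu> t) + c k \<nu>))"
    by (intro sum_mono piece)
  also have "\<dots> = a x + a t"
    by (simp only: a_def sum.distrib)
  finally show "cmod (Kker n P Q x t) \<le> a x + a t" .
qed

text \<open>The sum bound becomes a product bound through a(x) + a(t) \<le> (1 + a(x)) (1 + a(t)),
  valid as a \<ge> 0.\<close>

lemma L2_bij_Kker:
  assumes P: "\<And>k. k \<in> {1..n} \<Longrightarrow> L2w (invw b) (P k)" and Q: "\<And>k. k \<in> {1..n} \<Longrightarrow> L2w (invw b) (Q (k - 1))"
  shows "L2_bij b (Bop b (Kker n P Q))"
proof -
  obtain a :: "real \<Rightarrow> real" where a: "L2w (invw b) (\<lambda>x. complex_of_real (a x))" "\<And>x. 0 \<le> a x"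
    "\<And>x t. 0 \<le> t \<Longrightarrow> t \<le> x \<Longrightarrow> x \<le> 1 \<Longrightarrow> cmod (Kker n P Q x t) \<le> a x + a t"
    using Kker_bound[of n P Q, OF assms] by blast
  show ?thesis
  proof (rule volterra_L2_bij[OF Kker_measurable[of n P Q, OF assms], where A = "\<lambda>x. 1 + a x"])
    show "L2w (invw b) (\<lambda>x. complex_of_real (1 + a x))"
      using L2w_add[OF L2w_one(2) a(1)] by simp
    show "cmod (Kker n P Q x t) \<le> (1 + a x) * (1 + a t)" if "0 \<le> t" "t \<le> x" "x \<le> 1" for x t
      using a(3)[OF that] mult_nonneg_nonneg[OF a(2)[of x] a(2)[of t]] by (simp add: algebra_simps)
  qed (assumption | intro add_nonneg_nonneg zero_le_one a(2))+
qed

text \<open>At most one factor has top order n; the other is continuous on [0,1] and thus a bounded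
  multiplier of L_{2,b}.\<close>

lemma L2w_mult_ac_families:
  assumes D: "Wb b n D" and Y: "Wb b n Y" and ij: "i \<le> n" "j \<le> n" "i < n \<or> j < n"
  shows "L2w b (\<lambda>x. D i x * Y j x)"
proof -
  have *: "L2w b (\<lambda>x. U i x * Z j x)" if U: "Wb b n U" and Z: "Wb b n Z" and i: "i < n" and j: "j \<le> n" for U Z i j
  proof -
    have "continuous_on {0..1} (U i)"
      using U i by (auto simp: Wb_def intro: ac_family_continuous)
    moreover have "L2w b (Z j)"
      using Z j L2w_continuous(1)[OF ac_family_continuous[of n Z j]] by (cases "j = n") (auto simp: Wb_def)
    ultimately show ?thesis
      by (intro L2w_mult_continuous) auto
  qed
  show ?thesis
    using *[OF D Y, of i j] *[OF Y D, of j i] ij by (auto simp: mult.commute)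
qed

text \<open>A primitive represents its functional only on \<open>W0b\<close>, so the products formed
  by \<open>fmul\<close> must be recognised as test functions. They vanish at the ends because every
  Leibniz term of order below k contains a derivative of \<open>D\<close> of order below n.\<close>

lemma W0b_leib:
  assumes D: "W0b b n D" and Y: "Wb b n Y" and le: "a + k \<le> n" "c + k \<le> n" "a < n \<or> c < n"
  shows "W0b b k (leib (shiftF a D) (shiftF c Y))"
  unfolding W0b_def Wb_def
proof (intro conjI allI impI)
  have DW: "Wb b n D" using D by (simp add: W0b_def)
  show "ac_family k (leib (shiftF a D) (shiftF c Y))"
    using DW Y le
    by (intro ac_family_leib ac_family_shiftF) (auto simp: Wb_def add.commute intro: ac_family_mono)
  show "L2w b (leib (shiftF a D) (shiftF c Y) k)"
  proof -
    have "L2w b (\<lambda>x. \<Sum>i\<le>k. of_nat (k choose i) * (D (i + a) x * Y (k - i + c) x))"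
      using le by (intro L2w_sum L2w_cmult L2w_mult_ac_families[OF DW Y]) auto
    then show ?thesis
      by (simp add: leib_def shiftF_def mult.assoc)
  qed
  fix j assume "j < k"
  then show "leib (shiftF a D) (shiftF c Y) j 0 = 0" "leib (shiftF a D) (shiftF c Y) j 1 = 0"
    using D le by (auto simp: leib_def shiftF_def W0b_def intro!: sum.neutral)
qed

end

section \<open>Leibniz expansion of the functionals\<close>

lemma fdern_eq: "fdern m f D = (-1) ^ m * f (shiftF m D)"
  unfolding fdern_def
  by (induction m arbitrary: D) (simp_all add: fder_def shiftF_def)

text \<open>Reversing the sum counts terms by \<nu>, the number of orders by which the derivative of
  \<open>D\<close> falls short of n; with this index the contributions of p_k and q_(k-1) can be
  added.\<close>

lemma leib_shiftF_rev:
  assumes "a + k = n"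
  shows "leib (shiftF a D) (shiftF c Y) k x = (\<Sum>\<nu>\<le>k. of_nat (k choose \<nu>) * D (n - \<nu>) x * Y (\<nu> + c) x)"
proof -
  have "leib (shiftF a D) (shiftF c Y) k x = (\<Sum>\<nu>\<le>k. of_nat (k choose (k - \<nu>)) * D (n - (k - \<nu>)) x * Y (k - \<nu> + c) x)"
    unfolding leib_def shiftF_def
  proof (rule sum.cong[OF refl])
    fix i assume "i \<in> {..k}"
    then have "n - (k - i) = i + a" "k choose (k - i) = k choose i"
      using assms by (auto simp: binomial_symmetric[symmetric])
    then show "of_nat (k choose i) * D (i + a) x * Y (k - i + c) x = of_nat (k choose (k - i)) * D (n - (k - i)) x * Y (k - i + c) x"
      by simp
  qed
  also have "\<dots> = (\<Sum>\<nu>\<le>k. of_nat (k choose \<nu>) * D (n - \<nu>) x * Y (\<nu> + c) x)"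
    by (rule sum_rev_atMost)
  finally show ?thesis .
qed

text \<open>A purely algebraic identity: \<open>D\<close> and \<open>Y\<close> are arbitrary, so
  that it serves for test function and solution here and, with n = k, for two Taylor kernels in the
  treatment of polynomial primitives.\<close>

lemma rcoef_sum_eq_leib:
  assumes "k \<in> {1..n}"
  shows "(\<Sum>\<nu>\<le>k. rcoef P Q k \<nu> x * (D (n - \<nu>) x * Y (n - k + \<nu>) x)) =
    P k x * leib (shiftF (n - k) D) (shiftF (n - k) Y) k x +
    \<i> * (Q (k - 1) x * leib (shiftF (n - k + 1) D) (shiftF (n - k) Y) (k - 1) x
      - Q (k - 1) x * leib (shiftF (n - k) D) (shiftF (n - k + 1) Y) (k - 1) x)"
proof -
  obtain l where k: "k = Suc l" using assms by (cases k) auto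
  define a where "a = n - k"
  have n: "n = a + Suc l" using assms by (simp add: a_def k)
  let ?d = "\<lambda>\<nu>. D (n - \<nu>) x * Y (a + \<nu>) x"
  have 1: "leib (shiftF a D) (shiftF a Y) k x = (\<Sum>\<nu>\<le>k. of_nat (k choose \<nu>) * ?d \<nu>)"
    by (subst leib_shiftF_rev[of _ _ n]) (auto simp: n k add.commute mult.assoc)
  have 2: "leib (shiftF (a + 1) D) (shiftF a Y) l x = (\<Sum>\<nu>\<le>k. of_nat (l choose \<nu>) * ?d \<nu>)"
    by (subst leib_shiftF_rev[of _ _ n]) (auto simp: n k add.commute mult.assoc)
  \<comment> \<open>In this expansion the top order of \<open>D\<close> is n - 1, so its index is
    one behind; this is where \<nu> - 1 in the binomial coefficient originates.\<close>
  have 3: "leib (shiftF a D) (shiftF (a + 1) Y) l x = (\<Sum>\<nu>\<le>k. (if \<nu> = 0 then 0 else of_nat (l choose (\<nu> - 1))) * ?d \<nu>)"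
    unfolding k sum.atMost_Suc_shift
    by (subst leib_shiftF_rev[of _ _ "n - 1"]) (auto simp: n k add.commute mult.assoc)
  have "(\<Sum>\<nu>\<le>k. rcoef P Q k \<nu> x * ?d \<nu>) = P k x * (\<Sum>\<nu>\<le>k. of_nat (k choose \<nu>) * ?d \<nu>) +
    \<i> * (Q l x * (\<Sum>\<nu>\<le>k. of_nat (l choose \<nu>) * ?d \<nu>) - Q l x * (\<Sum>\<nu>\<le>k. (if \<nu> = 0 then 0 else of_nat (l choose (\<nu> - 1))) * ?d \<nu>))"
    unfolding sum_distrib_left sum_subtractf[symmetric] sum.distrib[symmetric] rcoef_def
    by (intro sum.cong refl) (simp add: k algebra_simps)
  then show ?thesis
    unfolding 1[symmetric] 2[symmetric] 3[symmetric] by (simp add: a_def k)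
qed

section \<open>Reduction of the expression to the normal form\<close>

lemma
  fixes f :: "'i \<Rightarrow> 'a \<Rightarrow> 'b::{banach, second_countable_topology}"
  assumes "\<And>i. i \<in> I \<Longrightarrow> set_integrable M A (f i)"
  shows set_integrable_sum: "set_integrable M A (\<lambda>x. \<Sum>i\<in>I. f i x)"
    and set_integral_sum: "(LINT x:A|M. \<Sum>i\<in>I. f i x) = (\<Sum>i\<in>I. LINT x:A|M. f i x)"
  using assms unfolding set_integrable_def set_lebesgue_integral_def scaleR_sum_right
  by (auto intro: Bochner_Integration.integral_sum)

lemma L2w_cong:
  assumes "\<And>x. 0 \<le> x \<Longrightarrow> x \<le> 1 \<Longrightarrow> F x = G x"
  shows "L2w w F \<longleftrightarrow> L2w w G"
  unfolding L2w_iff using assms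
  by (intro conj_cong measurable_cong Bochner_Integration.integrable_cong refl) auto

lemma power_diff_measurable [measurable]:
  "(\<lambda>(x,t). complex_of_real ((x - t) ^ j / fact j)) \<in> borel_measurable (borel \<Otimes>\<^sub>M borel)"
  unfolding case_prod_unfold by measurable

lemma norm_power_diff_le_1:
  assumes "x \<in> {0..c}" "t \<in> {0..c}" "c \<le> 1"
  shows "norm (complex_of_real ((x - t) ^ j / fact j)) \<le> 1"
proof -
  have "\<bar>x - t\<bar> ^ j / fact j \<le> 1"
    using assms by (intro power_div_fact_le_1) auto
  then show ?thesis
    unfolding norm_of_real by (simp add: power_abs)
qed

definition upiece :: "(nat \<Rightarrow> real \<Rightarrow> complex) \<Rightarrow> (nat \<Rightarrow> real \<Rightarrow> complex) \<Rightarrow> nat \<Rightarrow> nat \<Rightarrow> nat \<Rightarrow> real \<Rightarrow> complex" where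
  "upiece P Q k \<nu> j x =
     (if \<nu> = 0 then of_real (x ^ j / fact j) * rcoef P Q k 0 x
      else (-1) ^ \<nu> * (LINT \<tau>:{0..x}|lebesgue. of_real ((x - \<tau>) ^ (\<nu> - 1) / fact (\<nu> - 1)) *
         (of_real (\<tau> ^ j / fact j) * rcoef P Q k \<nu> \<tau>)))"

section \<open>Rewriting a single Leibniz product as an integral against the n-th derivative of the
  test function\<close>

context weight begin

context
  fixes n k \<nu> :: nat and P Q Y :: "nat \<Rightarrow> real \<Rightarrow> complex"
  assumes k: "k \<in> {1..n}" and \<nu>: "\<nu> \<le> k"
    and P: "L2w (invw b) (P k)" and Q: "L2w (invw b) (Q (k - 1))"
begin

private abbreviation (input) "r \<equiv> rcoef P Q k \<nu>"

private lemma r: "L2w (invw b) r"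
  using P Q by (rule L2w_rcoef)

private lemma r_integrable: "set_integrable lebesgue {0..1} r"
  by (rule L2w_integrable(2)[OF r])

lemma L2w_upiece: "L2w (invw b) (upiece P Q k \<nu> j)"
proof (cases "\<nu> = 0")
  case True
  then show ?thesis
    using L2w_mult_continuous[OF r, of "\<lambda>x. complex_of_real (x ^ j / fact j)"]
    by (simp add: upiece_def[abs_def] continuous_intros)
next
  case False
  have "set_integrable lebesgue {0..1} (\<lambda>\<tau>. complex_of_real (\<tau> ^ j / fact j) * r \<tau>)"
    by (rule set_integrable_mult_continuous[OF _ r_integrable]) (auto intro!: continuous_intros)
  from L2w_continuous(2)[OF continuous_on_iterated_integral[OF this]] False
  show ?thesis
    by (simp add: upiece_def[abs_def] L2w_cmult del: of_real_divide of_real_power)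
qed

lemma kpiece_mult_integrable:
  assumes Y: "L2w b y" and x: "0 \<le> x" "x \<le> 1"
  shows "set_integrable lebesgue {0..x} (\<lambda>t. kpiece P Q k \<nu> x t * y t)"
proof -
  have sub: "set_integrable lebesgue {0..x} f" if "set_integrable lebesgue {0..1} f" for f :: "real \<Rightarrow> complex"
    using x by (intro set_integrable_subset[OF that]) auto
  have cont: "continuous_on {0..x} (\<lambda>t. complex_of_real ((x - t) ^ i / fact i))" for i
    by (intro continuous_intros) auto
  have y: "set_integrable lebesgue {0..x} y"
    by (rule sub[OF L2w_integrable(1)[OF Y]])
  show ?thesis
  proof -
    consider "\<nu> = 0" | "\<nu> = k" "\<nu> \<noteq> 0" | "\<nu> \<noteq> 0" "\<nu> \<noteq> k" by blast
    then show ?thesis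
    proof cases
      case 1
      have "set_integrable lebesgue {0..x} (\<lambda>t. r x * (complex_of_real ((x - t) ^ (k - 1) / fact (k - 1)) * y t))"
        by (intro set_integrable_mult_right set_integrable_mult_continuous cont y)
      then show ?thesis
        using 1 by (simp add: kpiece_def mult_ac)
    next
      case 2
      have "set_integrable lebesgue {0..x} (\<lambda>t. (-1) ^ k * (complex_of_real ((x - t) ^ (k - 1) / fact (k - 1)) * (r t * y t)))"
        by (intro set_integrable_mult_right set_integrable_mult_continuous cont sub L2w_mult_integrable r Y)
      then show ?thesis
        using 2 by (simp add: kpiece_def mult_ac)
    next
      case 3
      have "set_integrable lebesgue {0..x} (\<lambda>t. y t * (LINT \<tau>:{t..x}|lebesgue. (of_real ((x - \<tau>) ^ (\<nu> - 1) / fact (\<nu> - 1)) * r \<tau>) *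
         of_real ((\<tau> - t) ^ (k - 1 - \<nu>) / fact (k - 1 - \<nu>))))"
        using x
        by (intro set_integrable_triangle_snd[where M = 1] y set_integrable_mult_continuous cont sub r_integrable
            power_diff_measurable norm_power_diff_le_1) auto
      then have "set_integrable lebesgue {0..x} (\<lambda>t. (-1) ^ \<nu> * (y t * mid_kernel (\<nu> - 1) (k - 1 - \<nu>) r x t))"
        unfolding mid_kernel_def by (rule set_integrable_mult_right)
      then show ?thesis
        using 3 by (simp add: kpiece_def mult_ac)
    qed
  qed
qed

context
  assumes Y: "Wb b n Y"
begin

text \<open>The share of the pair (k, \<nu>) in the final density By^(n) + Cy. It will be given a
  second form without kernel, either the product of the coefficient and y^(n-k) or an iterated
  primitive, from which its membership in L_{2,1/b} and its pairing with \<open>D n\<close> are read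
  off.\<close>

private definition "G x = (LINT t:{0..x}|lebesgue. kpiece P Q k \<nu> x t * Y n t)
    + (\<Sum>j<k - \<nu>. Y (n - k + \<nu> + j) 0 * upiece P Q k \<nu> j x)"

private lemma Yn: "L2w b (Y n)"
  using Y by (simp add: Wb_def)

private lemma Y_ac: "ac_family (k - \<nu>) (shiftF (n - k + \<nu>) Y)"
  using Y k \<nu> by (intro ac_family_shiftF) (auto simp: Wb_def intro: ac_family_mono)

private lemma Y_taylor:
  assumes "\<nu> < k" "0 \<le> x" "x \<le> 1"
  shows "Y (n - k + \<nu>) x = (\<Sum>j<k - \<nu>. Y (n - k + \<nu> + j) 0 * of_real (x ^ j / fact j))
    + (LINT t:{0..x}|lebesgue. of_real ((x - t) ^ (k - 1 - \<nu>) / fact (k - 1 - \<nu>)) * Y n t)"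
  using ac_family_taylor_left[OF Y_ac _ assms(2,3)] assms(1) k
  by (simp add: shiftF_def add_ac del: of_real_divide of_real_power)

private lemma G_0:
  assumes "\<nu> = 0" "0 \<le> x" "x \<le> 1"
  shows "G x = Y (n - k) x * r x"
proof -
  have "(LINT t:{0..x}|lebesgue. kpiece P Q k \<nu> x t * Y n t) =
    (LINT t:{0..x}|lebesgue. r x * (of_real ((x - t) ^ (k - 1) / fact (k - 1)) * Y n t))"
    using assms by (intro set_lebesgue_integral_cong) (auto simp: kpiece_def mult_ac)
  then have "G x = r x * (\<Sum>j<k - \<nu>. Y (n - k + \<nu> + j) 0 * of_real (x ^ j / fact j)) +
     r x * (LINT t:{0..x}|lebesgue. of_real ((x - t) ^ (k - 1) / fact (k - 1)) * Y n t)"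
    unfolding G_def set_integral_mult_right sum_distrib_left
    using assms by (simp add: upiece_def mult_ac del: of_real_divide of_real_power)
  also have "\<dots> = r x * Y (n - k) x"
    using Y_taylor[of x] assms k by (simp add: algebra_simps del: of_real_divide of_real_power)
  finally show ?thesis by (simp add: mult.commute)
qed

private lemma g_integrable:
  assumes "\<nu> \<noteq> 0"
  shows "set_integrable lebesgue {0..1} (\<lambda>\<tau>. Y (n - k + \<nu>) \<tau> * r \<tau>)"
proof (cases "\<nu> = k")
  case True
  then show ?thesis
    using L2w_mult_integrable[OF r Yn] k by (simp add: mult.commute)
next
  case False
  then show ?thesis
    using Y k \<nu> by (intro set_integrable_mult_continuous r_integrable ac_family_continuous[of n]) (auto simp: Wb_def)
qed

private lemma G_pos:
  assumes \<nu>0: "\<nu> \<noteq> 0" and x: "0 \<le> x" "x \<le> 1"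
  shows "G x = (-1) ^ \<nu> * (LINT \<tau>:{0..x}|lebesgue. of_real ((x - \<tau>) ^ (\<nu> - 1) / fact (\<nu> - 1)) * (Y (n - k + \<nu>) \<tau> * r \<tau>))"
proof (cases "\<nu> = k")
  case True
  have "(LINT t:{0..x}|lebesgue. kpiece P Q k \<nu> x t * Y n t) =
    (LINT t:{0..x}|lebesgue. (-1) ^ k * (of_real ((x - t) ^ (\<nu> - 1) / fact (\<nu> - 1)) * (Y (n - k + \<nu>) t * r t)))"
    using True \<nu>0 k by (intro set_lebesgue_integral_cong) (auto simp: kpiece_def mult_ac)
  then show ?thesis
    using True unfolding G_def set_integral_mult_right by simp
next
  case False
  then have \<nu>k: "\<nu> < k" using \<nu> by simp
  let ?\<phi> = "\<lambda>\<tau>. complex_of_real ((x - \<tau>) ^ (\<nu> - 1) / fact (\<nu> - 1))"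
  let ?T = "\<lambda>\<tau>. LINT t:{0..\<tau>}|lebesgue. of_real ((\<tau> - t) ^ (k - 1 - \<nu>) / fact (k - 1 - \<nu>)) * Y n t"
  let ?c = "\<lambda>j. Y (n - k + \<nu> + j) 0"
  have sub: "set_integrable lebesgue {0..x} f" if "set_integrable lebesgue {0..1} f" for f :: "real \<Rightarrow> complex"
    using x by (intro set_integrable_subset[OF that]) auto
  have cont: "continuous_on {0..x} ?\<phi>"
    by (intro continuous_intros) auto
  have \<phi>r: "set_integrable lebesgue {0..x} (\<lambda>\<tau>. ?\<phi> \<tau> * r \<tau>)"
    by (intro set_integrable_mult_continuous cont sub r_integrable)
  have yn: "set_integrable lebesgue {0..x} (Y n)"
    by (rule sub[OF L2w_integrable(1)[OF Yn]])
  have swap: "(LINT \<tau>:{0..x}|lebesgue. (?\<phi> \<tau> * r \<tau>) * ?T \<tau>) = (LINT t:{0..x}|lebesgue. Y n t * mid_kernel (\<nu> - 1) (k - 1 - \<nu>) r x t)"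
    unfolding mid_kernel_def using x
    by (intro set_integral_triangle_swap[where M = 1] \<phi>r yn power_diff_measurable norm_power_diff_le_1) auto
  have int: "set_integrable lebesgue {0..x} (\<lambda>\<tau>. (?\<phi> \<tau> * r \<tau>) * ?T \<tau>)"
    using x by (intro set_integrable_triangle_fst[where M = 1] \<phi>r yn power_diff_measurable norm_power_diff_le_1) auto
  have int_c: "set_integrable lebesgue {0..x} (\<lambda>\<tau>. ?c j * (?\<phi> \<tau> * (of_real (\<tau> ^ j / fact j) * r \<tau>)))" for j
    by (intro set_integrable_mult_right set_integrable_mult_continuous cont sub r_integrable) (auto intro!: continuous_intros)
  have "(LINT \<tau>:{0..x}|lebesgue. ?\<phi> \<tau> * (Y (n - k + \<nu>) \<tau> * r \<tau>)) =
    (LINT \<tau>:{0..x}|lebesgue. (\<Sum>j<k - \<nu>. ?c j * (?\<phi> \<tau> * (of_real (\<tau> ^ j / fact j) * r \<tau>))) + (?\<phi> \<tau> * r \<tau>) * ?T \<tau>)"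
  proof (rule set_lebesgue_integral_cong)
    show "\<forall>\<tau>. \<tau> \<in> {0..x} \<longrightarrow> ?\<phi> \<tau> * (Y (n - k + \<nu>) \<tau> * r \<tau>) =
       (\<Sum>j<k - \<nu>. ?c j * (?\<phi> \<tau> * (of_real (\<tau> ^ j / fact j) * r \<tau>))) + (?\<phi> \<tau> * r \<tau>) * ?T \<tau>"
    proof (intro allI impI)
      fix \<tau> assume "\<tau> \<in> {0..x}"
      then have \<tau>: "0 \<le> \<tau>" "\<tau> \<le> 1" using x by auto
      have "?\<phi> \<tau> * (Y (n - k + \<nu>) \<tau> * r \<tau>) = (?\<phi> \<tau> * r \<tau>) * (\<Sum>j<k - \<nu>. ?c j * of_real (\<tau> ^ j / fact j)) + (?\<phi> \<tau> * r \<tau>) * ?T \<tau>"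
        unfolding Y_taylor[OF \<nu>k \<tau>] by (simp only: algebra_simps)
      then show "?\<phi> \<tau> * (Y (n - k + \<nu>) \<tau> * r \<tau>) =
       (\<Sum>j<k - \<nu>. ?c j * (?\<phi> \<tau> * (of_real (\<tau> ^ j / fact j) * r \<tau>))) + (?\<phi> \<tau> * r \<tau>) * ?T \<tau>"
        by (simp only: sum_distrib_left mult_ac)
    qed
  qed simp
  also have "\<dots> = (LINT \<tau>:{0..x}|lebesgue. \<Sum>j<k - \<nu>. ?c j * (?\<phi> \<tau> * (of_real (\<tau> ^ j / fact j) * r \<tau>))) + (LINT \<tau>:{0..x}|lebesgue. (?\<phi> \<tau> * r \<tau>) * ?T \<tau>)"
    by (intro set_integral_add(2) int set_integrable_sum int_c)
  also have "(LINT \<tau>:{0..x}|lebesgue. \<Sum>j<k - \<nu>. ?c j * (?\<phi> \<tau> * (of_real (\<tau> ^ j / fact j) * r \<tau>))) =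
     (\<Sum>j<k - \<nu>. ?c j * (LINT \<tau>:{0..x}|lebesgue. ?\<phi> \<tau> * (of_real (\<tau> ^ j / fact j) * r \<tau>)))"
    by (simp only: set_integral_sum[OF int_c] set_integral_mult_right)
  finally have "(-1) ^ \<nu> * (LINT \<tau>:{0..x}|lebesgue. ?\<phi> \<tau> * (Y (n - k + \<nu>) \<tau> * r \<tau>)) =
     (\<Sum>j<k - \<nu>. ?c j * ((-1) ^ \<nu> * (LINT \<tau>:{0..x}|lebesgue. ?\<phi> \<tau> * (of_real (\<tau> ^ j / fact j) * r \<tau>))))
     + (LINT t:{0..x}|lebesgue. (-1) ^ \<nu> * (Y n t * mid_kernel (\<nu> - 1) (k - 1 - \<nu>) r x t))"
    unfolding swap set_integral_mult_right by (simp only: distrib_left sum_distrib_left mult_ac)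
  also have "\<dots> = G x"
    unfolding G_def using False \<nu>0 by (simp add: upiece_def kpiece_def mult_ac del: of_real_divide of_real_power set_integral_mult_right)
  finally show ?thesis by simp
qed

lemma L2w_piece: "L2w (invw b) (\<lambda>x. (LINT t:{0..x}|lebesgue. kpiece P Q k \<nu> x t * Y n t)
    + (\<Sum>j<k - \<nu>. Y (n - k + \<nu> + j) 0 * upiece P Q k \<nu> j x))"
proof -
  have "L2w (invw b) G"
  proof (cases "\<nu> = 0")
    case True
    have "continuous_on {0..1} (Y (n - k))"
      using Y k by (auto simp: Wb_def intro!: ac_family_continuous[of n])
    from L2w_mult_continuous[OF r this invw_measurable] show ?thesis
      by (subst L2w_cong[of G]) (use G_0[OF True] in auto)
  next
    case False
    from L2w_cmult[OF L2w_continuous(2)[OF continuous_on_iterated_integral[OF g_integrable[OF False]]]]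
    show ?thesis
      by (subst L2w_cong[of G]) (rule G_pos[OF False])
  qed
  then show ?thesis by (simp add: G_def[abs_def])
qed

text \<open>The expansion of y is already hidden in \<open>G\<close>, so only the test function is
  expanded, at 1, and only if \<nu> > 0; exchanging the order of integration then moves the Taylor
  kernel onto y.\<close>

lemma integral_piece:
  assumes D: "W0b b n D"
  shows "(LINT x:{0..1}|lebesgue. r x * (D (n - \<nu>) x * Y (n - k + \<nu>) x)) =
    (LINT x:{0..1}|lebesgue. ((LINT t:{0..x}|lebesgue. kpiece P Q k \<nu> x t * Y n t)
      + (\<Sum>j<k - \<nu>. Y (n - k + \<nu> + j) 0 * upiece P Q k \<nu> j x)) * D n x)"
proof (cases "\<nu> = 0")
  case True
  then show ?thesis
    unfolding G_def[symmetric]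
    by (intro set_lebesgue_integral_cong) (use G_0[OF True] True in \<open>auto simp: mult_ac\<close>)
next
  case False
  let ?\<phi> = "\<lambda>x \<tau>. complex_of_real ((x - \<tau>) ^ (\<nu> - 1) / fact (\<nu> - 1))"
  let ?g = "\<lambda>\<tau>. Y (n - k + \<nu>) \<tau> * r \<tau>"
  have Dn: "set_integrable lebesgue {0..1} (D n)"
    using D by (auto simp: W0b_def Wb_def intro: L2w_integrable)
  have D_ac: "ac_family \<nu> (shiftF (n - \<nu>) D)"
    using D k \<nu> by (intro ac_family_shiftF) (auto simp: W0b_def Wb_def)
  have D_taylor: "D (n - \<nu>) \<tau> = (-1) ^ \<nu> * (LINT x:{\<tau>..1}|lebesgue. ?\<phi> x \<tau> * D n x)" if "0 \<le> \<tau>" "\<tau> \<le> 1" for \<tau>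
    using ac_family_taylor_right[OF D_ac _ _ that] False D k \<nu>
    by (simp add: shiftF_def W0b_def del: of_real_divide of_real_power)
  have "(LINT x:{0..1}|lebesgue. r x * (D (n - \<nu>) x * Y (n - k + \<nu>) x)) =
     (LINT t:{0..1}|lebesgue. (-1) ^ \<nu> * (?g t * (LINT x:{t..1}|lebesgue. D n x * ?\<phi> x t)))"
    by (intro set_lebesgue_integral_cong) (auto simp: D_taylor mult_ac)
  also have "\<dots> = (-1) ^ \<nu> * (LINT x:{0..1}|lebesgue. D n x * (LINT t:{0..x}|lebesgue. ?\<phi> x t * ?g t))"
    unfolding set_integral_mult_right
    by (intro arg_cong2[where f = "(*)"] refl set_integral_triangle_swap[symmetric, where M = 1] Dn g_integrable False
        power_diff_measurable norm_power_diff_le_1) auto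
  also have "\<dots> = (LINT x:{0..1}|lebesgue. (-1) ^ \<nu> * (D n x * (LINT t:{0..x}|lebesgue. ?\<phi> x t * ?g t)))"
    by (rule set_integral_mult_right[symmetric])
  also have "\<dots> = (LINT x:{0..1}|lebesgue. G x * D n x)"
    by (intro set_lebesgue_integral_cong) (auto simp: G_pos[OF False])
  finally show ?thesis
    by (simp only: G_def)
qed

end
end

text \<open>The terms of p_k and q_(k-1) are taken together because their Leibniz expansions consist
  of the same products, with derivative orders adding up to 2n - k.\<close>

lemma ell_term_eq:
  assumes k: "k \<in> {1..n}" and pq: "primitives b n p q P Q" and Y: "Wb b n Y" and D: "W0b b n D"
  shows "fdern (n - k) (fmul (p k) (shiftF (n - k) Y)) D +
      \<i> * (fdern (n - (k - 1)) (fmul (q (k - 1)) (shiftF (n - (k - 1) - 1) Y)) D +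
           fdern (n - (k - 1) - 1) (fmul (q (k - 1)) (shiftF (n - (k - 1)) Y)) D) =
    (-1) ^ n * (\<Sum>\<nu>\<le>k. LINT x:{0..1}|lebesgue. rcoef P Q k \<nu> x * (D (n - \<nu>) x * Y (n - k + \<nu>) x))"
proof -
  define a where "a = n - k"
  have a: "n - (k - 1) = a + 1" "n - (k - 1) - 1 = a" "n - k = a" "n - k + 1 = a + 1" "n = a + k"
    using k by (auto simp: a_def)
  have DW: "Wb b n D" using D by (simp add: W0b_def)
  have P: "L2w (invw b) (P k)" "is_gder b k (P k) (p k)" and Q: "L2w (invw b) (Q (k - 1))" "is_gder b (k - 1) (Q (k - 1)) (q (k - 1))"
    using pq k unfolding primitives_def by auto
  define L1 where "L1 = leib (shiftF a D) (shiftF a Y)"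
  define L2 where "L2 = leib (shiftF (a + 1) D) (shiftF a Y)"
  define L3 where "L3 = leib (shiftF a D) (shiftF (a + 1) Y)"
  have W: "W0b b k L1" "W0b b (k - 1) L2" "W0b b (k - 1) L3"
    unfolding L1_def L2_def L3_def using k a(5) by (intro W0b_leib[OF D Y]; simp)+
  have 1: "fdern a (fmul (p k) (shiftF a Y)) D = (-1) ^ n * (LINT x:{0..1}|lebesgue. P k x * L1 k x)"
    using P(2) W(1) by (simp add: fdern_eq fmul_def is_gder_def gder_def a(5) power_add L1_def)
  have 2: "fdern (a + 1) (fmul (q (k - 1)) (shiftF a Y)) D = (-1) ^ n * (LINT x:{0..1}|lebesgue. Q (k - 1) x * L2 (k - 1) x)"
  proof -
    have "(-1) ^ (a + 1) * (-1) ^ (k - 1) = ((-1) ^ n :: complex)"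
      using k by (cases k) (auto simp: a(5) power_add)
    then show ?thesis
      using Q(2) W(2) by (simp add: fdern_eq fmul_def is_gder_def gder_def L2_def flip: mult.assoc)
  qed
  \<comment> \<open>The outer order and the order of the primitive add up to n - 1 here and to n in
    the other two terms; hence the difference of binomial coefficients in front of Q.\<close>
  have 3: "fdern a (fmul (q (k - 1)) (shiftF (a + 1) Y)) D = - ((-1) ^ n) * (LINT x:{0..1}|lebesgue. Q (k - 1) x * L3 (k - 1) x)"
  proof -
    have "(-1) ^ a * (-1) ^ (k - 1) = - ((-1) ^ n :: complex)"
      using k by (cases k) (auto simp: a(5) power_add)
    then show ?thesis
      using Q(2) W(3) by (simp add: fdern_eq fmul_def is_gder_def gder_def L3_def flip: mult.assoc)
  qed
  have I1: "set_integrable lebesgue {0..1} (\<lambda>x. P k x * L1 k x)"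
    and I2: "set_integrable lebesgue {0..1} (\<lambda>x. Q (k - 1) x * L2 (k - 1) x)"
    and I3: "set_integrable lebesgue {0..1} (\<lambda>x. Q (k - 1) x * L3 (k - 1) x)"
    using W P Q by (auto simp: W0b_def Wb_def intro: L2w_mult_integrable)
  have "L2w b (\<lambda>x. D (n - \<nu>) x * Y (n - k + \<nu>) x)" if "\<nu> \<le> k" for \<nu>
    using that k by (intro L2w_mult_ac_families[OF DW Y]) auto
  then have Ir: "set_integrable lebesgue {0..1} (\<lambda>x. rcoef P Q k \<nu> x * (D (n - \<nu>) x * Y (n - k + \<nu>) x))" if "\<nu> \<in> {..k}" for \<nu>
    using that by (intro L2w_mult_integrable L2w_rcoef P Q) auto
  have "(\<Sum>\<nu>\<le>k. LINT x:{0..1}|lebesgue. rcoef P Q k \<nu> x * (D (n - \<nu>) x * Y (n - k + \<nu>) x)) =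
     (LINT x:{0..1}|lebesgue. \<Sum>\<nu>\<le>k. rcoef P Q k \<nu> x * (D (n - \<nu>) x * Y (n - k + \<nu>) x))"
    using Ir by (rule set_integral_sum[symmetric])
  also have "\<dots> = (LINT x:{0..1}|lebesgue. P k x * L1 k x + \<i> * (Q (k - 1) x * L2 (k - 1) x - Q (k - 1) x * L3 (k - 1) x))"
    unfolding rcoef_sum_eq_leib[OF k] by (simp only: a(3,4) L1_def L2_def L3_def)
  also have "\<dots> = (LINT x:{0..1}|lebesgue. P k x * L1 k x) + (LINT x:{0..1}|lebesgue. \<i> * (Q (k - 1) x * L2 (k - 1) x - Q (k - 1) x * L3 (k - 1) x))"
    by (intro set_integral_add(2) set_integrable_mult_right set_integral_diff(1) I1 I2 I3)
  also have "(LINT x:{0..1}|lebesgue. \<i> * (Q (k - 1) x * L2 (k - 1) x - Q (k - 1) x * L3 (k - 1) x)) =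
    \<i> * ((LINT x:{0..1}|lebesgue. Q (k - 1) x * L2 (k - 1) x) - (LINT x:{0..1}|lebesgue. Q (k - 1) x * L3 (k - 1) x))"
    unfolding set_integral_mult_right by (simp only: set_integral_diff(2)[OF I2 I3])
  finally have "(\<Sum>\<nu>\<le>k. LINT x:{0..1}|lebesgue. rcoef P Q k \<nu> x * (D (n - \<nu>) x * Y (n - k + \<nu>) x)) =
    (LINT x:{0..1}|lebesgue. P k x * L1 k x) +
    \<i> * ((LINT x:{0..1}|lebesgue. Q (k - 1) x * L2 (k - 1) x) - (LINT x:{0..1}|lebesgue. Q (k - 1) x * L3 (k - 1) x))" .
  moreover have "e * u + \<i> * (e * v + - e * w) = e * z" if "z = u + \<i> * (v - w)" for e u v w z
    unfolding that by (simp add: algebra_simps)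
  ultimately show ?thesis
    unfolding a(2) unfolding a(1) unfolding a(3) 1 2 3 by blast
qed

lemma ell_eq:
  assumes pq: "primitives b n p q P Q" and Y: "Wb b n Y" and D: "W0b b n D"
  shows "ell n p0 p q Y D = (-1) ^ n * ((LINT x:{0..1}|lebesgue. p0 x * (D n x * Y n x)) +
    (\<Sum>k=1..n. \<Sum>\<nu>\<le>k. LINT x:{0..1}|lebesgue. rcoef P Q k \<nu> x * (D (n - \<nu>) x * Y (n - k + \<nu>) x)))"
proof -
  let ?p = "\<lambda>k. fdern (n - k) (fmul (pfn p0 p k) (shiftF (n - k) Y)) D"
  let ?q = "\<lambda>k. fdern (n - k) (fmul (q k) (shiftF (n - k - 1) Y)) D + fdern (n - k - 1) (fmul (q k) (shiftF (n - k) Y)) D"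
  have "{..n} = insert 0 {1..n}" by auto
  then have "ell n p0 p q Y D = ?p 0 + ((\<Sum>k=1..n. ?p k) + \<i> * (\<Sum>k<n. ?q k))"
    unfolding ell_def by (simp add: add.assoc)
  also have "(\<Sum>k<n. ?q k) = (\<Sum>k=1..n. ?q (k - 1))"
    by (simp add: sum.atLeast1_atMost_eq)
  also have "(\<Sum>k=1..n. ?p k) + \<i> * (\<Sum>k=1..n. ?q (k - 1)) = (\<Sum>k=1..n. ?p k + \<i> * ?q (k - 1))"
    by (simp only: sum_distrib_left sum.distrib distrib_left)
  also have "\<dots> = (\<Sum>k=1..n. (-1) ^ n * (\<Sum>\<nu>\<le>k. LINT x:{0..1}|lebesgue. rcoef P Q k \<nu> x * (D (n - \<nu>) x * Y (n - k + \<nu>) x)))"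
  proof (rule sum.cong[OF refl])
    fix k assume k: "k \<in> {1..n}"
    then have "pfn p0 p k = p k" by (simp add: pfn_def)
    then show "?p k + \<i> * ?q (k - 1) = (-1) ^ n * (\<Sum>\<nu>\<le>k. LINT x:{0..1}|lebesgue. rcoef P Q k \<nu> x * (D (n - \<nu>) x * Y (n - k + \<nu>) x))"
      using ell_term_eq[OF k pq Y D] by simp
  qed
  also have "?p 0 = (-1) ^ n * (LINT x:{0..1}|lebesgue. p0 x * (D n x * Y n x))"
    by (simp add: fdern_eq fmul_def pfn_def gder_def leib_def shiftF_def)
  finally show ?thesis
    by (simp only: distrib_left sum_distrib_left)
qed

lemma ell_representation:
  assumes pq: "primitives b n p q P Q" and p0: "\<And>x. x \<in> {0..1} \<Longrightarrow> (b x)\<^sup>2 = p0 x"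
  shows "\<exists>u. (\<forall>\<mu><n. L2w (invw b) (u \<mu>)) \<and>
    (\<forall>Y. Wb b n Y \<longrightarrow> (\<forall>D. W0b b n D \<longrightarrow>
       ell n p0 p q Y D = (-1) ^ n * set_lebesgue_integral lebesgue {0..1}
         (\<lambda>x. (Bop b (Kker n P Q) (Y n) x + (\<Sum>\<mu><n. Y \<mu> 0 * u \<mu> x)) * D n x)))"
proof (intro exI conjI allI impI)
  \<comment> \<open>All Taylor coefficients that are the same initial value y^(\<mu>)(0) are
    collected. Neither y nor the test function occurs, so one choice serves all of them.\<close>
  define u where "u \<mu> x = (\<Sum>k=1..n. \<Sum>\<nu>\<le>k. \<Sum>j<k - \<nu>. (if n - k + \<nu> + j = \<mu> then 1 else 0) * upiece P Q k \<nu> j x)" for \<mu> x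
  have P: "\<And>k. k \<in> {1..n} \<Longrightarrow> L2w (invw b) (P k)" and Q: "\<And>k. k \<in> {1..n} \<Longrightarrow> L2w (invw b) (Q (k - 1))"
    using pq unfolding primitives_def by blast+
  show "L2w (invw b) (u \<mu>)" for \<mu>
    unfolding u_def[abs_def] using P Q
    by (intro L2w_sum L2w_cmult L2w_upiece[where n = n]) auto
  fix Y D assume Y: "Wb b n Y" and D: "W0b b n D"
  have Yn: "L2w b (Y n)" and Dn: "L2w b (D n)"
    using Y D by (auto simp: W0b_def Wb_def)
  define W where "W k \<nu> x = (LINT t:{0..x}|lebesgue. kpiece P Q k \<nu> x t * Y n t)" for k \<nu> x
  define U where "U k \<nu> x = (\<Sum>j<k - \<nu>. Y (n - k + \<nu> + j) 0 * upiece P Q k \<nu> j x)" for k \<nu> x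
  have int: "set_integrable lebesgue {0..1} (\<lambda>x. (W k \<nu> x + U k \<nu> x) * D n x)" if "k \<in> {1..n}" "\<nu> \<in> {..k}" for k \<nu>
    unfolding W_def U_def using that by (intro L2w_mult_integrable[OF _ Dn] L2w_piece P Q Y) auto
  have int0: "set_integrable lebesgue {0..1} (\<lambda>x. ((b x)\<^sup>2 * Y n x) * D n x)"
    by (rule L2w_mult_integrable[OF L2w_b_square[OF Yn] Dn])
  have u: "(\<Sum>\<mu><n. Y \<mu> 0 * u \<mu> x) = (\<Sum>k=1..n. \<Sum>\<nu>\<le>k. U k \<nu> x)" for x
  proof -
    have "(\<Sum>\<mu><n. Y \<mu> 0 * u \<mu> x) = (\<Sum>\<mu><n. \<Sum>k=1..n. \<Sum>\<nu>\<le>k. \<Sum>j<k - \<nu>. Y \<mu> 0 * ((if n - k + \<nu> + j = \<mu> then 1 else 0) * upiece P Q k \<nu> j x))"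
      unfolding u_def sum_distrib_left ..
    also have "\<dots> = (\<Sum>k=1..n. \<Sum>\<nu>\<le>k. \<Sum>j<k - \<nu>. \<Sum>\<mu><n. Y \<mu> 0 * ((if n - k + \<nu> + j = \<mu> then 1 else 0) * upiece P Q k \<nu> j x))"
      by (subst sum.swap, rule sum.cong[OF refl], subst sum.swap, rule sum.cong[OF refl], rule sum.swap)
    also have "\<dots> = (\<Sum>k=1..n. \<Sum>\<nu>\<le>k. U k \<nu> x)"
      unfolding U_def
    proof (intro sum.cong refl)
      fix k \<nu> j assume "k \<in> {1..n}" "\<nu> \<in> {..k}" "j \<in> {..<k - \<nu>}"
      \<comment> \<open>Every triple is counted for exactly one \<mu> below n, as j < k -
        \<nu>.\<close>
      then have "n - k + \<nu> + j < n" by auto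
      moreover have "(\<Sum>\<mu><n. Y \<mu> 0 * ((if n - k + \<nu> + j = \<mu> then 1 else 0) * upiece P Q k \<nu> j x)) =
        (\<Sum>\<mu><n. if n - k + \<nu> + j = \<mu> then Y \<mu> 0 * upiece P Q k \<nu> j x else 0)"
        by (intro sum.cong) auto
      ultimately show "(\<Sum>\<mu><n. Y \<mu> 0 * ((if n - k + \<nu> + j = \<mu> then 1 else 0) * upiece P Q k \<nu> j x)) =
        Y (n - k + \<nu> + j) 0 * upiece P Q k \<nu> j x"
        by simp
    qed
    finally show ?thesis .
  qed
  have K: "(LINT t:{0..x}|lebesgue. Kker n P Q x t * Y n t) = (\<Sum>k=1..n. \<Sum>\<nu>\<le>k. W k \<nu> x)" if x: "0 \<le> x" "x \<le> 1" for x
  proof -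
    have i: "set_integrable lebesgue {0..x} (\<lambda>t. kpiece P Q k \<nu> x t * Y n t)" if "k \<in> {1..n}" "\<nu> \<in> {..k}" for k \<nu>
      using that by (intro kpiece_mult_integrable[where n = n] P Q Yn x) auto
    have "(LINT t:{0..x}|lebesgue. Kker n P Q x t * Y n t) = (LINT t:{0..x}|lebesgue. \<Sum>k=1..n. \<Sum>\<nu>\<le>k. kpiece P Q k \<nu> x t * Y n t)"
      by (simp only: Kker_eq_sum_kpiece sum_distrib_right)
    also have "\<dots> = (\<Sum>k=1..n. LINT t:{0..x}|lebesgue. \<Sum>\<nu>\<le>k. kpiece P Q k \<nu> x t * Y n t)"
      by (rule set_integral_sum[OF set_integrable_sum[OF i]])
    also have "\<dots> = (\<Sum>k=1..n. \<Sum>\<nu>\<le>k. W k \<nu> x)"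
      unfolding W_def by (intro sum.cong refl set_integral_sum[OF i])
    finally show ?thesis .
  qed
  have "ell n p0 p q Y D = (-1) ^ n * ((LINT x:{0..1}|lebesgue. p0 x * (D n x * Y n x)) +
    (\<Sum>k=1..n. \<Sum>\<nu>\<le>k. LINT x:{0..1}|lebesgue. rcoef P Q k \<nu> x * (D (n - \<nu>) x * Y (n - k + \<nu>) x)))"
    by (rule ell_eq[OF pq Y D])
  also have "(LINT x:{0..1}|lebesgue. p0 x * (D n x * Y n x)) = (LINT x:{0..1}|lebesgue. ((b x)\<^sup>2 * Y n x) * D n x)"
    using p0 by (intro set_lebesgue_integral_cong) auto
  also have "(\<Sum>k=1..n. \<Sum>\<nu>\<le>k. LINT x:{0..1}|lebesgue. rcoef P Q k \<nu> x * (D (n - \<nu>) x * Y (n - k + \<nu>) x)) =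
     (\<Sum>k=1..n. \<Sum>\<nu>\<le>k. LINT x:{0..1}|lebesgue. (W k \<nu> x + U k \<nu> x) * D n x)"
    unfolding W_def U_def by (intro sum.cong refl integral_piece P Q Y D) auto
  also have "\<dots> = (\<Sum>k=1..n. LINT x:{0..1}|lebesgue. \<Sum>\<nu>\<le>k. (W k \<nu> x + U k \<nu> x) * D n x)"
    by (intro sum.cong refl set_integral_sum[symmetric] int)
  also have "\<dots> = (LINT x:{0..1}|lebesgue. \<Sum>k=1..n. \<Sum>\<nu>\<le>k. (W k \<nu> x + U k \<nu> x) * D n x)"
    by (rule set_integral_sum[OF set_integrable_sum[OF int], symmetric])
  also have "(LINT x:{0..1}|lebesgue. ((b x)\<^sup>2 * Y n x) * D n x) + \<dots> =
     (LINT x:{0..1}|lebesgue. ((b x)\<^sup>2 * Y n x) * D n x + (\<Sum>k=1..n. \<Sum>\<nu>\<le>k. (W k \<nu> x + U k \<nu> x) * D n x))"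
    by (rule set_integral_add(2)[OF int0 set_integrable_sum[OF set_integrable_sum[OF int]], symmetric])
  also have "\<dots> = (LINT x:{0..1}|lebesgue. (Bop b (Kker n P Q) (Y n) x + (\<Sum>\<mu><n. Y \<mu> 0 * u \<mu> x)) * D n x)"
  proof (rule set_lebesgue_integral_cong)
    show "\<forall>x. x \<in> {0..1} \<longrightarrow> ((b x)\<^sup>2 * Y n x) * D n x + (\<Sum>k=1..n. \<Sum>\<nu>\<le>k. (W k \<nu> x + U k \<nu> x) * D n x) =
      (Bop b (Kker n P Q) (Y n) x + (\<Sum>\<mu><n. Y \<mu> 0 * u \<mu> x)) * D n x"
      unfolding Bop_def u by (simp add: K sum.distrib distrib_right sum_distrib_right)
  qed simp
  finally show "ell n p0 p q Y D = (-1) ^ n * (LINT x:{0..1}|lebesgue. (Bop b (Kker n P Q) (Y n) x + (\<Sum>\<mu><n. Y \<mu> 0 * u \<mu> x)) * D n x)" .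
qed

end

section \<open>Primitives of a functional and polynomials\<close>

text \<open>Induction on the number of functionals. If some e in the kernel of the earlier ones has
  L_k e nonzero, subtracting the multiple of L_k that agrees with \<Lambda> at e reduces to them;
  otherwise L_k vanishes on their common kernel and gets coefficient 0.\<close>

lemma functional_eq_combination:
  fixes V :: "('a \<Rightarrow> complex) set" and L :: "nat \<Rightarrow> ('a \<Rightarrow> complex) \<Rightarrow> complex" and \<Lambda> :: "('a \<Rightarrow> complex) \<Rightarrow> complex"
  assumes V: "\<And>f g c. f \<in> V \<Longrightarrow> g \<in> V \<Longrightarrow> (\<lambda>x. f x - c * g x) \<in> V"
    and L: "\<And>j f g c. f \<in> V \<Longrightarrow> g \<in> V \<Longrightarrow> L j (\<lambda>x. f x - c * g x) = L j f - c * L j g"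
    and \<Lambda>: "\<And>f g c. f \<in> V \<Longrightarrow> g \<in> V \<Longrightarrow> \<Lambda> (\<lambda>x. f x - c * g x) = \<Lambda> f - c * \<Lambda> g"
    and ker: "\<And>f. f \<in> V \<Longrightarrow> (\<And>j. j < k \<Longrightarrow> L j f = 0) \<Longrightarrow> \<Lambda> f = 0"
  shows "\<exists>c. \<forall>f\<in>V. \<Lambda> f = (\<Sum>j<k. c j * L j f)"
  using \<Lambda> ker
proof (induction k arbitrary: \<Lambda>)
  case 0
  then show ?case by simp
next
  case (Suc k)
  show ?case
  proof (cases "\<exists>e\<in>V. (\<forall>j<k. L j e = 0) \<and> L k e \<noteq> 0")
    case True
    then obtain e where e: "e \<in> V" "\<And>j. j < k \<Longrightarrow> L j e = 0" "L k e \<noteq> 0" by blast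
    define d where "d = \<Lambda> e / L k e"
    have "\<exists>c. \<forall>f\<in>V. \<Lambda> f - d * L k f = (\<Sum>j<k. c j * L j f)"
    proof (rule Suc.IH)
      show "\<Lambda> (\<lambda>x. f x - c * g x) - d * L k (\<lambda>x. f x - c * g x) = \<Lambda> f - d * L k f - c * (\<Lambda> g - d * L k g)"
        if "f \<in> V" "g \<in> V" for f g c
        using that by (simp add: Suc.prems(1) L algebra_simps)
      fix f assume f: "f \<in> V" "\<And>j. j < k \<Longrightarrow> L j f = 0"
      let ?h = "\<lambda>x. f x - L k f / L k e * e x"
      have "\<Lambda> ?h = 0"
      proof (rule Suc.prems(2))
        fix j assume "j < Suc k"
        moreover have "L j ?h = L j f - L k f / L k e * L j e"
          by (rule L[OF f(1) e(1)])
        ultimately show "L j ?h = 0"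
          using e f by (cases "j = k") auto
      qed (rule V[OF f(1) e(1)])
      moreover have "\<Lambda> ?h = \<Lambda> f - L k f / L k e * \<Lambda> e"
        by (rule Suc.prems(1)[OF f(1) e(1)])
      ultimately show "\<Lambda> f - d * L k f = 0"
        by (simp add: d_def mult.commute)
    qed
    then obtain c where c: "\<And>f. f \<in> V \<Longrightarrow> \<Lambda> f - d * L k f = (\<Sum>j<k. c j * L j f)" by blast
    have "\<Lambda> f = (\<Sum>j<Suc k. (c(k := d)) j * L j f)" if "f \<in> V" for f
      using c[OF that] by (simp add: algebra_simps)
    then show ?thesis by blast
  next
    case False
    have "\<exists>c. \<forall>f\<in>V. \<Lambda> f = (\<Sum>j<k. c j * L j f)"
    proof (rule Suc.IH)
      fix f assume f: "f \<in> V" "\<And>j. j < k \<Longrightarrow> L j f = 0"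
      then have "L k f = 0" using False by blast
      with f show "\<Lambda> f = 0"
        by (intro Suc.prems(2)) (auto simp: less_Suc_eq)
    qed (rule Suc.prems(1))
    then obtain c where c: "\<And>f. f \<in> V \<Longrightarrow> \<Lambda> f = (\<Sum>j<k. c j * L j f)" by blast
    have "\<Lambda> f = (\<Sum>j<Suc k. (c(k := 0)) j * L j f)" if "f \<in> V" for f
      using c[OF that] by simp
    then show ?thesis by blast
  qed
qed

text \<open>The i-th derivative of a polynomial of degree below k, written in powers of 1 - x
  because the moment kernels (1 - x)^j / j! express the values at 1 of iterated primitives.\<close>

definition poly_family :: "(nat \<Rightarrow> complex) \<Rightarrow> nat \<Rightarrow> nat \<Rightarrow> real \<Rightarrow> complex" where
  "poly_family c k i x = (\<Sum>j<k. c j * mono_family 1 j i x)"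

lemma ac_family_poly_family: "ac_family m (poly_family c k)"
  using ac_family_mono_family[of "Suc m"] unfolding ac_family_iff poly_family_def[abs_def]
  by (auto intro!: ac_deriv_sum ac_deriv_cmult)

lemma poly_family_top: "poly_family c k k = (\<lambda>x. 0)"
  by (simp add: poly_family_def[abs_def] mono_family_def)

lemma poly_family_continuous: "continuous_on {0..1} (poly_family c k i)"
  by (rule ac_family_continuous[OF ac_family_poly_family lessI])

context weight begin

text \<open>The k-fold primitive of f is a test function as soon as its values of order below k
  vanish at 1, that is, as soon as f has k vanishing moments. Thus \<sigma> annihilates the common
  kernel of the moment functionals and acts as a combination of them.\<close>

lemma orthogonal_imp_poly:
  assumes \<sigma>: "L2w (invw b) \<sigma>"
    and orth: "\<And>D. W0b b k D \<Longrightarrow> (LINT x:{0..1}|lebesgue. \<sigma> x * D k x) = 0"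
  obtains c where "AE x in lebesgue_on {0..1}. \<sigma> x = poly_family c k 0 x"
proof -
  define L where "L j g = (LINT x:{0..1}|lebesgue. mono_family 1 j 0 x * g x)" for j and g :: "real \<Rightarrow> complex"
  define \<Lambda> where "\<Lambda> g = (LINT x:{0..1}|lebesgue. \<sigma> x * g x)" for g
  have mono: "L2w (invw b) (mono_family 1 j 0)" for j
    by (intro L2w_continuous ac_family_continuous[OF ac_family_mono_family lessI])
  have lin: "(LINT x:{0..1}|lebesgue. s x * (f x - c * g x)) = (LINT x:{0..1}|lebesgue. s x * f x) - c * (LINT x:{0..1}|lebesgue. s x * g x)"
    if s: "L2w (invw b) s" and f: "L2w b f" and g: "L2w b g" for s f g c
  proof -
    have "(LINT x:{0..1}|lebesgue. s x * (f x - c * g x)) = (LINT x:{0..1}|lebesgue. s x * f x - c * (s x * g x))"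
      by (intro set_lebesgue_integral_cong) (auto simp: algebra_simps)
    also have "\<dots> = (LINT x:{0..1}|lebesgue. s x * f x) - (LINT x:{0..1}|lebesgue. c * (s x * g x))"
      by (intro set_integral_diff(2) set_integrable_mult_right L2w_mult_integrable s f g)
    finally show ?thesis by (simp only: set_integral_mult_right)
  qed
  have "\<exists>c. \<forall>f\<in>{f. L2w b f}. \<Lambda> f = (\<Sum>j<k. c j * L j f)"
  proof (rule functional_eq_combination)
    fix f assume f: "f \<in> {f. L2w b f}" and f0: "\<And>j. j < k \<Longrightarrow> L j f = 0"
    have f_int: "set_integrable lebesgue {0..1} f"
      using f by (simp add: L2w_integrable)
    have "W0b b k (iter_family k f)"
      unfolding W0b_def Wb_def
    proof (intro conjI allI impI)
      fix j assume j: "j < k"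
      show "iter_family k f j 0 = 0"
        by (rule iter_family_0[OF j])
      have "iter_family k f j = iter_family (Suc (k - Suc j)) f 0"
        using j by (simp add: iter_family_def Suc_diff_Suc)
      then have "iter_family k f j 1 = L (k - Suc j) f"
        using iter_family_eq[OF f_int, of 1 "k - Suc j"] by (simp add: L_def mono_family_def)
      then show "iter_family k f j 1 = 0"
        using f0[of "k - Suc j"] j by simp
    qed (use f ac_family_iter_family[OF f_int] in auto)
    from orth[OF this] show "\<Lambda> f = 0"
      by (simp add: \<Lambda>_def)
  qed (auto simp: \<Lambda>_def L_def lin \<sigma> mono intro!: L2w_diff L2w_cmult)
  then obtain c where c: "\<And>f. L2w b f \<Longrightarrow> \<Lambda> f = (\<Sum>j<k. c j * L j f)" by blast
  \<comment> \<open>With the coefficients just found, the difference is orthogonal to all of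
    L_{2,b}, not merely to top derivatives of test functions.\<close>
  define s where "s x = \<sigma> x - poly_family c k 0 x" for x
  have s: "L2w (invw b) s"
    unfolding s_def by (intro L2w_diff \<sigma> L2w_continuous poly_family_continuous) simp
  have s_orth: "(LINT x:{0..1}|lebesgue. s x * f x) = 0" if f: "L2w b f" for f
  proof -
    have int: "set_integrable lebesgue {0..1} (\<lambda>x. c j * (mono_family 1 j 0 x * f x))" for j
      by (intro set_integrable_mult_right L2w_mult_integrable mono f)
    have "(LINT x:{0..1}|lebesgue. s x * f x) = (LINT x:{0..1}|lebesgue. \<sigma> x * f x - (\<Sum>j<k. c j * (mono_family 1 j 0 x * f x)))"
      by (intro set_lebesgue_integral_cong) (auto simp: s_def poly_family_def left_diff_distrib sum_distrib_right mult.assoc)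
    also have "\<dots> = \<Lambda> f - (LINT x:{0..1}|lebesgue. \<Sum>j<k. c j * (mono_family 1 j 0 x * f x))"
      unfolding \<Lambda>_def by (intro set_integral_diff(2) set_integrable_sum int L2w_mult_integrable \<sigma> f)
    also have "(LINT x:{0..1}|lebesgue. \<Sum>j<k. c j * (mono_family 1 j 0 x * f x)) = (\<Sum>j<k. c j * L j f)"
      by (simp only: set_integral_sum[OF int] set_integral_mult_right L_def)
    finally show ?thesis using c[OF f] by simp
  qed
  \<comment> \<open>test with \<open>cnj s / \<bar>b\<bar>\<^sup>2\<close>\<close>
  define N where "N x = (cmod (invw b x * s x))\<^sup>2" for x
  define f where "f x = cnj (s x) * of_real ((cmod (invw b x))\<^sup>2)" for x
  have N: "integrable (lebesgue_on {0..1}) N"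
    using s by (simp add: L2w_iff N_def[abs_def])
  have "L2w b f"
    unfolding L2w_iff
  proof
    note [measurable] = L2w_measurable[OF s]
    have "(\<lambda>x. cnj (s x)) \<in> borel_measurable (lebesgue_on {0..1})"
      by (rule borel_measurable_continuous_on[OF continuous_on_cnj[OF continuous_on_id]]) measurable
    then show "f \<in> borel_measurable (lebesgue_on {0..1})"
      unfolding f_def by measurable
    have "(cmod (b x * f x))\<^sup>2 = N x" for x
    proof -
      have "cmod (b x * f x) = cmod (s x) * cmod (b x * (invw b x)\<^sup>2)"
        by (simp add: f_def norm_mult norm_power mult_ac)
      then show ?thesis
        unfolding b_invw_square by (simp add: N_def norm_mult mult.commute)
    qed
    then show "integrable (lebesgue_on {0..1}) (\<lambda>x. (cmod (b x * f x))\<^sup>2)"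
      using N by simp
  qed
  from s_orth[OF this] have "(LINT x:{0..1}|lebesgue. complex_of_real (N x)) = 0"
  proof (rule trans[rotated])
    show "(LINT x:{0..1}|lebesgue. complex_of_real (N x)) = (LINT x:{0..1}|lebesgue. s x * f x)"
    proof (rule set_lebesgue_integral_cong)
      show "\<forall>x. x \<in> {0..1} \<longrightarrow> complex_of_real (N x) = s x * f x"
        by (simp add: N_def f_def norm_mult power_mult_distrib complex_norm_square mult_ac del: of_real_power)
    qed simp
  qed
  then have "(LINT x:{0..1}|lebesgue. N x) = 0"
    by (simp add: set_integral_complex_of_real)
  then have "integral\<^sup>L (lebesgue_on {0..1}) N = 0"
    by (simp add: set_lebesgue_integral_def integral_restrict_space)
  then have "AE x in lebesgue_on {0..1}. N x = 0"
    using integral_nonneg_eq_0_iff_AE[OF N] by (simp add: N_def)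
  then have "AE x in lebesgue_on {0..1}. \<sigma> x = poly_family c k 0 x"
    using b_nonzero by eventually_elim (simp add: N_def s_def invw_def)
  then show ?thesis by (rule that)
qed

end

section \<open>Vanishing of the kernel for polynomial primitives\<close>

lemma leib_vanish_left:
  assumes "\<And>i. i < m \<Longrightarrow> D i x = 0"
  shows "j < m \<Longrightarrow> leib D Z j x = 0" "leib D Z m x = D m x * Z 0 x"
proof -
  show "leib D Z j x = 0" if "j < m"
    unfolding leib_def using assms that by (intro sum.neutral) auto
  have "leib D Z m x = (\<Sum>i\<le>m. if i = m then D m x * Z 0 x else 0)"
    unfolding leib_def using assms by (intro sum.cong) auto
  then show "leib D Z m x = D m x * Z 0 x" by simp
qed

lemma leib_vanish_right:
  assumes "\<And>i. i < m \<Longrightarrow> Z i x = 0"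
  shows "j < m \<Longrightarrow> leib D Z j x = 0" "leib D Z m x = D 0 x * Z m x"
proof -
  show "leib D Z j x = 0" if "j < m"
    unfolding leib_def using assms that by (intro sum.neutral) auto
  have "leib D Z m x = (\<Sum>i\<le>m. if i = 0 then D 0 x * Z m x else 0)"
    unfolding leib_def using assms by (intro sum.cong) auto
  then show "leib D Z m x = D 0 x * Z m x" by simp
qed

text \<open>The remaining integral contains the k-th derivative of a polynomial of degree below k,
  and \<open>V\<close> vanishes at both ends below order k - 1, so only the first boundary term
  survives.\<close>

lemma poly_family_by_parts:
  assumes V: "ac_family k V" and k: "0 < k" and tx: "0 \<le> t" "t \<le> x" "x \<le> 1"
    and V0: "\<And>j. j < k - 1 \<Longrightarrow> V j x = 0" "\<And>j. j < k - 1 \<Longrightarrow> V j t = 0"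
  shows "(LINT \<tau>:{t..x}|lebesgue. poly_family c k 0 \<tau> * V k \<tau>) =
    poly_family c k 0 x * V (k - 1) x - poly_family c k 0 t * V (k - 1) t"
proof -
  have "(LINT \<tau>:{t..x}|lebesgue. poly_family c k 0 \<tau> * V k \<tau>) =
    (\<Sum>j<k. (-1) ^ j * (poly_family c k j x * V (k - 1 - j) x - poly_family c k j t * V (k - 1 - j) t))
    + (-1) ^ k * (LINT x:{t..x}|lebesgue. poly_family c k k x * V 0 x)"
    by (rule ac_family_by_parts[OF ac_family_poly_family V tx k])
  also have "(\<Sum>j<k. (-1) ^ j * (poly_family c k j x * V (k - 1 - j) x - poly_family c k j t * V (k - 1 - j) t)) =
    (\<Sum>j<k. if j = 0 then poly_family c k 0 x * V (k - 1) x - poly_family c k 0 t * V (k - 1) t else 0)"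
    by (intro sum.cong) (auto simp: V0)
  finally show ?thesis
    using k by (simp add: poly_family_top)
qed

lemma shiftF_0 [simp]: "shiftF 0 D = D"
  by (simp add: shiftF_def)

lemma set_integrable_continuous:
  fixes f :: "real \<Rightarrow> 'a::euclidean_space"
  assumes "continuous_on {0..1} f" "0 \<le> t" "x \<le> 1"
  shows "set_integrable lebesgue {t..x} f"
  using assms by (intro set_integrable_subset[OF absolutely_integrable_continuous_real[OF assms(1)]]) auto

text \<open>By the Leibniz rule the middle terms of the kernel add up to a derivative of the product
  \<open>\<phi> \<psi>\<close>, which vanishes to order \<open>k - 1\<close> at both ends of \<open>[t, x]\<close>; integration by parts
  therefore leaves only the boundary terms, and these cancel the remaining part of the kernel.\<close>

lemma sum_kpiece_poly_family:
  assumes k: "0 < k" and tx: "0 \<le> t" "t \<le> x" "x \<le> 1"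
  shows "(\<Sum>\<nu>\<le>k. kpiece (\<lambda>_. poly_family c k 0) (\<lambda>_. poly_family d (k - 1) 0) k \<nu> x t) = 0"
proof -
  define l where "l = k - 1"
  have kl: "k = Suc l" using k by (simp add: l_def)
  define \<rho> where "\<rho> = poly_family c k 0"
  define s where "s = poly_family d l 0"
  \<comment> \<open>\<phi>(\<tau>) = (x - \<tau>)^l / l! vanishes to order l at x, and
    \<psi>(\<tau>) = (\<tau> - t)^l / l! does so at t; the sign in \<psi> reverses t -
    \<tau>.\<close>
  define \<phi> where "\<phi> = mono_family x l"
  define \<psi> where "\<psi> i \<tau> = (-1) ^ l * mono_family t l i \<tau>" for i \<tau>
  define e where "e = complex_of_real ((x - t) ^ l / fact l)"
  let ?r = "rcoef (\<lambda>_. \<rho>) (\<lambda>_. s) k"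
  have \<phi>_ac: "ac_family m \<phi>" for m
    unfolding \<phi>_def by (rule ac_family_mono_family)
  have \<psi>_ac: "ac_family m \<psi>" for m
    using ac_family_mono_family[of m t l] unfolding ac_family_iff \<psi>_def by (auto intro!: ac_deriv_cmult)
  have \<phi>'_ac: "ac_family m (shiftF 1 \<phi>)" and \<psi>'_ac: "ac_family m (shiftF 1 \<psi>)" for m
    by (intro ac_family_shiftF \<phi>_ac \<psi>_ac)+
  have \<phi>x: "\<phi> i x = (if i = l then (-1) ^ l else 0)" for i
    by (simp add: \<phi>_def mono_family_at_center)
  have \<psi>t: "\<psi> i t = (if i = l then 1 else 0)" for i
    by (simp add: \<psi>_def mono_family_at_center)
  have \<phi>t: "\<phi> 0 t = e"
    by (simp add: \<phi>_def mono_family_def e_def)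
  have flip: "(-1) ^ m * complex_of_real ((t - \<tau>) ^ m / fact m) = of_real ((\<tau> - t) ^ m / fact m)" for m \<tau>
  proof -
    have "(t - \<tau>) ^ m / fact m = (-1) ^ m * ((\<tau> - t) ^ m / fact m)"
      by (metis minus_diff_eq power_minus times_divide_eq_right)
    then have "complex_of_real ((t - \<tau>) ^ m / fact m) = (-1) ^ m * of_real ((\<tau> - t) ^ m / fact m)"
      by (simp only: of_real_mult of_real_power of_real_minus of_real_1)
    then show ?thesis
      by (simp only: left_minus_one_mult_self)
  qed
  have \<psi>_eq: "\<psi> i \<tau> = of_real ((\<tau> - t) ^ (l - i) / fact (l - i))" if "i \<le> l" for i \<tau>
  proof -
    have "(-1) ^ l * (-1) ^ i = ((-1) ^ (l - i) :: complex)"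
    proof -
      obtain m where m: "l = i + m" using le_Suc_ex[OF \<open>i \<le> l\<close>] by blast
      have "(-1) ^ l * (-1) ^ i = ((-1) ^ i * (-1) ^ i) * ((-1) ^ m :: complex)"
        by (simp only: m power_add mult_ac)
      also have "(-1) ^ i * (-1) ^ i = (1 :: complex)"
        by simp
      finally show ?thesis by (simp add: m)
    qed
    then show ?thesis
      using that flip[of "l - i" \<tau>] by (simp add: \<psi>_def mono_family_def flip: mult.assoc)
  qed
  have \<psi>x: "\<psi> 0 x = e"
    by (simp add: \<psi>_eq e_def)
  have \<phi>k: "\<phi> k \<tau> = 0" and \<psi>k: "\<psi> k \<tau> = 0" for \<tau>
    by (simp_all add: \<phi>_def \<psi>_def mono_family_def kl)

  have cont_r: "continuous_on {0..1} (?r \<nu>)" for \<nu>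
    unfolding rcoef_def \<rho>_def s_def by (intro continuous_intros poly_family_continuous)
  have cont_\<phi>: "continuous_on {0..1} (\<phi> i)" and cont_\<psi>: "continuous_on {0..1} (\<psi> i)" for i
    by (rule ac_family_continuous[OF _ lessI], rule \<phi>_ac \<psi>_ac)+
  have cont_\<rho>: "continuous_on {0..1} \<rho>" and cont_s: "continuous_on {0..1} s"
    unfolding \<rho>_def s_def by (intro poly_family_continuous)+
  have cont_leib: "continuous_on {0..1} (leib D Z j)" if "\<And>m. ac_family m D" "\<And>m. ac_family m Z" for D Z j
    by (rule ac_family_continuous[OF ac_family_leib[OF that] lessI])

  \<comment> \<open>The two kernel factors are \<phi>^(k-\<nu>) and \<psi>^(\<nu>); the sign
    (-1)^(k-\<nu>) from differentiating \<phi> makes the overall sign independent of \<nu>.\<close>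
  have mid: "kpiece (\<lambda>_. \<rho>) (\<lambda>_. s) k \<nu> x t = (-1) ^ k * (LINT \<tau>:{t..x}|lebesgue. ?r \<nu> \<tau> * (\<phi> (k - \<nu>) \<tau> * \<psi> \<nu> \<tau>))"
    if \<nu>: "\<nu> \<in> {1..l}" for \<nu>
  proof -
    have "(LINT \<tau>:{t..x}|lebesgue. ?r \<nu> \<tau> * (\<phi> (k - \<nu>) \<tau> * \<psi> \<nu> \<tau>)) =
      (LINT \<tau>:{t..x}|lebesgue. (-1) ^ (k - \<nu>) * (of_real ((x - \<tau>) ^ (\<nu> - 1) / fact (\<nu> - 1)) * ?r \<nu> \<tau> *
         of_real ((\<tau> - t) ^ (l - \<nu>) / fact (l - \<nu>))))"
    proof (rule set_lebesgue_integral_cong)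
      show "\<forall>\<tau>. \<tau> \<in> {t..x} \<longrightarrow> ?r \<nu> \<tau> * (\<phi> (k - \<nu>) \<tau> * \<psi> \<nu> \<tau>) =
         (-1) ^ (k - \<nu>) * (of_real ((x - \<tau>) ^ (\<nu> - 1) / fact (\<nu> - 1)) * ?r \<nu> \<tau> *
         of_real ((\<tau> - t) ^ (l - \<nu>) / fact (l - \<nu>)))"
      proof (intro allI impI)
        fix \<tau>
        have "\<phi> (k - \<nu>) \<tau> = (-1) ^ (k - \<nu>) * of_real ((x - \<tau>) ^ (\<nu> - 1) / fact (\<nu> - 1))"
        proof -
          have "k - \<nu> \<le> l" "l - (k - \<nu>) = \<nu> - 1" using \<nu> by (auto simp: kl)
          then show ?thesis by (simp add: \<phi>_def mono_family_def)
        qed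
        moreover have "\<psi> \<nu> \<tau> = of_real ((\<tau> - t) ^ (l - \<nu>) / fact (l - \<nu>))"
          using \<nu> by (intro \<psi>_eq) auto
        ultimately show "?r \<nu> \<tau> * (\<phi> (k - \<nu>) \<tau> * \<psi> \<nu> \<tau>) =
         (-1) ^ (k - \<nu>) * (of_real ((x - \<tau>) ^ (\<nu> - 1) / fact (\<nu> - 1)) * ?r \<nu> \<tau> *
         of_real ((\<tau> - t) ^ (l - \<nu>) / fact (l - \<nu>)))"
          by (simp only: mult_ac)
      qed
    qed simp
    also have "\<dots> = (-1) ^ (k - \<nu>) * mid_kernel (\<nu> - 1) (l - \<nu>) (?r \<nu>) x t"
      unfolding mid_kernel_def by (rule set_integral_mult_right)
    finally have I: "(LINT \<tau>:{t..x}|lebesgue. ?r \<nu> \<tau> * (\<phi> (k - \<nu>) \<tau> * \<psi> \<nu> \<tau>)) = (-1) ^ (k - \<nu>) * mid_kernel (\<nu> - 1) (l - \<nu>) (?r \<nu>) x t" .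
    have "k = \<nu> + (k - \<nu>)" using \<nu> by (simp add: kl)
    then have "(-1) ^ k = (-1) ^ \<nu> * ((-1) ^ (k - \<nu>) :: complex)"
      by (metis power_add)
    then have "(-1) ^ k * (LINT \<tau>:{t..x}|lebesgue. ?r \<nu> \<tau> * (\<phi> (k - \<nu>) \<tau> * \<psi> \<nu> \<tau>)) = (-1) ^ \<nu> * mid_kernel (\<nu> - 1) (l - \<nu>) (?r \<nu>) x t"
      unfolding I by (simp only: mult.assoc left_minus_one_mult_self)
    then show ?thesis
      using \<nu> by (simp add: kpiece_def kl)
  qed
  let ?I = "\<lambda>\<nu>. LINT \<tau>:{t..x}|lebesgue. ?r \<nu> \<tau> * (\<phi> (k - \<nu>) \<tau> * \<psi> \<nu> \<tau>)"
  have split: "(\<Sum>\<nu>\<le>k. f \<nu>) = f 0 + f k + (\<Sum>\<nu>=1..l. f \<nu>)" for f :: "nat \<Rightarrow> complex"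
  proof -
    have "{..k} = insert 0 (insert k {1..l})" by (auto simp: kl)
    then show ?thesis by (simp add: kl add.assoc)
  qed
  have "(\<Sum>\<nu>=1..l. kpiece (\<lambda>_. \<rho>) (\<lambda>_. s) k \<nu> x t) = (-1) ^ k * (\<Sum>\<nu>=1..l. ?I \<nu>)"
    unfolding sum_distrib_left by (rule sum.cong[OF refl mid])
  \<comment> \<open>Including \<nu> = 0 and \<nu> = k costs nothing, as the k-th derivatives of
    \<phi> and \<psi> vanish, and it completes the Leibniz sums.\<close>
  also have "(\<Sum>\<nu>=1..l. ?I \<nu>) = (\<Sum>\<nu>\<le>k. ?I \<nu>)"
    unfolding split by (simp add: \<phi>k \<psi>k)
  also have "\<dots> = (LINT \<tau>:{t..x}|lebesgue. \<Sum>\<nu>\<le>k. ?r \<nu> \<tau> * (\<phi> (k - \<nu>) \<tau> * \<psi> \<nu> \<tau>))"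
    by (intro set_integral_sum[symmetric] set_integrable_continuous continuous_intros cont_r cont_\<phi> cont_\<psi> tx)
  also have "\<dots> = (LINT \<tau>:{t..x}|lebesgue. \<rho> \<tau> * leib \<phi> \<psi> k \<tau> +
      \<i> * (s \<tau> * leib (shiftF 1 \<phi>) \<psi> l \<tau> - s \<tau> * leib \<phi> (shiftF 1 \<psi>) l \<tau>))"
    using rcoef_sum_eq_leib[of k k "\<lambda>_. \<rho>" "\<lambda>_. s" _ \<phi> \<psi>] by (simp add: kl)
  also have "\<dots> = (LINT \<tau>:{t..x}|lebesgue. \<rho> \<tau> * leib \<phi> \<psi> k \<tau>) +
      (LINT \<tau>:{t..x}|lebesgue. \<i> * (s \<tau> * leib (shiftF 1 \<phi>) \<psi> l \<tau> - s \<tau> * leib \<phi> (shiftF 1 \<psi>) l \<tau>))"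
    by (intro set_integral_add(2) set_integrable_continuous continuous_intros cont_\<rho> cont_s cont_leib \<phi>_ac \<psi>_ac \<phi>'_ac \<psi>'_ac tx)
  also have "(LINT \<tau>:{t..x}|lebesgue. \<i> * (s \<tau> * leib (shiftF 1 \<phi>) \<psi> l \<tau> - s \<tau> * leib \<phi> (shiftF 1 \<psi>) l \<tau>)) =
     \<i> * ((LINT \<tau>:{t..x}|lebesgue. s \<tau> * leib (shiftF 1 \<phi>) \<psi> l \<tau>) - (LINT \<tau>:{t..x}|lebesgue. s \<tau> * leib \<phi> (shiftF 1 \<psi>) l \<tau>))"
    unfolding set_integral_mult_right
    by (intro arg_cong2[where f = "(*)"] refl set_integral_diff(2) set_integrable_continuous continuous_intros cont_s cont_leib
        \<phi>_ac \<psi>_ac \<phi>'_ac \<psi>'_ac tx)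
  also have "(LINT \<tau>:{t..x}|lebesgue. \<rho> \<tau> * leib \<phi> \<psi> k \<tau>) = \<rho> x * ((-1) ^ l * e) - \<rho> t * e"
  proof -
    have "(LINT \<tau>:{t..x}|lebesgue. \<rho> \<tau> * leib \<phi> \<psi> k \<tau>) = \<rho> x * leib \<phi> \<psi> (k - 1) x - \<rho> t * leib \<phi> \<psi> (k - 1) t"
      unfolding \<rho>_def using tx k
      by (intro poly_family_by_parts ac_family_leib \<phi>_ac \<psi>_ac leib_vanish_left(1)[of "k - 1"] leib_vanish_right(1)[of "k - 1"])
        (auto simp: \<phi>x \<psi>t kl)
    also have "leib \<phi> \<psi> (k - 1) x = (-1) ^ l * e"
      by (subst leib_vanish_left(2)) (auto simp: \<phi>x \<psi>x kl)
    also have "leib \<phi> \<psi> (k - 1) t = e"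
      by (subst leib_vanish_right(2)) (auto simp: \<psi>t \<phi>t kl)
    finally show ?thesis .
  qed
  also have "(LINT \<tau>:{t..x}|lebesgue. s \<tau> * leib (shiftF 1 \<phi>) \<psi> l \<tau>) = s x * ((-1) ^ l * e)"
  proof (cases "l = 0")
    case False
    have "(LINT \<tau>:{t..x}|lebesgue. s \<tau> * leib (shiftF 1 \<phi>) \<psi> l \<tau>) =
      s x * leib (shiftF 1 \<phi>) \<psi> (l - 1) x - s t * leib (shiftF 1 \<phi>) \<psi> (l - 1) t"
      unfolding s_def using tx False
      by (intro poly_family_by_parts ac_family_leib \<phi>'_ac \<psi>_ac leib_vanish_left(1)[of "l - 1"] leib_vanish_right(1)[of "l - 1"])
        (auto simp: \<phi>x \<psi>t shiftF_def)
    also have "leib (shiftF 1 \<phi>) \<psi> (l - 1) x = (-1) ^ l * e"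
      using False by (subst leib_vanish_left(2)) (auto simp: \<phi>x \<psi>x shiftF_def)
    also have "leib (shiftF 1 \<phi>) \<psi> (l - 1) t = 0"
      using False by (intro leib_vanish_right(1)[of l]) (auto simp: \<psi>t)
    finally show ?thesis by simp
  qed (simp add: s_def poly_family_def)
  also have "(LINT \<tau>:{t..x}|lebesgue. s \<tau> * leib \<phi> (shiftF 1 \<psi>) l \<tau>) = - (s t * e)"
  proof (cases "l = 0")
    case False
    have "(LINT \<tau>:{t..x}|lebesgue. s \<tau> * leib \<phi> (shiftF 1 \<psi>) l \<tau>) =
      s x * leib \<phi> (shiftF 1 \<psi>) (l - 1) x - s t * leib \<phi> (shiftF 1 \<psi>) (l - 1) t"
      unfolding s_def using tx False
      by (intro poly_family_by_parts ac_family_leib \<phi>_ac \<psi>'_ac leib_vanish_left(1)[of "l - 1"] leib_vanish_right(1)[of "l - 1"])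
        (auto simp: \<phi>x \<psi>t shiftF_def)
    also have "leib \<phi> (shiftF 1 \<psi>) (l - 1) x = 0"
      using False by (intro leib_vanish_left(1)[of l]) (auto simp: \<phi>x)
    also have "leib \<phi> (shiftF 1 \<psi>) (l - 1) t = e"
      using False by (subst leib_vanish_right(2)) (auto simp: \<psi>t \<phi>t shiftF_def)
    finally show ?thesis by simp
  qed (simp add: s_def poly_family_def)
  finally have "(\<Sum>\<nu>=1..l. kpiece (\<lambda>_. \<rho>) (\<lambda>_. s) k \<nu> x t) =
    (-1) ^ k * ((\<rho> x * ((-1) ^ l * e) - \<rho> t * e) + \<i> * (s x * ((-1) ^ l * e) - - (s t * e)))" .
  moreover have "kpiece (\<lambda>_. \<rho>) (\<lambda>_. s) k 0 x t = e * (\<rho> x + \<i> * s x)"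
    by (simp add: kpiece_def rcoef_def e_def kl)
  moreover have "kpiece (\<lambda>_. \<rho>) (\<lambda>_. s) k k x t = (-1) ^ k * (e * (\<rho> t - \<i> * s t))"
    by (simp add: kpiece_def rcoef_def e_def kl binomial_eq_0)
  moreover have "(-1) ^ k * (-1) ^ l = (-1 :: complex)"
    by (simp add: kl)
  \<comment> \<open>Here a = (-1)^k and a' = (-1)^l, so a a' = -1 because k = l + 1; everything is a
    multiple of 1 + a a'.\<close>
  moreover have "e * (u + \<i> * v) + a * (e * (u' - \<i> * v')) + a * ((u * (a' * e) - u' * e) + \<i> * (v * (a' * e) - - (v' * e))) = 0"
    if "a * a' = -1" for a a' u u' v v'
  proof -
    have "e * (u + \<i> * v) + a * (e * (u' - \<i> * v')) + a * ((u * (a' * e) - u' * e) + \<i> * (v * (a' * e) - - (v' * e))) =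
      e * (u + \<i> * v) * (1 + a * a')"
      by (simp add: algebra_simps)
    then show ?thesis using that by simp
  qed
  ultimately have "(\<Sum>\<nu>\<le>k. kpiece (\<lambda>_. \<rho>) (\<lambda>_. s) k \<nu> x t) = 0"
    unfolding split by simp
  then show ?thesis
    by (simp add: \<rho>_def s_def l_def)
qed

section \<open>Independence of the choice of primitives\<close>

lemma set_integral_cong_AE_integrable:
  assumes "set_integrable M A f" "set_integrable M A g" "AE x in M. x \<in> A \<longrightarrow> f x = g x"
  shows "(LINT x:A|M. f x) = (LINT x:A|M. g x)"
  unfolding set_lebesgue_integral_def
proof (rule integral_cong_AE)
  show "AE x in M. indicat_real A x *\<^sub>R f x = indicat_real A x *\<^sub>R g x"
    using assms(3) by eventually_elim (auto simp: indicator_def)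
qed (use assms in \<open>auto simp: set_integrable_def\<close>)

context weight begin

text \<open>Equality almost everywhere is enough for the middle pieces, which integrate their
  coefficient; the extreme pieces evaluate it at x or at t, hence the separate hypotheses at these
  two points.\<close>

lemma kpiece_add:
  assumes P: "L2w (invw b) (P k)" and Q: "L2w (invw b) (Q (k - 1))"
    and P': "L2w (invw b) (P' k)" and Q': "L2w (invw b) (Q' (k - 1))"
    and R: "L2w (invw b) (R k)" and S: "L2w (invw b) (S (k - 1))"
    and eq: "AE x in lebesgue. x \<in> {0..1} \<longrightarrow> P' k x = P k x + R k x \<and> Q' (k - 1) x = Q (k - 1) x + S (k - 1) x"
    and tx: "0 \<le> t" "t \<le> x" "x \<le> 1"
    and x: "P' k x = P k x + R k x" "Q' (k - 1) x = Q (k - 1) x + S (k - 1) x"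
    and t: "P' k t = P k t + R k t" "Q' (k - 1) t = Q (k - 1) t + S (k - 1) t"
  shows "kpiece P' Q' k \<nu> x t = kpiece P Q k \<nu> x t + kpiece R S k \<nu> x t"
proof -
  have rx: "rcoef P' Q' k \<nu> y = rcoef P Q k \<nu> y + rcoef R S k \<nu> y"
    if "P' k y = P k y + R k y" "Q' (k - 1) y = Q (k - 1) y + S (k - 1) y" for y
    using that by (simp add: rcoef_def algebra_simps)
  have "mid_kernel i j (rcoef P' Q' k \<nu>) x t = mid_kernel i j (rcoef P Q k \<nu>) x t + mid_kernel i j (rcoef R S k \<nu>) x t" for i j
  proof -
    let ?f = "\<lambda>r \<tau>. of_real ((x - \<tau>) ^ i / fact i) * r \<tau> * of_real ((\<tau> - t) ^ j / fact j)"
    have int: "set_integrable lebesgue {t..x} (?f r)" if "L2w (invw b) r" for r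
    proof -
      have "set_integrable lebesgue {t..x} (\<lambda>\<tau>. complex_of_real ((x - \<tau>) ^ i / fact i) * (complex_of_real ((\<tau> - t) ^ j / fact j) * r \<tau>))"
        using tx by (intro set_integrable_mult_continuous set_integrable_subset[OF L2w_integrable(2)[OF that]])
          (auto intro!: continuous_intros)
      then show ?thesis by (simp only: mult_ac)
    qed
    have I: "set_integrable lebesgue {t..x} (?f (rcoef P Q k \<nu>))" "set_integrable lebesgue {t..x} (?f (rcoef R S k \<nu>))"
        "set_integrable lebesgue {t..x} (?f (rcoef P' Q' k \<nu>))"
      by (rule int[OF L2w_rcoef[of P k Q, OF P Q]], rule int[OF L2w_rcoef[of R k S, OF R S]],
          rule int[OF L2w_rcoef[of P' k Q', OF P' Q']])
    have "AE \<tau> in lebesgue. \<tau> \<in> {t..x} \<longrightarrow> ?f (rcoef P' Q' k \<nu>) \<tau> = ?f (rcoef P Q k \<nu>) \<tau> + ?f (rcoef R S k \<nu>) \<tau>"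
      using eq
    proof eventually_elim
      case (elim \<tau>)
      show ?case
      proof
        assume "\<tau> \<in> {t..x}"
        then have "\<tau> \<in> {0..1}" using tx by auto
        then show "?f (rcoef P' Q' k \<nu>) \<tau> = ?f (rcoef P Q k \<nu>) \<tau> + ?f (rcoef R S k \<nu>) \<tau>"
          using rx[of \<tau>] elim by (simp only: algebra_simps)
      qed
    qed
    then show ?thesis
      unfolding mid_kernel_def set_integral_add(2)[OF I(1,2), symmetric]
      by (rule set_integral_cong_AE_integrable[OF I(3) set_integral_add(1)[OF I(1,2)]])
  qed
  note mid = this
  consider "\<nu> = 0" | "\<nu> = k" "\<nu> \<noteq> 0" | "\<nu> \<noteq> 0" "\<nu> \<noteq> k" by blast
  then show ?thesis
  proof cases
    case 1
    then have "kpiece A B k \<nu> x t = of_real ((x - t) ^ (k - 1) / fact (k - 1)) * rcoef A B k \<nu> x" for A B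
      by (simp add: kpiece_def)
    then show ?thesis by (simp only: rx[OF x] distrib_left)
  next
    case 2
    then have "kpiece A B k \<nu> x t = (-1) ^ k * (of_real ((x - t) ^ (k - 1) / fact (k - 1)) * rcoef A B k \<nu> t)" for A B
      by (simp add: kpiece_def)
    then show ?thesis by (simp only: rx[OF t] distrib_left)
  next
    case 3
    then have "kpiece A B k \<nu> x t = (-1) ^ \<nu> * mid_kernel (\<nu> - 1) (k - 1 - \<nu>) (rcoef A B k \<nu>) x t" for A B
      by (simp add: kpiece_def)
    then show ?thesis by (simp only: mid distrib_left)
  qed
qed

lemma primitives_diff:
  assumes \<sigma>: "L2w (invw b) \<sigma>" "is_gder b k \<sigma> f" and \<sigma>': "L2w (invw b) \<sigma>'" "is_gder b k \<sigma>' f"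
  obtains c where "AE x in lebesgue_on {0..1}. \<sigma>' x = \<sigma> x + poly_family c k 0 x"
proof -
  have "(LINT x:{0..1}|lebesgue. (\<sigma>' x - \<sigma> x) * D k x) = 0" if D: "W0b b k D" for D
  proof -
    have Dk: "L2w b (D k)" using D by (simp add: W0b_def Wb_def)
    have "(LINT x:{0..1}|lebesgue. \<sigma>' x * D k x) = (LINT x:{0..1}|lebesgue. \<sigma> x * D k x)"
      using \<sigma>(2) \<sigma>'(2) D by (simp add: is_gder_def gder_def)
    then show ?thesis
      using L2w_mult_integrable[OF \<sigma>(1) Dk] L2w_mult_integrable[OF \<sigma>'(1) Dk] by (simp add: left_diff_distrib)
  qed
  then obtain c where "AE x in lebesgue_on {0..1}. \<sigma>' x - \<sigma> x = poly_family c k 0 x"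
    using orthogonal_imp_poly[OF L2w_diff[OF \<sigma>'(1) \<sigma>(1) invw_measurable], of k] by blast
  then have "AE x in lebesgue_on {0..1}. \<sigma>' x = \<sigma> x + poly_family c k 0 x"
    by eventually_elim (simp add: algebra_simps)
  then show ?thesis by (rule that)
qed

lemma Kker_independent:
  assumes pq: "primitives b n p q P Q" and pq': "primitives b n p q P' Q'"
  shows "AE x in lebesgue_on {0..1}. AE t in lebesgue_on {0..x}. Kker n P' Q' x t = Kker n P Q x t"
proof -
  have P: "L2w (invw b) (P k)" "is_gder b k (P k) (p k)" and Q: "L2w (invw b) (Q (k - 1))" "is_gder b (k - 1) (Q (k - 1)) (q (k - 1))"
    if "k \<in> {1..n}" for k
    using pq that unfolding primitives_def by auto
  have P': "L2w (invw b) (P' k)" "is_gder b k (P' k) (p k)" and Q': "L2w (invw b) (Q' (k - 1))" "is_gder b (k - 1) (Q' (k - 1)) (q (k - 1))"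
    if "k \<in> {1..n}" for k
    using pq' that unfolding primitives_def by auto
  have "\<forall>k\<in>{1..n}. \<exists>c d. AE x in lebesgue. x \<in> {0..1} \<longrightarrow>
     P' k x = P k x + poly_family c k 0 x \<and> Q' (k - 1) x = Q (k - 1) x + poly_family d (k - 1) 0 x"
  proof
    fix k assume k: "k \<in> {1..n}"
    obtain c where c: "AE x in lebesgue_on {0..1}. P' k x = P k x + poly_family c k 0 x"
      using primitives_diff[OF P[OF k] P'[OF k]] .
    obtain d where d: "AE x in lebesgue_on {0..1}. Q' (k - 1) x = Q (k - 1) x + poly_family d (k - 1) 0 x"
      using primitives_diff[OF Q[OF k] Q'[OF k]] .
    have "AE x in lebesgue. x \<in> {0..1} \<longrightarrow> P' k x = P k x + poly_family c k 0 x"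
      "AE x in lebesgue. x \<in> {0..1} \<longrightarrow> Q' (k - 1) x = Q (k - 1) x + poly_family d (k - 1) 0 x"
      using c d by (simp_all add: AE_restrict_space_iff)
    then have "AE x in lebesgue. x \<in> {0..1} \<longrightarrow>
       P' k x = P k x + poly_family c k 0 x \<and> Q' (k - 1) x = Q (k - 1) x + poly_family d (k - 1) 0 x"
    proof eventually_elim
      case (elim x)
      show ?case
        by (intro impI conjI elim[rule_format])
    qed
    then show "\<exists>c d. AE x in lebesgue. x \<in> {0..1} \<longrightarrow>
       P' k x = P k x + poly_family c k 0 x \<and> Q' (k - 1) x = Q (k - 1) x + poly_family d (k - 1) 0 x"
      by blast
  qed
  from bchoice[OF this] obtain c where "\<forall>k\<in>{1..n}. \<exists>d. AE x in lebesgue. x \<in> {0..1} \<longrightarrow>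
     P' k x = P k x + poly_family (c k) k 0 x \<and> Q' (k - 1) x = Q (k - 1) x + poly_family d (k - 1) 0 x" ..
  from bchoice[OF this] obtain d where "\<forall>k\<in>{1..n}. AE x in lebesgue. x \<in> {0..1} \<longrightarrow>
     P' k x = P k x + poly_family (c k) k 0 x \<and> Q' (k - 1) x = Q (k - 1) x + poly_family (d k) (k - 1) 0 x" ..
  note cd = bspec[OF this]
  \<comment> \<open>Finitely many k share one exceptional null set, and the kernels agree at every
    pair of points outside it; this yields the nested form of the claim.\<close>
  define good where "good x \<longleftrightarrow> (\<forall>k\<in>{1..n}. x \<in> {0..1} \<longrightarrow>
     P' k x = P k x + poly_family (c k) k 0 x \<and> Q' (k - 1) x = Q (k - 1) x + poly_family (d k) (k - 1) 0 x)" for x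
  have good: "AE x in lebesgue. good x"
    unfolding good_def using cd by (intro AE_finite_allI) auto
  have eq: "Kker n P' Q' x t = Kker n P Q x t" if "good x" "good t" "0 \<le> t" "t \<le> x" "x \<le> 1" for x t
    unfolding Kker_eq_sum_kpiece
  proof (rule sum.cong[OF refl])
    fix k assume k: "k \<in> {1..n}"
    \<comment> \<open>Each k is treated alone, so the polynomial families may be constant in their
      index, as required by \<open>sum_kpiece_poly_family\<close>.\<close>
    let ?R = "\<lambda>_::nat. poly_family (c k) k 0" and ?S = "\<lambda>_::nat. poly_family (d k) (k - 1) 0"
    have "kpiece P' Q' k \<nu> x t = kpiece P Q k \<nu> x t + kpiece ?R ?S k \<nu> x t" for \<nu>
      using cd[OF k] that k unfolding good_def
      by (intro kpiece_add P Q P' Q' L2w_continuous poly_family_continuous) auto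
    then have "(\<Sum>\<nu>\<le>k. kpiece P' Q' k \<nu> x t) = (\<Sum>\<nu>\<le>k. kpiece P Q k \<nu> x t) + (\<Sum>\<nu>\<le>k. kpiece ?R ?S k \<nu> x t)"
      by (simp only: sum.distrib)
    also have "(\<Sum>\<nu>\<le>k. kpiece ?R ?S k \<nu> x t) = 0"
      using k that by (intro sum_kpiece_poly_family) auto
    finally show "(\<Sum>\<nu>\<le>k. kpiece P' Q' k \<nu> x t) = (\<Sum>\<nu>\<le>k. kpiece P Q k \<nu> x t)" by simp
  qed
  have "AE x in lebesgue. x \<in> {0..1} \<longrightarrow> (AE t in lebesgue_on {0..x}. Kker n P' Q' x t = Kker n P Q x t)"
    using good
  proof eventually_elim
    case (elim x)
    show ?case
    proof
      assume "x \<in> {0..1}"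
      then have x: "0 \<le> x" "x \<le> 1" by auto
      have "AE t in lebesgue. t \<in> {0..x} \<longrightarrow> Kker n P' Q' x t = Kker n P Q x t"
        using good
      proof eventually_elim
        case (elim t)
        show ?case
          by (intro impI eq \<open>good x\<close> elim x(2)) simp_all
      qed
      then show "AE t in lebesgue_on {0..x}. Kker n P' Q' x t = Kker n P Q x t"
        by (simp add: AE_restrict_space_iff)
    qed
  qed
  then show ?thesis
    by (simp add: AE_restrict_space_iff)
qed

end

theorem theorem4:
  fixes n :: nat and p0 b :: "real \<Rightarrow> complex"
    and p q :: "nat \<Rightarrow> fnl" and P Q :: "nat \<Rightarrow> real \<Rightarrow> complex"
  assumes p0_nz: "AE x in lebesgue_on {0..1}. p0 x \<noteq> 0"
    and p0_L1: "set_integrable lebesgue {0..1} p0"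
    and p0_inv_L1: "set_integrable lebesgue {0..1} (\<lambda>x. inverse (p0 x))"
    and b_meas: "set_borel_measurable lebesgue {0..1} b"
    and b_sq: "\<forall>x\<in>{0..1}. (b x)\<^sup>2 = p0 x"
    and p_W: "\<forall>k\<in>{1..n}. in_Wneg b k (p k)"
    and q_W: "\<forall>\<nu><n. in_Wneg b \<nu> (q \<nu>)"
    and prim: "primitives b n p q P Q"
  shows "(\<exists>a :: real \<Rightarrow> real. L2w (invw b) (\<lambda>x. complex_of_real (a x)) \<and>
            (\<forall>x t. 0 \<le> t \<and> t \<le> x \<and> x \<le> 1 \<longrightarrow> cmod (Kker n P Q x t) \<le> a x + a t))
       \<and> L2_bij b (Bop b (Kker n P Q))
       \<and> (\<exists>u :: nat \<Rightarrow> real \<Rightarrow> complex. (\<forall>\<nu><n. L2w (invw b) (u \<nu>)) \<and>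
            (\<forall>Y. Wb b n Y \<longrightarrow> (\<forall>D. W0b b n D \<longrightarrow>
               ell n p0 p q Y D = (-1) ^ n * set_lebesgue_integral lebesgue {0..1}
                 (\<lambda>x. (Bop b (Kker n P Q) (Y n) x + (\<Sum>\<nu><n. Y \<nu> 0 * u \<nu> x)) * D n x))))
       \<and> (\<forall>P' Q'. primitives b n p q P' Q' \<longrightarrow>
            (AE x in lebesgue_on {0..1}. AE t in lebesgue_on {0..x}. Kker n P' Q' x t = Kker n P Q x t))"
proof -
  \<comment> \<open>Each condition on \<open>b\<close> follows from b^2 = p0 on [0,1]: the moduli of
    p0 and 1/p0 are |b|^2 and |1/b|^2, and b vanishes only where p0 does.\<close>
  interpret weight b
  proof
    have bp: "(b x)\<^sup>2 = p0 x" if "x \<in> space (lebesgue_on {0..1})" for x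
      using b_sq that by auto
    show "b \<in> borel_measurable (lebesgue_on {0..1})"
      using b_meas by (simp add: set_borel_measurable_lebesgue_on)
    have "integrable (lebesgue_on {0..1}) (\<lambda>x. cmod (p0 x))"
      using p0_L1 by (simp add: set_integrable_lebesgue_on)
    then show "integrable (lebesgue_on {0..1}) (\<lambda>x. (cmod (b x))\<^sup>2)"
      by (rule Bochner_Integration.integrable_cong[THEN iffD1, rotated 2])
        (auto simp: norm_power simp flip: bp)
    have "integrable (lebesgue_on {0..1}) (\<lambda>x. cmod (inverse (p0 x)))"
      using p0_inv_L1 by (intro integrable_norm) (simp add: set_integrable_lebesgue_on)
    then show "integrable (lebesgue_on {0..1}) (\<lambda>x. (cmod (invw b x))\<^sup>2)"
      by (rule Bochner_Integration.integrable_cong[THEN iffD1, rotated 2])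
        (auto simp: invw_def norm_inverse norm_power power_inverse simp flip: bp)
    show "AE x in lebesgue_on {0..1}. b x \<noteq> 0"
      using p0_nz AE_space
    proof eventually_elim
      case (elim x)
      then show ?case using bp[OF elim(2)] by (metis zero_power2)
    qed
  qed
  have P: "L2w (invw b) (P k)" and Q: "L2w (invw b) (Q (k - 1))" if "k \<in> {1..n}" for k
    using prim that unfolding primitives_def by auto
  show ?thesis
  proof (intro conjI)
    obtain a :: "real \<Rightarrow> real" where "L2w (invw b) (\<lambda>x. complex_of_real (a x))" "\<And>x. 0 \<le> a x"
      "\<And>x t. 0 \<le> t \<Longrightarrow> t \<le> x \<Longrightarrow> x \<le> 1 \<Longrightarrow> cmod (Kker n P Q x t) \<le> a x + a t"
      using Kker_bound[of n P Q, OF P Q] by blast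
    then show "\<exists>a :: real \<Rightarrow> real. L2w (invw b) (\<lambda>x. complex_of_real (a x)) \<and>
            (\<forall>x t. 0 \<le> t \<and> t \<le> x \<and> x \<le> 1 \<longrightarrow> cmod (Kker n P Q x t) \<le> a x + a t)"
      by (intro exI[of _ a]) simp
    show "L2_bij b (Bop b (Kker n P Q))"
      using P Q by (rule L2_bij_Kker)
    show "\<exists>u :: nat \<Rightarrow> real \<Rightarrow> complex. (\<forall>\<nu><n. L2w (invw b) (u \<nu>)) \<and>
            (\<forall>Y. Wb b n Y \<longrightarrow> (\<forall>D. W0b b n D \<longrightarrow>
               ell n p0 p q Y D = (-1) ^ n * set_lebesgue_integral lebesgue {0..1}
                 (\<lambda>x. (Bop b (Kker n P Q) (Y n) x + (\<Sum>\<nu><n. Y \<nu> 0 * u \<nu> x)) * D n x)))"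
      by (rule ell_representation[OF prim b_sq[rule_format]])
    show "\<forall>P' Q'. primitives b n p q P' Q' \<longrightarrow>
            (AE x in lebesgue_on {0..1}. AE t in lebesgue_on {0..x}. Kker n P' Q' x t = Kker n P Q x t)"
      using Kker_independent[OF prim] by blast
  qed
qed

end
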